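(* $\lim_{n\to\infty}p_{1,LP}(\mathbb{Z}\times K_n)=4-2\sqrt{3}$.
   Context: For a graph $H$, a random graph model on $H$ is a probability measure $\mu$ on subsets of $E(H)$; $\mathbf{H}_\mu$ denotes the random spanning subgraph with edge set distributed according to $\mu$. $\mu$ is $1$-independent if for all sets $A,B\subseteq E(H)$ whose edges span disjoint vertex sets, $E(\mathbf{H}_\mu)\cap A$ and $E(\mathbf{H}_\mu)\cap B$ are independent. $\mathcal{M}_{1,p}(H)$ is the set of $1$-independent measures on $H$ in which each edge is present with probability exactly $p$. The long paths critical probability is $p_{1,LP}(H)=\inf\{p\in[0,1]:\ \forall\mu\in\mathcal{M}_{1,p}(H),\ \forall \ell\in\mathbb{N},\ \mathbb{P}[\mathbf{H}_\mu\text{ contains a path of length }\ell]>0\}$. $\mathbb{Z}$ is the two-way infinite path on the integers, $K_n$ the complete graph on $n$ vertices, and $\times$ the Cartesian product of graphs (vertices $(v_1,v_2)$, with $(u_1,u_2)\sim(v_1,v_2)$ iff either $u_1=v_1$ and $u_2v_2$ is an edge of the second factor, or $u_1v_1$ is an edge of the first factor and $u_2=v_2$). *)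

theory Defs
  imports "HOL-Probability.Probability"
begin

text \<open>A (simple) graph is a pair (V, E) of a vertex set and a set of edges,
  each edge being a two-element subset of V.\<close>

type_synonym 'v graph = "'v set \<times> 'v set set"

definition verts :: "'v graph \<Rightarrow> 'v set" where "verts G = fst G"
definition edges :: "'v graph \<Rightarrow> 'v set set" where "edges G = snd G"

definition Z_graph :: "int graph" where
  "Z_graph = (UNIV, {{i, i + 1} | i. True})"

definition K_graph :: "nat \<Rightarrow> nat graph" where
  "K_graph n = ({..<n}, {{a, b} | a b. a < n \<and> b < n \<and> a \<noteq> b})"

definition cart_prod :: "'a graph \<Rightarrow> 'b graph \<Rightarrow> ('a \<times> 'b) graph" where
  "cart_prod G H =
     (verts G \<times> verts H,
      {{(u1, u2), (v1, v2)} | u1 u2 v1 v2.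
         (u1 = v1 \<and> u1 \<in> verts G \<and> {u2, v2} \<in> edges H) \<or>
         ({u1, v1} \<in> edges G \<and> u2 = v2 \<and> u2 \<in> verts H)})"

definition edge_event :: "'v graph \<Rightarrow> 'v set \<Rightarrow> 'v set set set" where
  "edge_event H e = {S \<in> Pow (edges H). e \<in> S}"

text \<open>The sigma-algebra generated by the random variable  S \<mapsto> S \<inter> A.\<close>
definition edge_sigma :: "'v graph \<Rightarrow> 'v set set \<Rightarrow> 'v set set set set" where
  "edge_sigma H A = sigma_sets (Pow (edges H)) (edge_event H ` A)"

definition random_graph_model :: "'v graph \<Rightarrow> 'v set set measure \<Rightarrow> bool" where
  "random_graph_model H \<mu> \<longleftrightarrow>
     prob_space \<mu> \<and> space \<mu> = Pow (edges H) \<and> sets \<mu> = edge_sigma H (edges H)"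

definition one_independent :: "'v graph \<Rightarrow> 'v set set measure \<Rightarrow> bool" where
  "one_independent H \<mu> \<longleftrightarrow>
     (\<forall>A B. A \<subseteq> edges H \<longrightarrow> B \<subseteq> edges H \<longrightarrow> \<Union>A \<inter> \<Union>B = {} \<longrightarrow>
        prob_space.indep_set \<mu> (edge_sigma H A) (edge_sigma H B))"

definition M1p :: "'v graph \<Rightarrow> real \<Rightarrow> 'v set set measure set" where
  "M1p H p = {\<mu>. random_graph_model H \<mu> \<and> one_independent H \<mu> \<and>
                 (\<forall>e \<in> edges H. measure \<mu> (edge_event H e) = p)}"

definition path_event :: "'v graph \<Rightarrow> nat \<Rightarrow> 'v set set set" where
  "path_event H l = {S \<in> Pow (edges H). \<exists>vs. length vs = l + 1 \<and> distinct vs \<and>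
                        (\<forall>i < l. {vs ! i, vs ! (i + 1)} \<in> S)}"

definition p1LP :: "'v graph \<Rightarrow> real" where
  "p1LP H = Inf {p \<in> {0..1}. \<forall>\<mu> \<in> M1p H p. \<forall>l::nat. measure \<mu> (path_event H l) > 0}"

end

theory Submission
  imports Defs "HOL-Library.Transitive_Closure_Table"
begin

text \<open>Upper bound. In two adjacent layers call a component giant if it has more than half of the
  vertices, medium if it has at least \<open>\<eta> n\<close> but no more than half of them. Condition on the labels of a
  bounded set of columns such that the remaining labels are nearly uncorrelated, and let \<open>x v\<close>, \<open>z v\<close>
  (\<open>y v\<close>, \<open>w v\<close> in the other layer) be the conditional probabilities that column \<open>v\<close> is in a giant or a
  medium component. Counting edges gives \<open>x\<^sup>2 + z\<^sup>2 \<ge> p\<close>, \<open>x \<ge> z\<close>, \<open>x + z \<le> 1\<close> for almost all columns, up to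
  small errors, so \<open>(x, z)\<close> and \<open>(y, w)\<close> have norm at least \<open>sqrt p\<close> and lie in a cone of angle 30 degrees,
  whence \<open>x y + z w \<ge> sqrt 3 / 2 * p\<close>, which exceeds \<open>1 - p\<close>. If the giants of the two layers were not
  connected, at least this proportion of the rungs would have to be absent. Hence adjacent giants are
  connected with probability at least 3/4, and by 1-independence arbitrarily long chains of such events
  have positive probability.

  Lower bound. An explicit colouring of the vertices with period 4 in the layers confines every
  component to a bounded number of layers and has all edge probabilities at least \<open>4 - 2 * sqrt 3\<close>.\<close>

section \<open>Conditioning on a bounded set of labels\<close>

text \<open>The value \<open>4 - 2 * sqrt 3\<close> arises in two ways. On the line
  \<open>x + z = 1\<close> it is the squared norm at the point with \<open>x = sqrt 3 * z\<close>,
  that is at 30 degrees, and it also solves \<open>sqrt 3 / 2 * p = 1 - p\<close>. The colouring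
  realises both equalities: the colour classes have proportions
  \<open>((3 - sqrt 3) / 2, (sqrt 3 - 1) / 2)\<close> in layers congruent to 2 modulo 4 and
  \<open>(sqrt 3 - 1, 0)\<close> in odd layers, two vectors at 30 degrees.

  Labels in one layer may be strongly correlated, so their unconditional means need not satisfy the
  quadratic inequality; hence the conditioning. Column sets chosen from the conditional means depend
  only on the revealed labels, which take boundedly many values, so concentration for fixed sets
  suffices. Rungs are not independent of the layers they join; only their number is used, and it
  concentrates because distinct rungs are disjoint. The two layers are independent of each other, so
  components of one can serve as fixed test weights for the labels of the other.\<close>

abbreviation expct :: "'a pmf \<Rightarrow> ('a \<Rightarrow> real) \<Rightarrow> real" where
  "expct P f \<equiv> measure_pmf.expectation P f"

text \<open>Conditional expectation given \<open>q\<close>, as an explicit quotient. On fibres of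
  probability 0 it takes the value 0, so bounds such as \<open>cexp_nonneg\<close> and
  \<open>cexp_le_1\<close> hold at every point and not only almost surely.\<close>

definition cexp :: "'a pmf \<Rightarrow> ('a \<Rightarrow> 'k) \<Rightarrow> ('a \<Rightarrow> real) \<Rightarrow> 'a \<Rightarrow> real" where
  "cexp P q f w = expct P (\<lambda>w'. f w' * of_bool (q w' = q w)) / expct P (\<lambda>w'. of_bool (q w' = q w))"

lemma expct_sum:
  assumes "finite (set_pmf P)"
  shows "expct P f = (\<Sum>w\<in>set_pmf P. pmf P w * f w)"
  using integral_measure_pmf[OF assms, of P f] by simp

lemma integrable_finite_pmf:
  fixes f :: "'a \<Rightarrow> real"
  assumes "finite (set_pmf P)"
  shows "integrable (measure_pmf P) f"
  using assms by (rule integrable_measure_pmf_finite)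

lemma expct_mono:
  assumes "finite (set_pmf P)" "\<And>w. w \<in> set_pmf P \<Longrightarrow> f w \<le> g w"
  shows "expct P f \<le> expct P g"
  unfolding expct_sum[OF assms(1)] by (intro sum_mono mult_left_mono assms) auto

lemma expct_abs_le_sqrt:
  assumes "finite (set_pmf P)"
  shows "expct P (\<lambda>w. \<bar>f w\<bar>) \<le> sqrt (expct P (\<lambda>w. (f w)\<^sup>2))"
proof (rule real_le_rsqrt)
  have "(\<Sum>w\<in>set_pmf P. sqrt (pmf P w) * (sqrt (pmf P w) * \<bar>f w\<bar>))\<^sup>2
     \<le> (\<Sum>w\<in>set_pmf P. (sqrt (pmf P w))\<^sup>2) * (\<Sum>w\<in>set_pmf P. (sqrt (pmf P w) * \<bar>f w\<bar>)\<^sup>2)"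
    by (rule Cauchy_Schwarz_ineq_sum)
  moreover have "(\<Sum>w\<in>set_pmf P. (sqrt (pmf P w))\<^sup>2) = 1"
    using sum_pmf_eq_1[OF assms order_refl] by simp
  ultimately show "(expct P (\<lambda>w. \<bar>f w\<bar>))\<^sup>2 \<le> expct P (\<lambda>w. (f w)\<^sup>2)"
    unfolding expct_sum[OF assms]
    by (simp add: power_mult_distrib mult.assoc[symmetric] flip: power2_eq_square)
qed

lemma cexp_fiber: "q w = q w' \<Longrightarrow> cexp P q f w = cexp P q f w'"
  by (simp add: cexp_def)

text \<open>The characteristic property of conditional expectation. After exchanging the two
  summations, the inner sum is the mass \<open>D\<close> of a fibre; it cancels the denominator
  because \<open>b\<close> and \<open>D\<close> are constant on fibres.\<close>

lemma expct_cexp: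
  assumes fin: "finite (set_pmf P)" and b: "\<And>w w'. q w = q w' \<Longrightarrow> b w = b w'"
  shows "expct P (\<lambda>w. b w * cexp P q f w) = expct P (\<lambda>w. b w * f w)"
proof -
  let ?S = "set_pmf P"
  define D where "D w = (\<Sum>w'\<in>?S. pmf P w' * of_bool (q w' = q w))" for w
  have D: "D w > 0" if "w \<in> ?S" for w
  proof -
    have "pmf P w * of_bool (q w = q w) \<le> D w"
      unfolding D_def by (rule member_le_sum) (use that fin in auto)
    then show ?thesis using that by (simp add: set_pmf_iff) (smt (verit) pmf_nonneg)
  qed
  have "expct P (\<lambda>w. b w * cexp P q f w)
      = (\<Sum>w\<in>?S. \<Sum>w'\<in>?S. pmf P w * b w * (pmf P w' * (f w' * of_bool (q w' = q w))) / D w)"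
    unfolding cexp_def expct_sum[OF fin] D_def
    by (simp add: sum_distrib_left sum_divide_distrib mult.assoc)
  also have "\<dots> = (\<Sum>w'\<in>?S. \<Sum>w\<in>?S. pmf P w * b w * (pmf P w' * (f w' * of_bool (q w' = q w))) / D w)"
    by (rule sum.swap)
  also have "\<dots> = (\<Sum>w'\<in>?S. \<Sum>w\<in>?S. pmf P w' * (b w' * f w') / D w' * (pmf P w * of_bool (q w = q w')))"
  proof (intro sum.cong refl)
    fix w w'
    show "pmf P w * b w * (pmf P w' * (f w' * of_bool (q w' = q w))) / D w =
      pmf P w' * (b w' * f w') / D w' * (pmf P w * of_bool (q w = q w'))"
      using b[of w w'] by (auto simp: D_def)
  qed
  also have "\<dots> = (\<Sum>w'\<in>?S. pmf P w' * (b w' * f w') / D w' * D w')"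
    by (simp add: D_def sum_distrib_left)
  also have "\<dots> = (\<Sum>w'\<in>?S. pmf P w' * (b w' * f w'))"
    by (intro sum.cong refl) (use D in \<open>force\<close>)
  finally show ?thesis unfolding expct_sum[OF fin] .
qed

lemma cexp_nonneg:
  assumes "\<And>w. f w \<ge> 0"
  shows "cexp P q f w \<ge> 0"
  unfolding cexp_def by (intro divide_nonneg_nonneg integral_nonneg) (auto simp: assms)

lemma cexp_add:
  assumes fin: "finite (set_pmf P)"
  shows "cexp P q (\<lambda>w. f w + g w) w = cexp P q f w + cexp P q g w"
  unfolding cexp_def expct_sum[OF fin]
  by (simp add: algebra_simps sum.distrib add_divide_distrib)

lemma cexp_le_1:
  assumes fin: "finite (set_pmf P)" and f: "\<And>w. f w \<le> 1"
  shows "cexp P q f w \<le> 1"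
proof -
  have "expct P (\<lambda>w'. f w' * of_bool (q w' = q w)) \<le> expct P (\<lambda>w'. of_bool (q w' = q w))"
    by (rule expct_mono[OF fin]) (use f in auto)
  moreover have "expct P (\<lambda>w'. of_bool (q w' = q w)) \<ge> (0::real)" by simp
  ultimately show ?thesis unfolding cexp_def by (auto simp: divide_le_eq_1 less_le)
qed

text \<open>Projections onto nested spaces: the cross term \<open>cexp P q f * cexp P q' f\<close>
  has the same expectation as the square of the coarser projection, so refining the key raises the
  energy by exactly the squared distance.\<close>

lemma cexp_pythagoras:
  assumes fin: "finite (set_pmf P)" and qq: "\<And>w w'. q' w = q' w' \<Longrightarrow> q w = q w'"
  shows "expct P (\<lambda>w. (cexp P q' f w - cexp P q f w)\<^sup>2)
       = expct P (\<lambda>w. (cexp P q' f w)\<^sup>2) - expct P (\<lambda>w. (cexp P q f w)\<^sup>2)"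
proof -
  note I[simp] = integrable_finite_pmf[OF fin]
  have "expct P (\<lambda>w. cexp P q f w * cexp P q' f w) = expct P (\<lambda>w. cexp P q f w * f w)"
    by (rule expct_cexp[OF fin]) (use qq in \<open>metis cexp_fiber\<close>)
  also have "\<dots> = expct P (\<lambda>w. cexp P q f w * cexp P q f w)"
    by (rule expct_cexp[OF fin, symmetric]) (metis cexp_fiber)
  finally show ?thesis
    by (simp add: power2_diff power2_eq_square algebra_simps)
qed

text \<open>Conditioning on the labels of a set \<open>T\<close> that maximises the energy minus a penalty
  proportional to the size of \<open>T\<close> leaves labels that are nearly uncorrelated on average.\<close>

lemma pinning:
  fixes P :: "'a pmf" and F :: "'i \<Rightarrow> 'a \<Rightarrow> bool"
  defines "f \<equiv> \<lambda>i w. of_bool (F i w) :: real"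
  defines "q \<equiv> \<lambda>T w. {i \<in> T. F i w}"
  assumes fin: "finite (set_pmf P)" and I: "finite I" and k: "k > 0"
  shows "\<exists>T\<subseteq>I. real (card T) \<le> 1 / k\<^sup>2 \<and>
    (\<forall>a. (\<forall>K i. \<bar>a K i\<bar> \<le> 1) \<longrightarrow>
      expct P (\<lambda>w. (\<Sum>i\<in>I. a (q T w) i * (f i w - cexp P (q T) (f i) w))\<^sup>2) \<le> k * (real (card I))\<^sup>2)"
proof (cases "I = {}")
  case True
  then show ?thesis using k by (intro exI[of _ "{}"]) auto
next
  case False
  define N where "N = real (card I)"
  have N: "N > 0" using False I by (simp add: N_def card_gt_0_iff)
  note J[simp] = integrable_finite_pmf[OF fin]
  define \<Phi> where "\<Phi> T = (\<Sum>i\<in>I. expct P (\<lambda>w. (cexp P (q T) (f i) w)\<^sup>2))" for T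
  have f01: "f i w \<ge> 0" "f i w \<le> 1" for i w by (auto simp: f_def)
  have c01: "cexp P (q T) (f i) w \<ge> 0" "cexp P (q T) (f i) w \<le> 1" for i w T
    by (auto intro!: cexp_nonneg cexp_le_1 fin f01)
  have Phi0: "\<Phi> T \<ge> 0" for T unfolding \<Phi>_def by (intro sum_nonneg integral_nonneg) auto
  have Phi1: "\<Phi> T \<le> N" for T
  proof -
    have "expct P (\<lambda>w. (cexp P (q T) (f i) w)\<^sup>2) \<le> expct P (\<lambda>w. 1)" for i
      by (rule expct_mono[OF fin]) (use c01 in \<open>auto simp: power_le_one\<close>)
    then have "\<Phi> T \<le> (\<Sum>i\<in>I. 1)" unfolding \<Phi>_def by (intro sum_mono) auto
    then show ?thesis by (simp add: N_def)
  qed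
  \<comment> \<open>The energy never exceeds \<open>N\<close>, so at a price of
    \<open>k\<^sup>2 * N\<close> per revealed label a maximiser has at most
    \<open>1 / k\<^sup>2\<close> labels, and one further label gains at most this price.\<close>
  define \<Psi> where "\<Psi> T = \<Phi> T - k\<^sup>2 * N * real (card T)" for T
  have "finite (Pow I)" "Pow I \<noteq> {}" using I by auto
  then have "Max (\<Psi> ` Pow I) \<in> \<Psi> ` Pow I" by (intro Max_in) auto
  then obtain T where T: "T \<in> Pow I" and "\<Psi> T = Max (\<Psi> ` Pow I)" by force
  then have max: "\<Psi> T' \<le> \<Psi> T" if "T' \<in> Pow I" for T'
    using Max_ge[of "\<Psi> ` Pow I"] that I by simp
  have "k\<^sup>2 * N * real (card T) \<le> N" using max[of "{}"] Phi0[of "{}"] Phi1[of T] by (simp add: \<Psi>_def)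
  then have cT: "real (card T) \<le> 1 / k\<^sup>2" using N k by (simp add: field_simps)
  have inc: "\<Phi> (insert j T) - \<Phi> T \<le> k\<^sup>2 * N" if j: "j \<in> I" for j
  proof (cases "j \<in> T")
    case True then show ?thesis using N by (simp add: insert_absorb)
  next
    case False
    have "finite T" using T I finite_subset by auto
    then have "card (insert j T) = Suc (card T)" using False by simp
    then show ?thesis using max[of "insert j T"] T j by (simp add: \<Psi>_def algebra_simps)
  qed
  define x where "x i = cexp P (q T) (f i)" for i
  define m where "m i j w = cexp P (q (insert j T)) (f i) w - x i w" for i j w
  have qsub: "q (insert j T) w = q (insert j T) w' \<Longrightarrow> q T w = q T w'" for j w w'
    by (auto simp: q_def)
  have msq: "(\<Sum>i\<in>I. expct P (\<lambda>w. (m i j w)\<^sup>2)) = \<Phi> (insert j T) - \<Phi> T" for j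
    unfolding \<Phi>_def m_def x_def
    by (simp add: cexp_pythagoras[where q' = "q (insert j T)" and q = "q T", OF fin qsub] sum_subtractf)
  \<comment> \<open>\<open>m i j\<close> is the shift of the mean of label \<open>i\<close> when
    label \<open>j\<close> is revealed. By maximality the squared shifts over all
    \<open>N\<^sup>2\<close> pairs add up to at most \<open>N * (k\<^sup>2 * N)\<close>, and
    Cauchy-Schwarz over the pairs gives \<open>k * N\<^sup>2\<close>.\<close>
  have m1: "(\<Sum>i\<in>I. \<Sum>j\<in>I. expct P (\<lambda>w. \<bar>m i j w\<bar>)) \<le> k * N\<^sup>2"
  proof -
    have "(\<Sum>z\<in>I\<times>I. 1 * expct P (\<lambda>w. \<bar>m (fst z) (snd z) w\<bar>))\<^sup>2
        \<le> (\<Sum>z\<in>I\<times>I. 1\<^sup>2) * (\<Sum>z\<in>I\<times>I. (expct P (\<lambda>w. \<bar>m (fst z) (snd z) w\<bar>))\<^sup>2)"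
      by (rule Cauchy_Schwarz_ineq_sum)
    also have "\<dots> \<le> N\<^sup>2 * (\<Sum>z\<in>I\<times>I. expct P (\<lambda>w. (m (fst z) (snd z) w)\<^sup>2))"
    proof (intro mult_mono sum_mono)
      fix z
      have "expct P (\<lambda>w. \<bar>m (fst z) (snd z) w\<bar>) \<le> sqrt (expct P (\<lambda>w. (m (fst z) (snd z) w)\<^sup>2))"
        by (rule expct_abs_le_sqrt[OF fin])
      moreover have "0 \<le> expct P (\<lambda>w. \<bar>m (fst z) (snd z) w\<bar>)" by simp
      ultimately have "(expct P (\<lambda>w. \<bar>m (fst z) (snd z) w\<bar>))\<^sup>2 \<le> (sqrt (expct P (\<lambda>w. (m (fst z) (snd z) w)\<^sup>2)))\<^sup>2"
        by (rule power_mono)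
      then show "(expct P (\<lambda>w. \<bar>m (fst z) (snd z) w\<bar>))\<^sup>2 \<le> expct P (\<lambda>w. (m (fst z) (snd z) w)\<^sup>2)"
        by simp
    qed (auto simp: N_def power2_eq_square card_cartesian_product intro!: sum_nonneg)
    also have "(\<Sum>z\<in>I\<times>I. expct P (\<lambda>w. (m (fst z) (snd z) w)\<^sup>2)) = (\<Sum>j\<in>I. \<Sum>i\<in>I. expct P (\<lambda>w. (m i j w)\<^sup>2))"
      unfolding sum.cartesian_product' by (subst sum.swap) simp
    also have "\<dots> \<le> (\<Sum>j\<in>I. k\<^sup>2 * N)" by (intro sum_mono) (simp add: msq inc)
    also have "N\<^sup>2 * (\<Sum>j\<in>I. k\<^sup>2 * N) = (k * N\<^sup>2)\<^sup>2" by (simp add: N_def power2_eq_square)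
    finally have "(\<Sum>z\<in>I\<times>I. 1 * expct P (\<lambda>w. \<bar>m (fst z) (snd z) w\<bar>))\<^sup>2 \<le> (k * N\<^sup>2)\<^sup>2"
      by (simp only: mult_left_mono[OF _ zero_le_power2])
    then have "(\<Sum>z\<in>I\<times>I. 1 * expct P (\<lambda>w. \<bar>m (fst z) (snd z) w\<bar>)) \<le> k * N\<^sup>2"
      by (rule power2_le_imp_le) (use k N in auto)
    then show ?thesis by (simp add: sum.cartesian_product')
  qed
  have main: "expct P (\<lambda>w. (\<Sum>i\<in>I. a (q T w) i * (f i w - x i w))\<^sup>2) \<le> k * N\<^sup>2"
    if a: "\<And>K i. \<bar>a K i\<bar> \<le> 1" for a
  proof -
    define e where "e i w = f i w - x i w" for i w
    have e0: "expct P (\<lambda>w. b w * e i w) = 0" if b: "\<And>w w'. q T w = q T w' \<Longrightarrow> b w = b w'" for b i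
    proof -
      have "expct P (\<lambda>w. b w * x i w) = expct P (\<lambda>w. b w * f i w)"
        unfolding x_def by (rule expct_cexp[OF fin]) (rule b)
      then show ?thesis by (simp add: e_def right_diff_distrib)
    qed
    have "expct P (\<lambda>w. (\<Sum>i\<in>I. a (q T w) i * e i w)\<^sup>2)
        = (\<Sum>i\<in>I. \<Sum>j\<in>I. expct P (\<lambda>w. (a (q T w) i * e i w) * (a (q T w) j * e j w)))"
      by (simp add: power2_eq_square sum_product)
    also have "\<dots> \<le> (\<Sum>i\<in>I. \<Sum>j\<in>I. expct P (\<lambda>w. \<bar>m i j w\<bar>))"
    proof (intro sum_mono)
      fix i j
      let ?b = "\<lambda>w. a (q T w) i * a (q T w) j"
      \<comment> \<open>Weights and means are functions of \<open>q T\<close>, to which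
        \<open>e i\<close> is orthogonal, so only the part with \<open>f j\<close> survives. That
        part is a function of \<open>q (insert j T)\<close>, and conditioning on this finer key
        turns \<open>e i\<close> into the shift \<open>m i j\<close>.\<close>
      have "expct P (\<lambda>w. (a (q T w) i * e i w) * (a (q T w) j * e j w))
          = expct P (\<lambda>w. (?b w * f j w) * e i w) - expct P (\<lambda>w. (?b w * x j w) * e i w)"
        by (subst Bochner_Integration.integral_diff[symmetric])
           (auto simp: e_def algebra_simps)
      also have "expct P (\<lambda>w. (?b w * x j w) * e i w) = 0"
        by (rule e0) (simp add: x_def, metis cexp_fiber)
      also have "expct P (\<lambda>w. (?b w * f j w) * e i w)
          = expct P (\<lambda>w. (?b w * f j w) * f i w) - expct P (\<lambda>w. (?b w * f j w) * x i w)"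
        by (simp add: e_def right_diff_distrib)
      also have "expct P (\<lambda>w. (?b w * f j w) * f i w)
          = expct P (\<lambda>w. (?b w * f j w) * cexp P (q (insert j T)) (f i) w)"
      proof (rule expct_cexp[OF fin, symmetric])
        fix w w' assume eq: "q (insert j T) w = q (insert j T) w'"
        have "F j w = F j w'" using eq by (auto simp: q_def)
        then show "?b w * f j w = ?b w' * f j w'" using qsub[OF eq] by (simp add: f_def)
      qed
      also have "\<dots> - expct P (\<lambda>w. (?b w * f j w) * x i w) = expct P (\<lambda>w. (?b w * f j w) * m i j w)"
        by (simp add: m_def right_diff_distrib)
      finally have "expct P (\<lambda>w. (a (q T w) i * e i w) * (a (q T w) j * e j w)) = expct P (\<lambda>w. (?b w * f j w) * m i j w)"
        by simp
      also have "\<dots> \<le> expct P (\<lambda>w. \<bar>m i j w\<bar>)"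
      proof (rule expct_mono[OF fin])
        fix w
        have "\<bar>?b w * f j w\<bar> \<le> 1 * 1 * 1"
          unfolding abs_mult by (intro mult_mono a) (auto simp: f_def)
        then have "\<bar>?b w * f j w\<bar> * \<bar>m i j w\<bar> \<le> 1 * \<bar>m i j w\<bar>" by (intro mult_right_mono) auto
        then show "?b w * f j w * m i j w \<le> \<bar>m i j w\<bar>" by (simp add: abs_mult[symmetric])
      qed
      finally show "expct P (\<lambda>w. (a (q T w) i * e i w) * (a (q T w) j * e j w)) \<le> expct P (\<lambda>w. \<bar>m i j w\<bar>)" .
    qed
    also note m1
    finally show ?thesis by (simp add: e_def)
  qed
  show ?thesis
    using T cT main unfolding x_def N_def by (intro exI[of _ T]) auto
qed

section \<open>Components of a random layer\<close>

definition reach :: "(nat \<times> nat) set \<Rightarrow> nat \<Rightarrow> nat set" where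
  "reach A u = A\<^sup>* `` {u}"

text \<open>The labels are real-valued indicators, ready for sums and averages. A component with
  more than half of the vertices is unique, so \<open>giant\<close> marks a single component,
  whereas \<open>medium\<close> merges all components of intermediate size.\<close>

definition giant :: "nat \<Rightarrow> (nat \<times> nat) set \<Rightarrow> nat \<Rightarrow> real" where
  "giant n A v = of_bool (v < n \<and> n < 2 * card (reach A v))"

definition medium :: "real \<Rightarrow> nat \<Rightarrow> (nat \<times> nat) set \<Rightarrow> nat \<Rightarrow> real" where
  "medium \<eta> n A v = of_bool (v < n \<and> 2 * card (reach A v) \<le> n \<and> \<eta> * n \<le> card (reach A v))"

definition graph_on :: "nat \<Rightarrow> (nat \<times> nat) set \<Rightarrow> bool" where
  "graph_on n A \<longleftrightarrow> A \<subseteq> {..<n} \<times> {..<n} \<and> sym A"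

lemma reach_subset:
  assumes "graph_on n A" "u < n"
  shows "reach A u \<subseteq> {..<n}"
proof
  fix v assume "v \<in> reach A u"
  then have "(u, v) \<in> A\<^sup>*" by (simp add: reach_def)
  then show "v \<in> {..<n}"
    by (induction rule: rtrancl_induct) (use assms in \<open>auto simp: graph_on_def\<close>)
qed

lemma finite_reach: "graph_on n A \<Longrightarrow> u < n \<Longrightarrow> finite (reach A u)"
  using reach_subset finite_subset[OF _ finite_lessThan] by metis

lemma reach_self: "u \<in> reach A u"
  by (simp add: reach_def)

lemma reach_eq:
  assumes "graph_on n A" "v \<in> reach A u"
  shows "reach A v = reach A u"
proof -
  have s: "sym (A\<^sup>*)" using assms(1) by (simp add: graph_on_def sym_rtrancl)
  have uv: "(u, v) \<in> A\<^sup>*" using assms(2) by (simp add: reach_def)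
  then have "(v, u) \<in> A\<^sup>*" using s by (meson symD)
  with uv show ?thesis unfolding reach_def by (auto intro: rtrancl_trans)
qed

lemma reach_sym: "graph_on n A \<Longrightarrow> v \<in> reach A u \<longleftrightarrow> u \<in> reach A v"
  using reach_eq reach_self by metis

lemma reach_edge: "(u, v) \<in> A \<Longrightarrow> v \<in> reach A u"
  by (auto simp: reach_def)

lemma giant_reach:
  assumes A: "graph_on n A" and "giant n A u = 1" "giant n A v = 1"
  shows "v \<in> reach A u"
proof -
  have u: "u < n" "n < 2 * card (reach A u)" and v: "v < n" "n < 2 * card (reach A v)"
    using assms by (auto simp: giant_def split: if_splits)
  have "reach A u \<inter> reach A v \<noteq> {}"
  proof
    assume "reach A u \<inter> reach A v = {}"
    then have "card (reach A u) + card (reach A v) = card (reach A u \<union> reach A v)"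
      using finite_reach[OF A] u v by (simp add: card_Un_disjoint)
    also have "\<dots> \<le> card {..<n}"
      by (rule card_mono) (use reach_subset[OF A] u v in auto)
    finally show False using u v by simp
  qed
  then obtain w where "w \<in> reach A u" "w \<in> reach A v" by auto
  then have "reach A u = reach A v" using reach_eq[OF A] by metis
  then show ?thesis using reach_self by blast
qed

text \<open>An edge stays inside one component, so its ends are both giant, both medium, or both in
  a component with fewer than \<open>\<eta> * n\<close> vertices; the last kind gives each
  \<open>u\<close> fewer than \<open>\<eta> * n\<close> partners. Pairs from different medium
  components are merely overcounted.\<close>

lemma edges_le_labels:
  assumes A: "graph_on n A" and U: "U \<subseteq> {..<n}" and eta: "\<eta> \<ge> 0"
  shows "(\<Sum>u\<in>U. \<Sum>v\<in>U. of_bool ((u, v) \<in> A))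
    \<le> (\<Sum>u\<in>U. giant n A u)\<^sup>2 + (\<Sum>u\<in>U. medium \<eta> n A u)\<^sup>2 + \<eta> * (real n)\<^sup>2"
proof -
  have fU: "finite U" using U finite_subset by blast
  define d where "d u v = (of_bool (v \<in> reach A u \<and> card (reach A u) < \<eta> * n) :: real)" for u v
  have "of_bool ((u, v) \<in> A) \<le> giant n A u * giant n A v + medium \<eta> n A u * medium \<eta> n A v + d u v"
    if "u \<in> U" "v \<in> U" for u v
  proof (cases "(u, v) \<in> A")
    case True
    then have v: "v \<in> reach A u" by (rule reach_edge)
    then have "reach A v = reach A u" using reach_eq[OF A] by simp
    moreover have "u < n" "v < n" using that U by auto
    ultimately show ?thesis using v True by (auto simp: giant_def medium_def d_def)
  qed (auto simp: giant_def medium_def d_def)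
  then have "(\<Sum>u\<in>U. \<Sum>v\<in>U. of_bool ((u, v) \<in> A))
      \<le> (\<Sum>u\<in>U. \<Sum>v\<in>U. giant n A u * giant n A v + medium \<eta> n A u * medium \<eta> n A v + d u v)"
    by (intro sum_mono)
  also have "\<dots> = (\<Sum>u\<in>U. giant n A u)\<^sup>2 + (\<Sum>u\<in>U. medium \<eta> n A u)\<^sup>2 + (\<Sum>u\<in>U. \<Sum>v\<in>U. d u v)"
    by (simp add: sum.distrib power2_eq_square sum_product)
  also have "(\<Sum>u\<in>U. \<Sum>v\<in>U. d u v) \<le> (\<Sum>u\<in>U. \<eta> * n)"
  proof (intro sum_mono)
    fix u assume "u \<in> U"
    then have u: "u < n" using U by auto
    show "(\<Sum>v\<in>U. d u v) \<le> \<eta> * n"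
    proof (cases "card (reach A u) < \<eta> * n")
      case True
      have "(\<Sum>v\<in>U. d u v) = real (card (U \<inter> reach A u))"
        using True fU by (simp add: d_def of_bool_def sum.If_cases Int_def)
      also have "\<dots> \<le> card (reach A u)"
        using finite_reach[OF A u] by (simp add: card_mono)
      finally show ?thesis using True by simp
    qed (use eta in \<open>auto simp: d_def\<close>)
  qed
  also have "\<dots> \<le> n * (\<eta> * n)"
    using card_mono[OF finite_lessThan U] eta by (simp add: mult_right_mono)
  finally show ?thesis by (simp add: power2_eq_square algebra_simps)
qed

text \<open>The neighbours of \<open>u\<close> lie in its component. A medium component has at most
  half of the vertices and is disjoint from the giant, hence at most \<open>n - G\<close> vertices;
  the maximum in \<open>G\<close> covers layers without a giant.\<close>

lemma degree_le_labels:
  assumes A: "graph_on n A" and u: "u < n" and eta: "\<eta> \<ge> 0"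
    and G: "G = max (\<Sum>v<n. giant n A v) (n / 2)"
  shows "(\<Sum>v<n. of_bool ((u, v) \<in> A)) \<le> giant n A u * G + medium \<eta> n A u * (n - G) + \<eta> * n"
proof -
  have "(\<Sum>v<n. of_bool ((u, v) \<in> A)) \<le> (\<Sum>v<n. of_bool (v \<in> reach A u) :: real)"
    by (intro sum_mono) (auto dest: reach_edge)
  also have "\<dots> = real (card ({..<n} \<inter> reach A u))"
    by (simp add: of_bool_def sum.If_cases Int_def)
  also have "{..<n} \<inter> reach A u = reach A u" using reach_subset[OF A u] by auto
  finally have le: "(\<Sum>v<n. of_bool ((u, v) \<in> A)) \<le> real (card (reach A u))" .
  define S where "S = {v. v < n \<and> n < 2 * card (reach A v)}"
  have S: "(\<Sum>v<n. giant n A v) = real (card S)"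
  proof -
    have "(\<Sum>v<n. giant n A v) = real (card ({..<n} \<inter> {v. n < 2 * card (reach A v)}))"
      by (simp add: giant_def of_bool_def sum.If_cases Int_def)
    also have "{..<n} \<inter> {v. n < 2 * card (reach A v)} = S" by (auto simp: S_def)
    finally show ?thesis .
  qed
  have fS: "finite S" "S \<subseteq> {..<n}" by (auto simp: S_def)
  have cS: "card S \<le> n" using card_mono[OF finite_lessThan fS(2)] by simp
  then have G': "n / 2 \<le> G" "G \<le> n" "card S \<le> G" by (auto simp: G S)
  show ?thesis
  proof (cases "n < 2 * card (reach A u)")
    case True
    have "reach A u \<subseteq> S"
    proof
      fix v assume v: "v \<in> reach A u"
      then have "reach A v = reach A u" using reach_eq[OF A] by simp
      then show "v \<in> S" using True v reach_subset[OF A u] by (auto simp: S_def)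
    qed
    then have "card (reach A u) \<le> card S" using fS by (simp add: card_mono)
    moreover have "giant n A u = 1" "medium \<eta> n A u = 0" using True u by (auto simp: giant_def medium_def)
    moreover have "\<eta> * real n \<ge> 0" using eta by simp
    ultimately show ?thesis using le G' by simp
  next
    case False
    have g: "giant n A u = 0" using False by (simp add: giant_def)
    show ?thesis
    proof (cases "\<eta> * n \<le> card (reach A u)")
      case True
      have "reach A u \<inter> S = {}"
      proof (rule ccontr)
        assume "reach A u \<inter> S \<noteq> {}"
        then obtain v where v: "v \<in> reach A u" "v \<in> S" by auto
        then have "reach A v = reach A u" using reach_eq[OF A] by simp
        then show False using v False by (simp add: S_def)
      qed
      then have "card (reach A u) + card S = card (reach A u \<union> S)"
        using finite_reach[OF A u] fS by (simp add: card_Un_disjoint)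
      also have "\<dots> \<le> card {..<n}"
        by (rule card_mono) (use reach_subset[OF A u] fS in auto)
      finally have "card (reach A u) + card S \<le> n" by simp
      then have "real (card (reach A u)) \<le> n - G" using False by (auto simp: G S max_def)
      moreover have "medium \<eta> n A u = 1" using False True u by (simp add: medium_def)
      moreover have "\<eta> * real n \<ge> 0" using eta by simp
      ultimately show ?thesis using le g by simp
    next
      case False2: False
      then have "medium \<eta> n A u = 0" by (simp add: medium_def)
      then show ?thesis using le g False2 by simp
    qed
  qed
qed

section \<open>Concentration of edge counts in one layer\<close>

text \<open>When the square is expanded, only the pairs in \<open>B\<close> can contribute, each at
  most 1; the first absolute moment is at most the root of the second moment.\<close>

lemma second_moment:
  fixes X :: "'i \<Rightarrow> 'a \<Rightarrow> real"
  assumes fin: "finite (set_pmf P)" and D: "finite D" and B: "B \<subseteq> D \<times> D"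
    and X: "\<And>d w. \<bar>X d w\<bar> \<le> 1" and a: "\<And>d. \<bar>a d\<bar> \<le> 1"
    and z: "\<And>d d'. d \<in> D \<Longrightarrow> d' \<in> D \<Longrightarrow> (d, d') \<notin> B \<Longrightarrow> expct P (\<lambda>w. X d w * X d' w) = 0"
  shows "expct P (\<lambda>w. \<bar>\<Sum>d\<in>D. a d * X d w\<bar>) \<le> sqrt (card B)"
proof -
  note J[simp] = integrable_finite_pmf[OF fin]
  have "expct P (\<lambda>w. (\<Sum>d\<in>D. a d * X d w)\<^sup>2)
     = (\<Sum>d\<in>D. \<Sum>d'\<in>D. a d * a d' * expct P (\<lambda>w. X d w * X d' w))"
  proof -
    have "(\<Sum>d\<in>D. a d * X d w)\<^sup>2 = (\<Sum>d\<in>D. \<Sum>d'\<in>D. (a d * a d') * (X d w * X d' w))" for w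
      unfolding power2_eq_square sum_product by (intro sum.cong refl) (simp only: mult_ac)
    then show ?thesis by simp
  qed
  also have "\<dots> \<le> (\<Sum>d\<in>D. \<Sum>d'\<in>D. of_bool ((d, d') \<in> B))"
  proof (intro sum_mono)
    fix d d' assume d: "d \<in> D" "d' \<in> D"
    show "a d * a d' * expct P (\<lambda>w. X d w * X d' w) \<le> of_bool ((d, d') \<in> B)"
    proof (cases "(d, d') \<in> B")
      case True
      have "a d * a d' * (X d w * X d' w) \<le> 1" for w
      proof -
        have "\<bar>a d * a d' * (X d w * X d' w)\<bar> \<le> 1 * 1 * (1 * 1)"
          unfolding abs_mult by (intro mult_mono X a) auto
        then show ?thesis by simp
      qed
      then have "expct P (\<lambda>w. a d * a d' * (X d w * X d' w)) \<le> expct P (\<lambda>w. 1)"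
        by (intro expct_mono[OF fin])
      then show ?thesis using True by simp
    qed (use z d in simp)
  qed
  also have "\<dots> = (\<Sum>z\<in>D\<times>D. of_bool (z \<in> B))" by (simp add: sum.cartesian_product')
  also have "\<dots> = real (card ((D \<times> D) \<inter> B))"
    using D by (simp add: of_bool_def sum.If_cases Int_def)
  also have "(D \<times> D) \<inter> B = B" using B by auto
  finally have "expct P (\<lambda>w. (\<Sum>d\<in>D. a d * X d w)\<^sup>2) \<le> card B" .
  then show ?thesis
    using expct_abs_le_sqrt[OF fin, of "\<lambda>w. \<Sum>d\<in>D. a d * X d w"]
    by (meson order_trans real_sqrt_le_mono)
qed

text \<open>What 1-independence provides inside a single layer: disjoint edges are pairwise
  independent, while edges with a common vertex may depend on each other arbitrarily.\<close>

definition layer_law :: "nat \<Rightarrow> real \<Rightarrow> (nat \<times> nat) set pmf \<Rightarrow> bool" where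
  "layer_law n p P \<longleftrightarrow> (\<forall>A\<in>set_pmf P. graph_on n A) \<and>
     (\<forall>u<n. \<forall>v<n. u \<noteq> v \<longrightarrow> measure_pmf.prob P {A. (u, v) \<in> A} = p) \<and>
     (\<forall>u<n. \<forall>v<n. \<forall>u'<n. \<forall>v'<n. u \<noteq> v \<longrightarrow> u' \<noteq> v' \<longrightarrow> {u, v} \<inter> {u', v'} = {} \<longrightarrow>
        measure_pmf.prob P {A. (u, v) \<in> A \<and> (u', v') \<in> A} = p\<^sup>2)"

lemma layer_law_finite:
  assumes "layer_law n p P"
  shows "finite (set_pmf P)"
proof (rule finite_subset)
  show "set_pmf P \<subseteq> Pow ({..<n} \<times> {..<n})"
    using assms by (auto simp: layer_law_def graph_on_def)
qed auto

lemma expct_of_bool: "expct P (\<lambda>w. of_bool (Q w)) = measure_pmf.prob P {w. Q w}"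
proof -
  have "(\<lambda>w. of_bool (Q w) :: real) = indicator {w. Q w}" by (auto simp: indicator_def)
  then show ?thesis by simp
qed

lemma covariance_zero:
  assumes fin: "finite (set_pmf P)"
    and "measure_pmf.prob P {w. Q w} = p" "measure_pmf.prob P {w. R w} = p"
    and "measure_pmf.prob P {w. Q w \<and> R w} = p\<^sup>2"
  shows "expct P (\<lambda>w. (of_bool (Q w) - p) * (of_bool (R w) - p)) = 0"
proof -
  note J[simp] = integrable_finite_pmf[OF fin]
  have "expct P (\<lambda>w. (of_bool (Q w) - p) * (of_bool (R w) - p))
    = expct P (\<lambda>w. of_bool (Q w \<and> R w) - p * of_bool (Q w) - p * of_bool (R w) + p * p)"
    by (intro Bochner_Integration.integral_cong) (auto simp: algebra_simps)
  also have "\<dots> = p\<^sup>2 - p * p - p * p + p * p"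
    using assms(2-4) by (simp add: expct_of_bool del: of_bool_conj)
  finally show ?thesis by (simp add: power2_eq_square)
qed

text \<open>Two ordered pairs with a common vertex coincide in one of four patterns, each with three
  free vertices. So at most \<open>4 * n ^ 3\<close> of the roughly \<open>n ^ 4\<close> products
  are correlated, and the error is of smaller order than \<open>n\<^sup>2\<close>.\<close>

lemma layer_concentration:
  assumes L: "layer_law n p P" and p: "0 \<le> p" "p \<le> 1" and a: "\<And>d. \<bar>a d\<bar> \<le> 1"
  shows "expct P (\<lambda>A. \<bar>\<Sum>d\<in>{d\<in>{..<n}\<times>{..<n}. fst d \<noteq> snd d}. a d * (of_bool (d \<in> A) - p)\<bar>)
     \<le> 2 * sqrt (real n ^ 3)"
proof -
  let ?D = "{d\<in>{..<n}\<times>{..<n}. fst d \<noteq> snd d}"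
  define B where "B = {(d, d'). d \<in> ?D \<and> d' \<in> ?D \<and> {fst d, snd d} \<inter> {fst d', snd d'} \<noteq> {}}"
  have fin: "finite (set_pmf P)" by (rule layer_law_finite[OF L])
  have "expct P (\<lambda>A. \<bar>\<Sum>d\<in>?D. a d * (of_bool (d \<in> A) - p)\<bar>) \<le> sqrt (card B)"
  proof (rule second_moment[OF fin _ _ _ a])
    fix d d' assume d: "d \<in> ?D" "d' \<in> ?D" "(d, d') \<notin> B"
    obtain u v u' v' where [simp]: "d = (u, v)" "d' = (u', v')" by (cases d, cases d')
    show "expct P (\<lambda>w. (of_bool (d \<in> w) - p) * (of_bool (d' \<in> w) - p)) = 0"
      by (rule covariance_zero[OF fin]) (use L d in \<open>auto simp: layer_law_def B_def\<close>)
  qed (use p in \<open>auto simp: B_def\<close>)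
  also have "real (card B) \<le> 4 * real n ^ 3"
  proof -
    let ?N = "{..<n} \<times> {..<n} \<times> {..<n}"
    have "B \<subseteq> (\<lambda>(u,v,w). ((u,v),(u,w))) ` ?N \<union> (\<lambda>(u,v,w). ((u,v),(w,u))) ` ?N
       \<union> (\<lambda>(u,v,w). ((u,v),(v,w))) ` ?N \<union> (\<lambda>(u,v,w). ((u,v),(w,v))) ` ?N" (is "_ \<subseteq> ?a \<union> ?b \<union> ?c \<union> ?d")
      by (fastforce simp: B_def image_iff)
    then have "card B \<le> card (?a \<union> ?b \<union> ?c \<union> ?d)" by (intro card_mono) auto
    also have "\<dots> \<le> card ?a + card ?b + card ?c + card ?d"
      by (meson add_mono card_Un_le order.trans order_refl)
    also have "\<dots> \<le> card ?N + card ?N + card ?N + card ?N"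
      by (intro add_mono card_image_le) auto
    also have "\<dots> = 4 * n ^ 3" by (simp add: card_cartesian_product power3_eq_cube)
    finally show ?thesis by (metis of_nat_le_iff of_nat_mult of_nat_numeral of_nat_power)
  qed
  then have "sqrt (real (card B)) \<le> 2 * sqrt (real n ^ 3)"
    by (metis real_sqrt_four real_sqrt_le_iff real_sqrt_mult)
  finally show ?thesis .
qed

lemma giant_bounds: "0 \<le> giant n A v" "giant n A v \<le> 1"
  by (auto simp: giant_def)

lemma medium_bounds: "0 \<le> medium \<eta> n A v" "medium \<eta> n A v \<le> 1"
  by (auto simp: medium_def)

lemma giant_medium_le_1: "giant n A v + medium \<eta> n A v \<le> 1"
  by (auto simp: giant_def medium_def)

lemma sum_unit_bounds:
  fixes f :: "nat \<Rightarrow> real"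
  assumes "U \<subseteq> {..<n}" "\<And>v. 0 \<le> f v" "\<And>v. f v \<le> 1"
  shows "0 \<le> sum f U" "sum f U \<le> n"
proof -
  show "0 \<le> sum f U" using assms by (intro sum_nonneg) auto
  have "sum f U \<le> (\<Sum>v\<in>U. 1)" by (intro sum_mono assms)
  also have "\<dots> \<le> n" using card_mono[OF finite_lessThan assms(1)] by simp
  finally show "sum f U \<le> n" .
qed

lemma square_diff_le:
  fixes a b :: real
  assumes "0 \<le> a" "0 \<le> b" "a \<le> n" "b \<le> n"
  shows "a\<^sup>2 \<le> b\<^sup>2 + 2 * n * \<bar>a - b\<bar>"
proof -
  have "a\<^sup>2 - b\<^sup>2 = (a + b) * (a - b)" by (simp add: power2_eq_square algebra_simps)
  also have "\<dots> \<le> (a + b) * \<bar>a - b\<bar>" using assms by (intro mult_left_mono) auto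
  also have "\<dots> \<le> (2 * n) * \<bar>a - b\<bar>" using assms by (intro mult_right_mono) auto
  finally show ?thesis by simp
qed

lemma mult_le_abs:
  fixes a b s :: real
  assumes "0 \<le> a" "a \<le> b"
  shows "a * s \<le> b * \<bar>s\<bar>"
proof -
  have "a * s \<le> a * \<bar>s\<bar>" using assms by (intro mult_left_mono) auto
  also have "\<dots> \<le> b * \<bar>s\<bar>" using assms by (intro mult_right_mono) auto
  finally show ?thesis .
qed

section \<open>Columns with a short vector of means, and columns with inverted means\<close>

text \<open>Up to errors, \<open>p * (card U)\<^sup>2\<close> ordered pairs inside \<open>U\<close>
  are edges, whereas counting them by labels and applying Cauchy-Schwarz leaves at most
  \<open>card U\<close> times the sum of \<open>(x v)\<^sup>2 + (z v)\<^sup>2\<close>. The summand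
  \<open>n\<close> pays for the missing diagonal.\<close>

lemma short_set_bound:
  fixes n :: nat and x z :: "nat \<Rightarrow> real"
  assumes A: "graph_on n A" and U: "U \<subseteq> {..<n}" and eta: "\<eta> \<ge> 0" and p: "0 \<le> p" "p \<le> 1"
    and b: "\<And>v. 0 \<le> x v" "\<And>v. x v \<le> 1" "\<And>v. 0 \<le> z v" "\<And>v. z v \<le> 1"
    and short: "\<And>v. v \<in> U \<Longrightarrow> (x v)\<^sup>2 + (z v)\<^sup>2 \<le> p - \<beta>"
  shows "\<beta> * (real (card U))\<^sup>2 \<le> \<eta> * (real n)\<^sup>2 + n
     + \<bar>\<Sum>d\<in>{d\<in>{..<n}\<times>{..<n}. fst d \<noteq> snd d}. of_bool (d \<in> U \<times> U) * (of_bool (d \<in> A) - p)\<bar>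
     + 2 * real n * (\<bar>\<Sum>v\<in>U. giant n A v - x v\<bar> + \<bar>\<Sum>v\<in>U. medium \<eta> n A v - z v\<bar>)"
proof -
  let ?D = "{d\<in>{..<n}\<times>{..<n}. fst d \<noteq> snd d}"
  let ?e = "\<Sum>d\<in>?D. of_bool (d \<in> U \<times> U) * (of_bool (d \<in> A) - p)"
  have fU: "finite U" using U finite_subset by blast
  have cU: "card U \<le> n" using card_mono[OF finite_lessThan U] by simp
  have "?e = (\<Sum>d\<in>{d\<in>U\<times>U. fst d \<noteq> snd d}. of_bool (d \<in> A) - p)"
    by (rule sum.mono_neutral_cong_right) (use U in auto)
  also have "\<dots> = (\<Sum>d\<in>{d\<in>U\<times>U. fst d \<noteq> snd d}. of_bool (d \<in> A)) - p * card {d\<in>U\<times>U. fst d \<noteq> snd d}"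
    by (simp add: sum_subtractf)
  also have "(\<Sum>d\<in>{d\<in>U\<times>U. fst d \<noteq> snd d}. of_bool (d \<in> A)) \<le> (\<Sum>d\<in>U\<times>U. of_bool (d \<in> A) :: real)"
    by (rule sum_mono2) (use fU in auto)
  also have "\<dots> = (\<Sum>u\<in>U. \<Sum>v\<in>U. of_bool ((u,v) \<in> A))"
    by (simp add: sum.cartesian_product')
  finally have e1: "?e \<le> (\<Sum>u\<in>U. \<Sum>v\<in>U. of_bool ((u,v) \<in> A)) - p * card {d\<in>U\<times>U. fst d \<noteq> snd d}" by simp
  have "real (card {d\<in>U\<times>U. fst d \<noteq> snd d}) = (real (card U))\<^sup>2 - card U"
  proof -
    have "{d\<in>U\<times>U. fst d \<noteq> snd d} = U \<times> U - (\<lambda>u. (u,u)) ` U" by auto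
    moreover have "card ((\<lambda>u. (u,u)) ` U) = card U" by (rule card_image) (auto simp: inj_on_def)
    moreover have "card (U \<times> U - (\<lambda>u. (u,u)) ` U) = card (U \<times> U) - card ((\<lambda>u. (u,u)) ` U)"
      by (rule card_Diff_subset) (use fU in auto)
    ultimately have "card {d\<in>U\<times>U. fst d \<noteq> snd d} = card U * card U - card U"
      by (simp add: card_cartesian_product)
    moreover have "card U \<le> card U * card U" by simp
    ultimately show ?thesis by (simp add: of_nat_diff power2_eq_square)
  qed
  moreover have "p * real (card U) \<le> 1 * real n" using p cU by (intro mult_mono) auto
  ultimately have e2: "p * (real (card U))\<^sup>2 \<le> (\<Sum>u\<in>U. \<Sum>v\<in>U. of_bool ((u,v) \<in> A)) + real n + \<bar>?e\<bar>"
    using e1 by (simp add: right_diff_distrib)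
  have gx: "(\<Sum>v\<in>U. giant n A v)\<^sup>2 \<le> (\<Sum>v\<in>U. x v)\<^sup>2 + 2 * real n * \<bar>\<Sum>v\<in>U. giant n A v - x v\<bar>"
    unfolding sum_subtractf
    by (intro square_diff_le sum_unit_bounds(1)[OF U] sum_unit_bounds(2)[OF U] b giant_bounds)
  have sz: "(\<Sum>v\<in>U. medium \<eta> n A v)\<^sup>2 \<le> (\<Sum>v\<in>U. z v)\<^sup>2 + 2 * real n * \<bar>\<Sum>v\<in>U. medium \<eta> n A v - z v\<bar>"
    unfolding sum_subtractf
    by (intro square_diff_le sum_unit_bounds(1)[OF U] sum_unit_bounds(2)[OF U] b medium_bounds)
  have cs: "(sum f U)\<^sup>2 \<le> card U * (\<Sum>v\<in>U. (f v)\<^sup>2)" for f :: "nat \<Rightarrow> real"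
    using Cauchy_Schwarz_ineq_sum[of "\<lambda>_. 1" f U] by simp
  have "(\<Sum>v\<in>U. x v)\<^sup>2 + (\<Sum>v\<in>U. z v)\<^sup>2 \<le> card U * (\<Sum>v\<in>U. (x v)\<^sup>2 + (z v)\<^sup>2)"
    using cs[of x] cs[of z] by (simp add: sum.distrib distrib_left)
  also have "\<dots> \<le> card U * (\<Sum>v\<in>U. p - \<beta>)"
    by (intro mult_left_mono sum_mono short) auto
  also have "\<dots> = p * (real (card U))\<^sup>2 - \<beta> * (real (card U))\<^sup>2"
    by (simp add: power2_eq_square algebra_simps)
  finally have "(\<Sum>v\<in>U. x v)\<^sup>2 + (\<Sum>v\<in>U. z v)\<^sup>2 \<le> p * (real (card U))\<^sup>2 - \<beta> * (real (card U))\<^sup>2" .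
  then show ?thesis
    using e2 gx sz edges_le_labels[OF A U eta] by (simp only: distrib_left)
qed

text \<open>The vertices of \<open>U\<close> have average degree about \<open>p * n\<close> in the
  whole layer, but \<open>degree_le_labels\<close> allows on average only
  \<open>G * x u + (n - G) * z u\<close>. Since \<open>G \<ge> n / 2\<close>, the larger weight
  falls on the smaller mean and this is at most \<open>n / 2\<close>.\<close>

lemma inverted_set_bound:
  fixes n :: nat and x z :: "nat \<Rightarrow> real"
  assumes A: "graph_on n A" and U: "U \<subseteq> {..<n}" and eta: "\<eta> \<ge> 0" and p: "0 \<le> p" "p \<le> 1"
    and b: "\<And>v. x v + z v \<le> 1"
    and inv: "\<And>v. v \<in> U \<Longrightarrow> x v \<le> z v"
  shows "(p - 1/2) * (n * real (card U)) \<le> \<eta> * (real n)\<^sup>2 + n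
     + \<bar>\<Sum>d\<in>{d\<in>{..<n}\<times>{..<n}. fst d \<noteq> snd d}. of_bool (d \<in> U \<times> UNIV) * (of_bool (d \<in> A) - p)\<bar>
     + n * (\<bar>\<Sum>v\<in>U. giant n A v - x v\<bar> + \<bar>\<Sum>v\<in>U. medium \<eta> n A v - z v\<bar>)"
proof -
  let ?D = "{d\<in>{..<n}\<times>{..<n}. fst d \<noteq> snd d}"
  let ?D' = "{d\<in>U\<times>{..<n}. fst d \<noteq> snd d}"
  let ?e = "\<Sum>d\<in>?D. of_bool (d \<in> U \<times> UNIV) * (of_bool (d \<in> A) - p)"
  have fU: "finite U" using U finite_subset by blast
  have cU: "card U \<le> n" using card_mono[OF finite_lessThan U] by simp
  have "?e = (\<Sum>d\<in>?D'. of_bool (d \<in> A) - p)"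
    by (rule sum.mono_neutral_cong_right) (use U in auto)
  also have "\<dots> = (\<Sum>d\<in>?D'. of_bool (d \<in> A)) - p * card ?D'"
    by (simp add: sum_subtractf)
  also have "(\<Sum>d\<in>?D'. of_bool (d \<in> A)) \<le> (\<Sum>d\<in>U\<times>{..<n}. of_bool (d \<in> A) :: real)"
    by (rule sum_mono2) (use fU in auto)
  also have "\<dots> = (\<Sum>u\<in>U. \<Sum>v<n. of_bool ((u,v) \<in> A))"
    by (simp add: sum.cartesian_product')
  finally have e1: "?e \<le> (\<Sum>u\<in>U. \<Sum>v<n. of_bool ((u,v) \<in> A)) - p * card ?D'" by simp
  have "real (card ?D') = n * real (card U) - card U"
  proof -
    have "?D' = U \<times> {..<n} - (\<lambda>u. (u,u)) ` U" using U by auto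
    moreover have "card ((\<lambda>u. (u,u)) ` U) = card U" by (rule card_image) (auto simp: inj_on_def)
    moreover have "card (U \<times> {..<n} - (\<lambda>u. (u,u)) ` U) = card (U \<times> {..<n}) - card ((\<lambda>u. (u,u)) ` U)"
      by (rule card_Diff_subset) (use fU U in auto)
    ultimately have "card ?D' = card U * n - card U"
      by (simp add: card_cartesian_product)
    moreover have "card U \<le> card U * n" using cU by (cases n) auto
    ultimately show ?thesis by (simp add: of_nat_diff)
  qed
  moreover have "p * real (card U) \<le> 1 * real n" using p cU by (intro mult_mono) auto
  ultimately have e2: "p * (n * real (card U)) \<le> (\<Sum>u\<in>U. \<Sum>v<n. of_bool ((u,v) \<in> A)) + real n + \<bar>?e\<bar>"
    using e1 by (simp add: right_diff_distrib)
  define G where "G = max (\<Sum>v<n. giant n A v) (n / 2)"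
  have "(\<Sum>v<n. giant n A v) \<le> n" by (intro sum_unit_bounds giant_bounds) auto
  then have G: "n / 2 \<le> G" "G \<le> n" by (auto simp: G_def)
  have "(\<Sum>u\<in>U. \<Sum>v<n. of_bool ((u,v) \<in> A)) \<le> (\<Sum>u\<in>U. giant n A u * G + medium \<eta> n A u * (n - G) + \<eta> * n)"
    by (intro sum_mono degree_le_labels[OF A _ eta G_def]) (use U in auto)
  also have "\<dots> = G * (\<Sum>u\<in>U. giant n A u) + (n - G) * (\<Sum>u\<in>U. medium \<eta> n A u) + card U * (\<eta> * n)"
    by (simp add: sum.distrib sum_distrib_left mult_ac)
  also have "\<dots> = (\<Sum>u\<in>U. G * x u + (n - G) * z u)
      + (G * (\<Sum>v\<in>U. giant n A v - x v) + (n - G) * (\<Sum>v\<in>U. medium \<eta> n A v - z v)) + card U * (\<eta> * n)"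
    by (simp add: sum.distrib sum_subtractf sum_distrib_left algebra_simps)
  also have "(\<Sum>u\<in>U. G * x u + (n - G) * z u) \<le> (\<Sum>u\<in>U. n / 2)"
  proof (intro sum_mono)
    fix u assume u: "u \<in> U"
    have "G * x u + (n - G) * z u = n / 2 * (x u + z u) - (G - n / 2) * (z u - x u)"
      by (simp add: field_simps)
    also have "\<dots> \<le> n / 2 * (x u + z u)"
      using mult_nonneg_nonneg[of "G - n/2" "z u - x u"] G inv[OF u] by simp
    also have "\<dots> \<le> n / 2 * 1" by (intro mult_left_mono b) auto
    finally show "G * x u + (n - G) * z u \<le> n / 2" by simp
  qed
  also have "G * (\<Sum>v\<in>U. giant n A v - x v) \<le> n * \<bar>\<Sum>v\<in>U. giant n A v - x v\<bar>"
    by (rule mult_le_abs) (use G in auto)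
  also have "(n - G) * (\<Sum>v\<in>U. medium \<eta> n A v - z v) \<le> n * \<bar>\<Sum>v\<in>U. medium \<eta> n A v - z v\<bar>"
    by (rule mult_le_abs) (use G in auto)
  also have "card U * (\<eta> * n) \<le> n * (\<eta> * n)"
    using cU eta by (intro mult_right_mono) auto
  finally have "(\<Sum>u\<in>U. \<Sum>v<n. of_bool ((u,v) \<in> A)) \<le> (n * real (card U)) / 2
     + (n * \<bar>\<Sum>v\<in>U. giant n A v - x v\<bar> + n * \<bar>\<Sum>v\<in>U. medium \<eta> n A v - z v\<bar>) + \<eta> * (real n)\<^sup>2"
    by (simp add: power2_eq_square mult_ac)
  then show ?thesis using e2 by (simp only: distrib_left left_diff_distrib)
qed

section \<open>Conditional means of the labels in a random layer\<close>

text \<open>The index \<open>q w\<close> is itself random; summing over all possible keys removes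
  this dependence at the cost of a factor that does not grow with the layer.\<close>

lemma expct_max_key:
  fixes Z :: "'k \<Rightarrow> 'a \<Rightarrow> real" and c :: real
  assumes fin: "finite (set_pmf P)" and K: "finite K" "\<And>w. q w \<in> K"
    and Z: "\<And>k. k \<in> K \<Longrightarrow> expct P (\<lambda>w. \<bar>Z k w\<bar>) \<le> c"
  shows "expct P (\<lambda>w. \<bar>Z (q w) w\<bar>) \<le> card K * c"
proof -
  note J[simp] = integrable_finite_pmf[OF fin]
  have "expct P (\<lambda>w. \<bar>Z (q w) w\<bar>) \<le> expct P (\<lambda>w. \<Sum>k\<in>K. \<bar>Z k w\<bar>)"
    by (intro expct_mono[OF fin] member_le_sum[where f = "\<lambda>k. \<bar>Z k _\<bar>"]) (use K in auto)
  also have "\<dots> = (\<Sum>k\<in>K. expct P (\<lambda>w. \<bar>Z k w\<bar>))" by simp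
  also have "\<dots> \<le> (\<Sum>k\<in>K. c)" by (intro sum_mono Z)
  finally show ?thesis by simp
qed

lemma expct_markov:
  assumes fin: "finite (set_pmf P)" and f: "\<And>w. w \<in> set_pmf P \<Longrightarrow> 0 \<le> f w" and c: "c > 0"
    and S: "\<And>w. w \<in> set_pmf P \<Longrightarrow> w \<in> S \<Longrightarrow> c \<le> f w"
  shows "measure_pmf.prob P S \<le> expct P f / c"
proof -
  have "measure_pmf.prob P S = expct P (\<lambda>w. of_bool (w \<in> S))" by (simp add: expct_of_bool)
  also have "\<dots> \<le> expct P (\<lambda>w. f w / c)"
    by (rule expct_mono[OF fin]) (use f S c in \<open>auto simp: field_simps\<close>)
  finally show ?thesis by simp
qed

lemma layer_pinning:
  fixes P :: "(nat \<times> nat) set pmf"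
  assumes fin: "finite (set_pmf P)" and k: "k > 0"
  obtains q :: "(nat \<times> nat) set \<Rightarrow> (nat \<times> bool) set" and T and x z :: "(nat \<times> nat) set \<Rightarrow> nat \<Rightarrow> real"
  where "finite T" "real (card T) \<le> 1 / k\<^sup>2" "\<And>A. q A \<subseteq> T"
    "\<And>A A' v. q A = q A' \<Longrightarrow> x A v = x A' v \<and> z A v = z A' v"
    "\<And>A v. 0 \<le> x A v \<and> 0 \<le> z A v \<and> x A v + z A v \<le> 1"
    "\<And>a. (\<And>K v. \<bar>a K v\<bar> \<le> (1::real)) \<Longrightarrow>
       expct P (\<lambda>A. \<bar>\<Sum>v<n. a (q A) v * (giant n A v - x A v)\<bar>) \<le> 2 * sqrt k * n \<and>
       expct P (\<lambda>A. \<bar>\<Sum>v<n. a (q A) v * (medium \<eta> n A v - z A v)\<bar>) \<le> 2 * sqrt k * n"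
proof -
  \<comment> \<open>Both kinds of labels are pinned at once, so that \<open>x\<close> and
    \<open>z\<close> are conditional means for the same key.\<close>
  define F where "F i A = (if snd i then giant n A (fst i) = 1 else medium \<eta> n A (fst i) = 1)"
    for i :: "nat \<times> bool" and A
  define f where "f i A = (of_bool (F i A) :: real)" for i A
  define q where "q T A = {i \<in> T. F i A}" for T A
  have f_simps: "f (v, True) = (\<lambda>A. giant n A v)" "f (v, False) = (\<lambda>A. medium \<eta> n A v)" for v
    by (auto simp: f_def F_def giant_def medium_def fun_eq_iff)
  let ?I = "{..<n} \<times> (UNIV :: bool set)"
  have cI: "real (card ?I) = 2 * n" by (simp add: card_cartesian_product)
  obtain T where T: "T \<subseteq> ?I" "real (card T) \<le> 1 / k\<^sup>2"
    and main: "\<And>a. (\<forall>K i. \<bar>a K i\<bar> \<le> 1) \<Longrightarrow>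
      expct P (\<lambda>A. (\<Sum>i\<in>?I. a (q T A) i * (f i A - cexp P (q T) (f i) A))\<^sup>2) \<le> k * (real (card ?I))\<^sup>2"
    using pinning[OF fin _ k, of ?I F] unfolding q_def f_def[abs_def] by auto
  have sqrtI: "sqrt (k * (real (card ?I))\<^sup>2) = 2 * sqrt k * n"
    unfolding cI by (simp add: real_sqrt_mult)
  have L1: "expct P (\<lambda>A. \<bar>\<Sum>i\<in>?I. a (q T A) i * (f i A - cexp P (q T) (f i) A)\<bar>) \<le> 2 * sqrt k * n"
    if "\<forall>K i. \<bar>a K i\<bar> \<le> 1" for a
    using expct_abs_le_sqrt[OF fin] real_sqrt_le_mono[OF main[OF that]] unfolding sqrtI
    by (rule order_trans)
  define x where "x A v = cexp P (q T) (\<lambda>A. giant n A v) A" for A v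
  define z where "z A v = cexp P (q T) (\<lambda>A. medium \<eta> n A v) A" for A v
  have split: "(\<Sum>i\<in>?I. h i) = (\<Sum>v<n. h (v, True)) + (\<Sum>v<n. h (v, False))" for h :: "nat \<times> bool \<Rightarrow> real"
    by (simp add: sum.cartesian_product' UNIV_bool sum.distrib)
  show thesis
  proof (rule that[of T "q T" x z])
    show "finite T" using T by (meson finite_SigmaI finite_lessThan finite_subset finite)
    show "real (card T) \<le> 1 / k\<^sup>2" by (rule T)
    show "q T A \<subseteq> T" for A by (auto simp: q_def)
    show "x A v = x A' v \<and> z A v = z A' v" if "q T A = q T A'" for A A' v
      unfolding x_def z_def using cexp_fiber[where q = "q T", OF that] by blast
    show "0 \<le> x A v \<and> 0 \<le> z A v \<and> x A v + z A v \<le> 1" for A v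
    proof (intro conjI)
      show "0 \<le> x A v" "0 \<le> z A v"
        unfolding x_def z_def by (intro cexp_nonneg giant_bounds medium_bounds)+
      show "x A v + z A v \<le> 1"
        unfolding x_def z_def cexp_add[OF fin, symmetric]
        by (intro cexp_le_1[OF fin] giant_medium_le_1)
    qed
    show "expct P (\<lambda>A. \<bar>\<Sum>v<n. a (q T A) v * (giant n A v - x A v)\<bar>) \<le> 2 * sqrt k * n \<and>
       expct P (\<lambda>A. \<bar>\<Sum>v<n. a (q T A) v * (medium \<eta> n A v - z A v)\<bar>) \<le> 2 * sqrt k * n"
      if a: "\<And>K v. \<bar>a K v\<bar> \<le> 1" for a
      \<comment> \<open>Weight 0 on one of the two kinds of labels isolates the other.\<close>
      using L1[of "\<lambda>K i. if snd i then a K (fst i) else 0"]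
        L1[of "\<lambda>K i. if snd i then 0 else a K (fst i)"] a
      unfolding split f_simps x_def z_def by simp
  qed
qed

text \<open>More than \<open>\<beta> * n\<close> bad columns force, by
  \<open>short_set_bound\<close> or \<open>inverted_set_bound\<close>, a total error of at least
  \<open>\<beta>^3 / 8 * n\<^sup>2\<close>. The expected error is at most \<open>\<tau>\<close>
  times this amount, and Markov's inequality concludes.\<close>

lemma layer_structure:
  fixes p \<beta> \<eta> \<tau> :: real
  assumes p: "1/2 + \<beta> \<le> p" "p \<le> 1" and beta: "0 < \<beta>" and eta: "0 \<le> \<eta>" "\<eta> \<le> \<beta>^3 / 16" and tau: "0 < \<tau>"
  shows "\<exists>N. \<forall>n\<ge>N. \<forall>P. layer_law n p P \<longrightarrow> (\<exists>x z.
    (\<forall>A v. 0 \<le> x A v \<and> 0 \<le> z A v \<and> x A v + z A v \<le> (1::real)) \<and>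
    (\<forall>a. (\<forall>v. \<bar>a v\<bar> \<le> (1::real)) \<longrightarrow>
       expct P (\<lambda>A. \<bar>\<Sum>v<n. a v * (giant n A v - x A v)\<bar>) \<le> \<tau> * n \<and>
       expct P (\<lambda>A. \<bar>\<Sum>v<n. a v * (medium \<eta> n A v - z A v)\<bar>) \<le> \<tau> * n) \<and>
    measure_pmf.prob P {A. real (card {v\<in>{..<n}. \<not> (p - \<beta> \<le> (x A v)\<^sup>2 + (z A v)\<^sup>2 \<and> z A v \<le> x A v)}) > \<beta> * n} \<le> \<tau>)"
proof -
  \<comment> \<open>Four label errors of size \<open>\<tau>' * n\<close>, each weighted by
    \<open>2 * n\<close>, make up one half of the admissible
    \<open>\<tau> * (\<beta>^3 / 8 * n\<^sup>2)\<close>; the other half is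
    \<open>\<gamma> * n\<^sup>2\<close>, for the diagonal and the edge counts. \<open>M\<close>
    bounds the number of keys independently of \<open>n\<close>.\<close>
  define \<tau>' where "\<tau>' = min \<tau> (\<tau> * \<beta>^3 / 128)"
  have tau': "\<tau>' > 0" "\<tau>' \<le> \<tau>" "\<tau>' \<le> \<tau> * \<beta>^3 / 128" using tau beta by (auto simp: \<tau>'_def)
  define k where "k = (\<tau>' / 2)\<^sup>2"
  have k: "k > 0" "2 * sqrt k = \<tau>'" using tau' by (auto simp: k_def)
  define M where "M = (2::real) ^ nat \<lfloor>1 / k\<^sup>2\<rfloor>"
  define \<gamma> where "\<gamma> = \<tau> * \<beta>^3 / 16"
  have gamma: "\<gamma> > 0" using tau beta by (simp add: \<gamma>_def)
  have "eventually (\<lambda>n::nat. real n + 4 * M * sqrt (real n ^ 3) \<le> \<gamma> * (real n)\<^sup>2) sequentially"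
    using gamma by real_asymp
  then obtain N where N: "\<And>n. n \<ge> N \<Longrightarrow> real n + 4 * M * sqrt (real n ^ 3) \<le> \<gamma> * (real n)\<^sup>2"
    by (auto simp: eventually_sequentially)
  show ?thesis
  proof (intro exI[of _ "max N 1"] allI impI)
    fix n P assume n: "max N 1 \<le> n" and L: "layer_law n p P"
    have fin: "finite (set_pmf P)" by (rule layer_law_finite[OF L])
    note J[simp] = integrable_finite_pmf[OF fin]
    obtain q :: "(nat \<times> nat) set \<Rightarrow> (nat \<times> bool) set" and T x z
      where T: "finite T" "real (card T) \<le> 1 / k\<^sup>2" "\<And>A. q A \<subseteq> T"
        and key: "\<And>A A' v. q A = q A' \<Longrightarrow> x A v = x A' v \<and> z A v = z A' v"
        and b: "\<And>A v. 0 \<le> x A v \<and> 0 \<le> z A v \<and> x A v + z A v \<le> 1"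
        and pin0: "\<And>a. (\<And>K v. \<bar>a K v\<bar> \<le> (1::real)) \<Longrightarrow>
           expct P (\<lambda>A. \<bar>\<Sum>v<n. a (q A) v * (giant n A v - x A v)\<bar>) \<le> 2 * sqrt k * n \<and>
           expct P (\<lambda>A. \<bar>\<Sum>v<n. a (q A) v * (medium \<eta> n A v - z A v)\<bar>) \<le> 2 * sqrt k * n"
      by (rule layer_pinning[OF fin k(1), of n \<eta>]) (assumption | blast)+
    note pin = pin0[unfolded k(2)]
    have b1: "x A v \<le> 1" "z A v \<le> 1" for A v using b[of A v] by auto
    define U where "U A = {v\<in>{..<n}. (x A v)\<^sup>2 + (z A v)\<^sup>2 \<le> p - \<beta>}" for A
    define V where "V A = {v\<in>{..<n}. x A v \<le> z A v}" for A
    \<comment> \<open>\<open>U\<close> and \<open>V\<close> depend on \<open>A\<close> only through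
      the key. A representative of each key turns them into functions of the key, to which
      \<open>expct_max_key\<close> and the pinning estimate apply.\<close>
    define rep where "rep K = (SOME A. q A = K)" for K
    have rep: "q (rep (q A)) = q A" for A unfolding rep_def by (rule someI) simp
    have repU: "U (rep (q A)) = U A" "V (rep (q A)) = V A" for A
      using key[OF rep] by (auto simp: U_def V_def)
    have Usub: "U A \<subseteq> {..<n}" "V A \<subseteq> {..<n}" for A by (auto simp: U_def V_def)
    let ?D = "{d\<in>{..<n}\<times>{..<n}. fst d \<noteq> snd d}"
    define e1 where "e1 A = \<bar>\<Sum>d\<in>?D. of_bool (d \<in> U A \<times> U A) * (of_bool (d \<in> A) - p)\<bar>" for A
    define e2 where "e2 A = \<bar>\<Sum>d\<in>?D. of_bool (d \<in> V A \<times> UNIV) * (of_bool (d \<in> A) - p)\<bar>" for A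
    define e3 where "e3 A = \<bar>\<Sum>v\<in>U A. giant n A v - x A v\<bar>" for A
    define e4 where "e4 A = \<bar>\<Sum>v\<in>U A. medium \<eta> n A v - z A v\<bar>" for A
    define e5 where "e5 A = \<bar>\<Sum>v\<in>V A. giant n A v - x A v\<bar>" for A
    define e6 where "e6 A = \<bar>\<Sum>v\<in>V A. medium \<eta> n A v - z A v\<bar>" for A
    have e0: "e1 A \<ge> 0" "e2 A \<ge> 0" "e3 A \<ge> 0" "e4 A \<ge> 0" "e5 A \<ge> 0" "e6 A \<ge> 0" for A
      by (auto simp: e1_def e2_def e3_def e4_def e5_def e6_def)
    have p01: "0 \<le> p" "p \<le> 1" using p beta by auto
    have "real (card (Pow T)) \<le> M"
    proof -
      have "card T \<le> nat \<lfloor>1 / k\<^sup>2\<rfloor>" using T(2) by linarith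
      then have "(2::real) ^ card T \<le> 2 ^ nat \<lfloor>1 / k\<^sup>2\<rfloor>" by (intro power_increasing) auto
      then show ?thesis using T(1) by (simp add: card_Pow M_def)
    qed
    then have cM: "real (card (Pow T)) * (2 * sqrt (real n ^ 3)) \<le> M * (2 * sqrt (real n ^ 3))"
      by (intro mult_right_mono) auto
    have E1: "expct P e1 \<le> M * (2 * sqrt (real n ^ 3))"
    proof -
      have "expct P e1 = expct P (\<lambda>A. \<bar>(\<lambda>K A. \<Sum>d\<in>?D. of_bool (d \<in> U (rep K) \<times> U (rep K)) * (of_bool (d \<in> A) - p)) (q A) A\<bar>)"
        unfolding e1_def repU by simp
      also have "\<dots> \<le> card (Pow T) * (2 * sqrt (real n ^ 3))"
        by (intro expct_max_key[OF fin] layer_concentration[OF L p01]) (use T in auto)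
      finally show ?thesis using cM by linarith
    qed
    have E2: "expct P e2 \<le> M * (2 * sqrt (real n ^ 3))"
    proof -
      have "expct P e2 = expct P (\<lambda>A. \<bar>(\<lambda>K A. \<Sum>d\<in>?D. of_bool (d \<in> V (rep K) \<times> UNIV) * (of_bool (d \<in> A) - p)) (q A) A\<bar>)"
        unfolding e2_def repU by simp
      also have "\<dots> \<le> card (Pow T) * (2 * sqrt (real n ^ 3))"
        by (intro expct_max_key[OF fin] layer_concentration[OF L p01]) (use T in auto)
      finally show ?thesis using cM by linarith
    qed
    have restr: "(\<Sum>v\<in>W. h v) = (\<Sum>v<n. of_bool (v \<in> W) * h v)" if "W \<subseteq> {..<n}" for W and h :: "nat \<Rightarrow> real"
      by (rule sum.mono_neutral_cong_left) (use that in auto)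
    have "expct P e3 \<le> \<tau>' * n \<and> expct P e4 \<le> \<tau>' * n"
      unfolding e3_def e4_def restr[OF Usub(1)]
      using pin[of "\<lambda>K v. of_bool (v \<in> U (rep K))"] by (simp add: repU)
    moreover have "expct P e5 \<le> \<tau>' * n \<and> expct P e6 \<le> \<tau>' * n"
      unfolding e5_def e6_def restr[OF Usub(2)]
      using pin[of "\<lambda>K v. of_bool (v \<in> V (rep K))"] by (simp add: repU)
    ultimately have E3: "expct P e3 + expct P e4 + expct P e5 + expct P e6 \<le> 4 * (\<tau>' * n)" by linarith
    define E where "E A = n + e1 A + e2 A + 2 * real n * (e3 A + e4 A + e5 A + e6 A)" for A
    have n0: "real n > 0" using n by simp
    have "expct P E = n + expct P e1 + expct P e2 + 2 * real n * (expct P e3 + expct P e4 + expct P e5 + expct P e6)"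
      unfolding E_def by simp
    also have "\<dots> \<le> n + M * (2 * sqrt (real n ^ 3)) + M * (2 * sqrt (real n ^ 3)) + 2 * real n * (4 * (\<tau>' * n))"
      by (intro add_mono E1 E2 mult_left_mono E3) auto
    also have "\<dots> = (n + 4 * M * sqrt (real n ^ 3)) + 8 * \<tau>' * (real n)\<^sup>2"
      by (simp add: power2_eq_square algebra_simps)
    also have "\<dots> \<le> \<gamma> * (real n)\<^sup>2 + 8 * (\<tau> * \<beta>^3 / 128) * (real n)\<^sup>2"
      using N[of n] n tau'(3) by (intro add_mono mult_right_mono) auto
    also have "\<dots> = \<tau> * (\<beta>^3 / 8 * (real n)\<^sup>2)" by (simp add: \<gamma>_def field_simps)
    finally have EE: "expct P E \<le> \<tau> * (\<beta>^3 / 8 * (real n)\<^sup>2)" .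
    let ?bad = "\<lambda>A. {v\<in>{..<n}. \<not> (p - \<beta> \<le> (x A v)\<^sup>2 + (z A v)\<^sup>2 \<and> z A v \<le> x A v)}"
    let ?S = "{A. real (card (?bad A)) > \<beta> * n}"
    have "measure_pmf.prob P ?S \<le> expct P E / (\<beta>^3 / 8 * (real n)\<^sup>2)"
    proof (rule expct_markov[OF fin])
      show "0 \<le> E A" for A using e0[of A] n0 by (simp add: E_def)
      show "0 < \<beta>^3 / 8 * (real n)\<^sup>2" using beta n0 by simp
      fix A assume A: "A \<in> set_pmf P" "A \<in> ?S"
      have gA: "graph_on n A" using L A by (simp add: layer_law_def)
      have "?bad A \<subseteq> U A \<union> V A" by (auto simp: U_def V_def)
      then have "card (?bad A) \<le> card (U A \<union> V A)" by (intro card_mono) (auto simp: U_def V_def)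
      also have "\<dots> \<le> card (U A) + card (V A)" by (rule card_Un_le)
      finally have big: "real (card (U A)) + real (card (V A)) > \<beta> * n" using A by simp
      have sU: "\<beta> * (real (card (U A)))\<^sup>2 \<le> \<eta> * (real n)\<^sup>2 + n + e1 A + 2 * real n * (e3 A + e4 A)"
        unfolding e1_def e3_def e4_def
        by (rule short_set_bound[OF gA Usub(1) eta(1) p01]) (use b b1 in \<open>auto simp: U_def\<close>)
      have sV: "(p - 1/2) * (n * real (card (V A))) \<le> \<eta> * (real n)\<^sup>2 + n + e2 A + n * (e5 A + e6 A)"
        unfolding e2_def e5_def e6_def
        by (rule inverted_set_bound[OF gA Usub(2) eta(1) p01]) (use b b1 in \<open>auto simp: V_def\<close>)
      have nn: "0 \<le> n * e3 A" "0 \<le> n * e4 A" "0 \<le> n * e5 A" "0 \<le> n * e6 A" using e0[of A] by auto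
      have etan: "\<eta> * (real n)\<^sup>2 \<le> \<beta>^3 / 16 * (real n)\<^sup>2" using eta by (intro mult_right_mono) auto
      have bn: "0 \<le> \<beta>^3 * (real n)\<^sup>2" using beta by simp
      show "\<beta>^3 / 8 * (real n)\<^sup>2 \<le> E A"
      \<comment> \<open>At least half of the bad columns are of one kind. A large \<open>U\<close>
        yields \<open>\<beta>^3 / 4\<close>, a large \<open>V\<close> yields
        \<open>\<beta>^2 / 2\<close>, and in either case \<open>\<beta>^3 / 8\<close> remains after
        the loss of \<open>\<eta> \<le> \<beta>^3 / 16\<close>.\<close>
      proof (cases "real (card (U A)) \<ge> \<beta> * n / 2")
        case True
        have "\<beta> * (\<beta> * n / 2)\<^sup>2 \<le> \<beta> * (real (card (U A)))\<^sup>2"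
          using True beta n0 by (intro mult_left_mono power_mono) auto
        then have "\<beta>^3 / 4 * (real n)\<^sup>2 \<le> \<beta> * (real (card (U A)))\<^sup>2"
          by (simp add: power2_eq_square power3_eq_cube mult_ac)
        then show ?thesis using sU[unfolded distrib_left] etan e0[of A] nn bn unfolding E_def distrib_left by linarith
      next
        case False
        then have "real (card (V A)) \<ge> \<beta> * n / 2" using big by linarith
        then have "\<beta> * (n * (\<beta> * n / 2)) \<le> (p - 1/2) * (n * real (card (V A)))"
          using p beta n0 by (intro mult_mono) auto
        then have "\<beta>^2 / 2 * (real n)\<^sup>2 \<le> (p - 1/2) * (n * real (card (V A)))"
          by (simp add: power2_eq_square mult_ac)
        moreover have "\<beta>^3 / 2 * (real n)\<^sup>2 \<le> \<beta>^2 / 2 * (real n)\<^sup>2"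
          using beta p by (intro mult_right_mono divide_right_mono power_decreasing) auto
        ultimately show ?thesis using sV[unfolded distrib_left] etan e0[of A] nn bn unfolding E_def distrib_left by linarith
      qed
    qed
    also have "\<dots> \<le> \<tau>"
      using EE n0 beta by (simp add: divide_le_eq)
    finally have bad: "measure_pmf.prob P ?S \<le> \<tau>" .
    have "\<tau>' * n \<le> \<tau> * n" using tau' by (intro mult_right_mono) auto
    then have "expct P (\<lambda>A. \<bar>\<Sum>v<n. a v * (giant n A v - x A v)\<bar>) \<le> \<tau> * n \<and>
       expct P (\<lambda>A. \<bar>\<Sum>v<n. a v * (medium \<eta> n A v - z A v)\<bar>) \<le> \<tau> * n" if "\<forall>v. \<bar>a v\<bar> \<le> 1" for a
      using pin[of "\<lambda>K. a"] that by fastforce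
    then show "\<exists>x z.
    (\<forall>A v. 0 \<le> x A v \<and> 0 \<le> z A v \<and> x A v + z A v \<le> (1::real)) \<and>
    (\<forall>a. (\<forall>v. \<bar>a v\<bar> \<le> (1::real)) \<longrightarrow>
       expct P (\<lambda>A. \<bar>\<Sum>v<n. a v * (giant n A v - x A v)\<bar>) \<le> \<tau> * n \<and>
       expct P (\<lambda>A. \<bar>\<Sum>v<n. a v * (medium \<eta> n A v - z A v)\<bar>) \<le> \<tau> * n) \<and>
    measure_pmf.prob P {A. real (card {v\<in>{..<n}. \<not> (p - \<beta> \<le> (x A v)\<^sup>2 + (z A v)\<^sup>2 \<and> z A v \<le> x A v)}) > \<beta> * n} \<le> \<tau>"
      using b bad by blast
  qed
qed

section \<open>Two adjacent layers\<close>

text \<open>The quadratic form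
  \<open>(4 - 2 * sqrt 3) * (x + z)\<^sup>2 - (x\<^sup>2 + z\<^sup>2)\<close> vanishes exactly on
  the line \<open>x = sqrt 3 * z\<close> and on its mirror image. Between the two lines it is
  positive, which together with \<open>x + z \<le> 1\<close> would make the norm too small.\<close>

lemma cone_bound:
  fixes x z :: real
  assumes "0 \<le> z" "z \<le> x" "x + z \<le> 1" "4 - 2 * sqrt 3 \<le> x\<^sup>2 + z\<^sup>2"
  shows "sqrt 3 * z \<le> x"
proof (rule ccontr)
  define s where "s = sqrt (3::real)"
  have s: "s * s = 3" "1 < s" "s < 2" by (auto simp: s_def real_less_rsqrt real_less_lsqrt)
  assume "\<not> sqrt 3 * z \<le> x"
  then have lt: "x < s * z" by (simp add: s_def)
  have z: "z > 0" using lt assms by (cases "z = 0") auto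
  have "1 * z < s * x" using s assms z by (intro mult_less_le_imp_less) auto
  then have "0 < (2 - s) * ((s * z - x) * (s * x - z))" using lt s by simp
  also have "\<dots> = (4 - 2 * s) * (x + z)\<^sup>2 - (x\<^sup>2 + z\<^sup>2)"
  proof -
    have "(s * z - x) * (s * x - z) = (s * s) * (x * z) - s * (z * z) - s * (x * x) + x * z"
      by (simp add: algebra_simps)
    also have "\<dots> = 4 * (x * z) - s * (x * x + z * z)" unfolding s by (simp add: algebra_simps)
    finally have e: "(s * z - x) * (s * x - z) = 4 * (x * z) - s * (x * x + z * z)" .
    have "(2 - s) * ((s * z - x) * (s * x - z))
      = (8 - 4 * s) * (x * z) - (2 * s - s * s) * (x * x + z * z)"
      unfolding e by (simp add: algebra_simps)
    then show ?thesis unfolding s by (simp add: power2_eq_square algebra_simps)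
  qed
  finally have "x\<^sup>2 + z\<^sup>2 < (4 - 2 * s) * (x + z)\<^sup>2" by simp
  also have "\<dots> \<le> (4 - 2 * s) * 1"
    using assms s by (intro mult_left_mono power_le_one) auto
  finally show False using assms by (simp add: s_def)
qed

text \<open>Vectors with directions between 0 and 30 degrees enclose an angle of at most 30 degrees.
  Algebraically, \<open>4 * (x * y + z * w)\<^sup>2 - 3 * ((x\<^sup>2 + z\<^sup>2) * (y\<^sup>2 +
  w\<^sup>2))\<close> is the sum of the two nonnegative products below.\<close>

lemma cone_product:
  fixes x z y w q :: real
  assumes "0 \<le> z" "z \<le> x" "x + z \<le> 1" "q \<le> x\<^sup>2 + z\<^sup>2"
    and "0 \<le> w" "w \<le> y" "y + w \<le> 1" "q \<le> y\<^sup>2 + w\<^sup>2"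
    and q: "4 - 2 * sqrt 3 \<le> q"
  shows "sqrt 3 / 2 * q \<le> x * y + z * w"
proof -
  have q0: "0 \<le> q"
  proof -
    have "sqrt 3 \<le> (2::real)" by (rule real_le_lsqrt) auto
    then show ?thesis using q by simp
  qed
  have "sqrt 3 * z \<le> x" "sqrt 3 * w \<le> y"
    using cone_bound[of z x] cone_bound[of w y] assms by linarith+
  then have "(sqrt 3 * z)\<^sup>2 \<le> x\<^sup>2" "(sqrt 3 * w)\<^sup>2 \<le> y\<^sup>2"
    using assms by (auto intro!: power_mono)
  then have "0 \<le> (x\<^sup>2 - 3 * z\<^sup>2) * (y\<^sup>2 - 3 * w\<^sup>2)"
    by (intro mult_nonneg_nonneg) (auto simp: power_mult_distrib)
  moreover have "0 \<le> 8 * (z * w) * (x * y - z * w)"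
    using assms by (intro mult_nonneg_nonneg) (auto intro: mult_mono)
  ultimately have "3 * ((x\<^sup>2 + z\<^sup>2) * (y\<^sup>2 + w\<^sup>2)) \<le> 4 * (x * y + z * w)\<^sup>2"
    by (simp add: power2_eq_square algebra_simps)
  moreover have "q * q \<le> (x\<^sup>2 + z\<^sup>2) * (y\<^sup>2 + w\<^sup>2)"
    using assms q0 by (intro mult_mono) auto
  ultimately have "3 * (q * q) \<le> 4 * (x * y + z * w)\<^sup>2" by linarith
  then have "(sqrt 3 * q)\<^sup>2 \<le> (2 * (x * y + z * w))\<^sup>2"
    unfolding power_mult_distrib by (simp add: power2_eq_square)
  then have "sqrt 3 * q \<le> 2 * (x * y + z * w)"
    by (rule power2_le_imp_le) (use assms in auto)
  then show ?thesis by simp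
qed

text \<open>The layers are indexed by \<open>False\<close> and \<open>True\<close>; \<open>H\<close> is the set of columns whose
  horizontal edge is present.\<close>

definition ladder :: "(nat \<times> nat) set \<Rightarrow> (nat \<times> nat) set \<Rightarrow> nat set \<Rightarrow> ((bool \<times> nat) \<times> (bool \<times> nat)) set" where
  "ladder A1 A2 H = {((False, u), (False, v)) | u v. (u, v) \<in> A1} \<union> {((True, u), (True, v)) | u v. (u, v) \<in> A2}
     \<union> {((b, v), (\<not> b, v)) | b v. v \<in> H}"

definition linked :: "nat \<Rightarrow> (nat \<times> nat) set \<Rightarrow> (nat \<times> nat) set \<Rightarrow> nat set \<Rightarrow> bool" where
  "linked n A1 A2 H \<longleftrightarrow> (\<exists>u v. giant n A1 u = 1 \<and> giant n A2 v = 1 \<and> ((False, u), (True, v)) \<in> (ladder A1 A2 H)\<^sup>*)"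

lemma ladder_reach:
  shows "v \<in> reach A1 u \<Longrightarrow> ((False, u), (False, v)) \<in> (ladder A1 A2 H)\<^sup>*"
    and "v \<in> reach A2 u \<Longrightarrow> ((True, u), (True, v)) \<in> (ladder A1 A2 H)\<^sup>*"
proof -
  show "((False, u), (False, v)) \<in> (ladder A1 A2 H)\<^sup>*" if "v \<in> reach A1 u"
    using that unfolding reach_def Image_singleton_iff
    by (induction rule: rtrancl_induct) (auto simp: ladder_def elim!: rtrancl_into_rtrancl)
  show "((True, u), (True, v)) \<in> (ladder A1 A2 H)\<^sup>*" if "v \<in> reach A2 u"
    using that unfolding reach_def Image_singleton_iff
    by (induction rule: rtrancl_induct) (auto simp: ladder_def elim!: rtrancl_into_rtrancl)
qed

section \<open>Counting the columns between two unlinked giants\<close>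

lemma sum_of_bool_mem: "(\<Sum>v<n. of_bool (v \<in> S)) = real (card ({..<n} \<inter> S))" for n :: nat
  by (simp add: of_bool_def sum.If_cases Int_def)

text \<open>A weight that is constant on components is an average of component indicators, with
  coefficients at most \<open>1 / (\<eta> * n)\<close>. The weights used later depend on the rungs
  as well; the bound on the right no longer contains them and so can be averaged by independence of
  the layers.\<close>

lemma component_weight_bound:
  fixes c e :: "nat \<Rightarrow> real" and \<eta> :: real
  assumes A: "graph_on n A" and c: "\<And>v. 0 \<le> c v" "\<And>v. c v \<le> 1"
    and const: "\<And>u v. v \<in> reach A u \<Longrightarrow> c v = c u"
    and large: "\<And>v. v < n \<Longrightarrow> c v \<noteq> 0 \<Longrightarrow> \<eta> * n \<le> card (reach A v)" and eta: "\<eta> > 0" and n: "n > 0"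
  shows "\<bar>\<Sum>v<n. c v * e v\<bar> \<le> 1 / (\<eta> * n) * (\<Sum>u<n. \<bar>\<Sum>v<n. of_bool (v \<in> reach A u) * e v\<bar>)"
proof -
  define r where "r v = real (card (reach A v))" for v
  have r: "r v > 0" if "v < n" for v
    using finite_reach[OF A that] reach_self[of v A] by (auto simp: r_def card_gt_0_iff)
  have "(\<Sum>v<n. c v * e v) = (\<Sum>v<n. \<Sum>u<n. c u / r u * (of_bool (v \<in> reach A u) * e v))"
  proof (intro sum.cong refl)
    fix v assume v: "v \<in> {..<n}"
    have "(\<Sum>u<n. c u / r u * (of_bool (v \<in> reach A u) * e v))
        = (\<Sum>u<n. of_bool (u \<in> reach A v) * (c v / r v * e v))"
    proof (intro sum.cong refl)
      fix u
      show "c u / r u * (of_bool (v \<in> reach A u) * e v) = of_bool (u \<in> reach A v) * (c v / r v * e v)"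
      proof (cases "u \<in> reach A v")
        case True
        then have "reach A u = reach A v" using reach_eq[OF A] by metis
        then show ?thesis using True const[OF True] reach_sym[OF A, of v u] by (simp add: r_def)
      qed (use reach_sym[OF A, of v u] in simp)
    qed
    also have "\<dots> = real (card ({..<n} \<inter> reach A v)) * (c v / r v * e v)"
      unfolding sum_distrib_right[symmetric] sum_of_bool_mem ..
    also have "{..<n} \<inter> reach A v = reach A v" using reach_subset[OF A] v by auto
    also have "real (card (reach A v)) * (c v / r v * e v) = c v * e v"
      using r[of v] v by (simp add: r_def)
    finally show "c v * e v = (\<Sum>u<n. c u / r u * (of_bool (v \<in> reach A u) * e v))" by simp
  qed
  also have "\<dots> = (\<Sum>u<n. c u / r u * (\<Sum>v<n. of_bool (v \<in> reach A u) * e v))"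
    unfolding sum_distrib_left by (rule sum.swap)
  finally have "\<bar>\<Sum>v<n. c v * e v\<bar> = \<bar>\<Sum>u<n. c u / r u * (\<Sum>v<n. of_bool (v \<in> reach A u) * e v)\<bar>" by simp
  also have "\<dots> \<le> (\<Sum>u<n. \<bar>c u / r u * (\<Sum>v<n. of_bool (v \<in> reach A u) * e v)\<bar>)" by (rule sum_abs)
  also have "\<dots> \<le> (\<Sum>u<n. 1 / (\<eta> * n) * \<bar>\<Sum>v<n. of_bool (v \<in> reach A u) * e v\<bar>)"
  proof (intro sum_mono)
    fix u assume u: "u \<in> {..<n}"
    have "\<bar>c u / r u\<bar> \<le> 1 / (\<eta> * n)"
    proof (cases "c u = 0")
      case True then show ?thesis using eta by simp
    next
      case False
      then have "\<eta> * n \<le> r u" using large u by (simp add: r_def)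
      then show ?thesis using c[of u] r[of u] u eta n by (auto intro!: frac_le)
    qed
    then show "\<bar>c u / r u * (\<Sum>v<n. of_bool (v \<in> reach A u) * e v)\<bar> \<le> 1 / (\<eta> * n) * \<bar>\<Sum>v<n. of_bool (v \<in> reach A u) * e v\<bar>"
      unfolding abs_mult by (intro mult_right_mono) auto
  qed
  finally show ?thesis by (simp add: sum_distrib_left)
qed

text \<open>The deviations of the labels of \<open>A1\<close> from their means, tested only against
  weights that are determined by \<open>A2\<close>. With \<open>A2\<close> fixed, each of them is
  small in expectation.\<close>

definition link_error ::
  "nat \<Rightarrow> real \<Rightarrow> (nat \<times> nat) set \<Rightarrow> (nat \<times> nat) set \<Rightarrow> (nat \<Rightarrow> real) \<Rightarrow> (nat \<Rightarrow> real) \<Rightarrow> real" where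
  "link_error n \<eta> A1 A2 x z =
     \<bar>\<Sum>v<n. giant n A2 v * (giant n A1 v - x v)\<bar> + \<bar>\<Sum>v<n. medium \<eta> n A2 v * (medium \<eta> n A1 v - z v)\<bar>
     + 1 / (\<eta> * n) * (\<Sum>u<n. \<bar>\<Sum>v<n. of_bool (v \<in> reach A2 u) * (giant n A1 v - x v)\<bar>)
     + 1 / (\<eta> * n) * (\<Sum>u<n. \<bar>\<Sum>v<n. of_bool (v \<in> reach A2 u) * (medium \<eta> n A1 v - z v)\<bar>)"

text \<open>The weight \<open>R v * medium \<eta> n A2 v\<close> is constant on the components of
  \<open>A2\<close>, so \<open>component_weight_bound\<close> replaces the labels by their means.
  What remains is a weighted sum of \<open>x v - z v\<close>, nonnegative outside \<open>B\<close>;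
  this is where the ordering of the means enters.\<close>

lemma cross_term_bound:
  fixes R :: "nat \<Rightarrow> real" and \<eta> :: real
  assumes A1: "graph_on n A1" and A2: "graph_on n A2" and eta: "\<eta> > 0" and n: "n > 0"
    and R: "\<And>v. R v = 0 \<or> R v = 1" and const: "\<And>u v. v \<in> reach A2 u \<Longrightarrow> R v = R u"
    and b: "\<And>v. 0 \<le> x v \<and> 0 \<le> z v \<and> x v + z v \<le> 1" and B: "\<And>v. v < n \<Longrightarrow> v \<notin> B \<Longrightarrow> z v \<le> x v" and BB: "B \<subseteq> {..<n}"
  shows "- real (card B) - 1 / (\<eta> * n) * (\<Sum>u<n. \<bar>\<Sum>v<n. of_bool (v \<in> reach A2 u) * (giant n A1 v - x v)\<bar>)
     - 1 / (\<eta> * n) * (\<Sum>u<n. \<bar>\<Sum>v<n. of_bool (v \<in> reach A2 u) * (medium \<eta> n A1 v - z v)\<bar>)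
     \<le> (\<Sum>v<n. R v * medium \<eta> n A2 v * (giant n A1 v - medium \<eta> n A1 v))"
proof -
  define c where "c v = R v * medium \<eta> n A2 v" for v
  have c01: "0 \<le> c v" "c v \<le> 1" for v using R[of v] by (auto simp: c_def medium_def)
  have cc: "c v = c u" if "v \<in> reach A2 u" for u v
  proof -
    have "reach A2 v = reach A2 u" using reach_eq[OF A2 that] .
    moreover have "v < n \<longleftrightarrow> u < n"
      using reach_subset[OF A2] reach_sym[OF A2] that by blast
    ultimately show ?thesis using const[OF that] by (simp add: c_def medium_def)
  qed
  have cl: "\<eta> * n \<le> card (reach A2 v)" if "c v \<noteq> 0" for v
    using that by (auto simp: c_def medium_def)
  have eq: "(\<Sum>v<n. c v * (giant n A1 v - medium \<eta> n A1 v))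
     = (\<Sum>v<n. c v * (x v - z v)) + (\<Sum>v<n. c v * (giant n A1 v - x v)) - (\<Sum>v<n. c v * (medium \<eta> n A1 v - z v))"
    by (simp add: sum.distrib[symmetric] sum_subtractf[symmetric] algebra_simps)
  have low: "(\<Sum>v<n. c v * (x v - z v)) \<ge> - real (card B)"
  proof -
    have "(\<Sum>v<n. - of_bool (v \<in> B)) \<le> (\<Sum>v<n. c v * (x v - z v))"
    proof (intro sum_mono)
      fix v assume v: "v \<in> {..<n}"
      show "- of_bool (v \<in> B) \<le> c v * (x v - z v)"
      proof (cases "v \<in> B")
        case True
        have "\<bar>c v * (x v - z v)\<bar> \<le> 1 * 1" unfolding abs_mult
          using c01[of v] b[of v] by (intro mult_mono) auto
        then show ?thesis using True by simp
      qed (use B[of v] v c01[of v] in auto)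
    qed
    moreover have "(\<Sum>v<n. - of_bool (v \<in> B)) = - real (card ({..<n} \<inter> B))"
      by (simp add: of_bool_def sum_negf sum.If_cases Int_def)
    moreover have "{..<n} \<inter> B = B" using BB by auto
    ultimately show ?thesis by simp
  qed
  have cw: "\<bar>\<Sum>v<n. c v * e v\<bar> \<le> 1 / (\<eta> * n) * (\<Sum>u<n. \<bar>\<Sum>v<n. of_bool (v \<in> reach A2 u) * e v\<bar>)" for e
    by (rule component_weight_bound[OF A2 c01 _ _ eta n]) (erule cc, erule cl)
  show ?thesis using eq low cw[of "\<lambda>v. giant n A1 v - x v"] cw[of "\<lambda>v. medium \<eta> n A1 v - z v"] unfolding c_def by linarith
qed

text \<open>With \<open>R1\<close>, \<open>R2\<close> marking the vertices connected to the giant of the first layer, a horizontal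
  edge needs \<open>R1 v = R2 v\<close>; the pointwise inequality below is the count of the columns
  where this fails. Only the sums over giants and over all medium components have to be
  controlled, because the two correction terms are nonnegative on average.\<close>

lemma unlinked_bound:
  fixes x z y w :: "nat \<Rightarrow> real"
  assumes A1: "graph_on n A1" and A2: "graph_on n A2" and H: "H \<subseteq> {..<n}" and eta: "\<eta> > 0" and n: "n > 0"
    and nl: "\<not> linked n A1 A2 H"
    and bx: "\<And>v. 0 \<le> x v \<and> 0 \<le> z v \<and> x v + z v \<le> 1" and b2: "\<And>v. 0 \<le> y v \<and> 0 \<le> w v \<and> y v + w v \<le> 1"
    and q: "4 - 2 * sqrt 3 \<le> q"
  defines "B1 \<equiv> {v\<in>{..<n}. \<not> (q \<le> (x v)\<^sup>2 + (z v)\<^sup>2 \<and> z v \<le> x v)}"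
    and "B2 \<equiv> {v\<in>{..<n}. \<not> (q \<le> (y v)\<^sup>2 + (w v)\<^sup>2 \<and> w v \<le> y v)}"
  shows "sqrt 3 / 2 * q * (real n - card B1 - card B2) - card B1 - card B2 \<le>
     real n - card H + link_error n \<eta> A1 A2 x z + link_error n \<eta> A2 A1 y w
     + \<bar>\<Sum>v<n. x v * (giant n A2 v - y v)\<bar> + \<bar>\<Sum>v<n. z v * (medium \<eta> n A2 v - w v)\<bar>"
proof -
  let ?L = "(ladder A1 A2 H)\<^sup>*"
  define R1 where "R1 v = (of_bool (\<exists>u. giant n A1 u = 1 \<and> ((False,u),(False,v)) \<in> ?L) :: real)" for v
  define R2 where "R2 v = (of_bool (\<exists>u. giant n A1 u = 1 \<and> ((False,u),(True,v)) \<in> ?L) :: real)" for v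
  have R01: "R1 v = 0 \<or> R1 v = 1" "R2 v = 0 \<or> R2 v = 1" for v by (auto simp: R1_def R2_def)
  have RH: "R1 v = R2 v" if "v \<in> H" for v
  proof -
    have "((False,v),(True,v)) \<in> ladder A1 A2 H" "((True,v),(False,v)) \<in> ladder A1 A2 H"
      using that by (auto simp: ladder_def)
    then show ?thesis unfolding R1_def R2_def of_bool_eq_iff
      by (blast intro: rtrancl_into_rtrancl)
  qed
  have Rg1: "R1 v = 1" if "giant n A1 v = 1" for v using that by (auto simp: R1_def)
  have Rg2: "R2 v = 0" if "giant n A2 v = 1" for v
    using that nl by (auto simp: R2_def linked_def)
  have c1: "R1 v = R1 u" if "v \<in> reach A1 u" for u v
  proof -
    have "u \<in> reach A1 v" using that reach_sym[OF A1] by blast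
    then have "((False,u),(False,v)) \<in> ?L" "((False,v),(False,u)) \<in> ?L"
      using that ladder_reach(1) by auto
    then show ?thesis unfolding R1_def by (meson rtrancl_trans)
  qed
  have c2: "R2 v = R2 u" if "v \<in> reach A2 u" for u v
  proof -
    have "u \<in> reach A2 v" using that reach_sym[OF A2] by blast
    then have "((True,u),(True,v)) \<in> ?L" "((True,v),(True,u)) \<in> ?L"
      using that ladder_reach(2) by auto
    then show ?thesis unfolding R2_def by (meson rtrancl_trans)
  qed
  let ?g1 = "giant n A1" and ?g2 = "giant n A2" and ?s1 = "medium \<eta> n A1" and ?s2 = "medium \<eta> n A2"
  \<comment> \<open>Columns with two medium labels contribute \<open>R2 v - R1 v\<close>, mixed
    columns \<open>1 - R2 v\<close> or \<open>R1 v\<close>; each vanishes if the rung is present. A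
    column with two giant labels has \<open>R1 v = 1\<close> and \<open>R2 v = 0\<close>, so its
    rung is absent.\<close>
  have pt: "?g1 v * ?g2 v + ?s1 v * ?s2 v + (1 - R2 v) * ?s2 v * (?g1 v - ?s1 v) + R1 v * ?s1 v * (?g2 v - ?s2 v)
      \<le> 1 - of_bool (v \<in> H)" for v
  proof -
    have "(?g1 v, ?s1 v) \<in> {(1,0),(0,1),(0,0)}" "(?g2 v, ?s2 v) \<in> {(1,0),(0,1),(0,0)}"
      by (auto simp: giant_def medium_def)
    then show ?thesis using RH[of v] Rg1[of v] Rg2[of v] R01[of v] by auto
  qed
  have "(\<Sum>v<n. ?g1 v * ?g2 v) + (\<Sum>v<n. ?s1 v * ?s2 v) + (\<Sum>v<n. (1 - R2 v) * ?s2 v * (?g1 v - ?s1 v))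
     + (\<Sum>v<n. R1 v * ?s1 v * (?g2 v - ?s2 v)) \<le> (\<Sum>v<n. 1 - of_bool (v \<in> H))"
    unfolding sum.distrib[symmetric] by (intro sum_mono pt)
  also have "\<dots> = real n - card ({..<n} \<inter> H)"
    by (simp add: sum_subtractf of_bool_def sum.If_cases Int_def)
  also have "{..<n} \<inter> H = H" using H by auto
  finally have main: "(\<Sum>v<n. ?g1 v * ?g2 v) + (\<Sum>v<n. ?s1 v * ?s2 v) + (\<Sum>v<n. (1 - R2 v) * ?s2 v * (?g1 v - ?s1 v))
     + (\<Sum>v<n. R1 v * ?s1 v * (?g2 v - ?s2 v)) \<le> real n - card H" .
  have T2: "- real (card B1) - 1 / (\<eta> * n) * (\<Sum>u<n. \<bar>\<Sum>v<n. of_bool (v \<in> reach A2 u) * (?g1 v - x v)\<bar>)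
     - 1 / (\<eta> * n) * (\<Sum>u<n. \<bar>\<Sum>v<n. of_bool (v \<in> reach A2 u) * (?s1 v - z v)\<bar>)
     \<le> (\<Sum>v<n. (1 - R2 v) * ?s2 v * (?g1 v - ?s1 v))"
    by (rule cross_term_bound[OF A1 A2 eta n]) (use bx R01 c2 in \<open>auto simp: B1_def\<close>)
  have T1: "- real (card B2) - 1 / (\<eta> * n) * (\<Sum>u<n. \<bar>\<Sum>v<n. of_bool (v \<in> reach A1 u) * (?g2 v - y v)\<bar>)
     - 1 / (\<eta> * n) * (\<Sum>u<n. \<bar>\<Sum>v<n. of_bool (v \<in> reach A1 u) * (?s2 v - w v)\<bar>)
     \<le> (\<Sum>v<n. R1 v * ?s1 v * (?g2 v - ?s2 v))"
    by (rule cross_term_bound[OF A2 A1 eta n]) (use b2 R01 c1 in \<open>auto simp: B2_def\<close>)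
  \<comment> \<open>The means are inserted one layer at a time, so that each deviation is weighted
    by a quantity of the opposite layer.\<close>
  have gg: "(\<Sum>v<n. ?g1 v * ?g2 v) = (\<Sum>v<n. x v * y v) + (\<Sum>v<n. ?g2 v * (?g1 v - x v)) + (\<Sum>v<n. x v * (?g2 v - y v))"
    by (simp add: sum.distrib[symmetric] algebra_simps)
  have ss: "(\<Sum>v<n. ?s1 v * ?s2 v) = (\<Sum>v<n. z v * w v) + (\<Sum>v<n. ?s2 v * (?s1 v - z v)) + (\<Sum>v<n. z v * (?s2 v - w v))"
    by (simp add: sum.distrib[symmetric] algebra_simps)
  have q0: "0 \<le> sqrt 3 / 2 * q"
  proof -
    have "sqrt 3 \<le> (2::real)" by (rule real_le_lsqrt) auto
    then show ?thesis using q by simp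
  qed
  have "(\<Sum>v<n. sqrt 3 / 2 * q * (1 - of_bool (v \<in> B1) - of_bool (v \<in> B2))) \<le> (\<Sum>v<n. x v * y v + z v * w v)"
  proof (intro sum_mono)
    fix v assume v: "v \<in> {..<n}"
    have nn: "0 \<le> x v * y v + z v * w v" using bx[of v] b2[of v] by simp
    show "sqrt 3 / 2 * q * (1 - of_bool (v \<in> B1) - of_bool (v \<in> B2)) \<le> x v * y v + z v * w v"
    proof (cases "v \<in> B1 \<or> v \<in> B2")
      case True
      then have "sqrt 3 / 2 * q * (1 - of_bool (v \<in> B1) - of_bool (v \<in> B2)) \<le> 0"
        using q0 by (intro mult_nonneg_nonpos) auto
      then show ?thesis using nn by linarith
    next
      case False
      then have "q \<le> (x v)\<^sup>2 + (z v)\<^sup>2 \<and> z v \<le> x v" "q \<le> (y v)\<^sup>2 + (w v)\<^sup>2 \<and> w v \<le> y v"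
        using v by (auto simp: B1_def B2_def)
      then have "sqrt 3 / 2 * q \<le> x v * y v + z v * w v"
        using cone_product[of "z v" "x v" q "w v" "y v"] bx[of v] b2[of v] q by blast
      then show ?thesis using False by simp
    qed
  qed
  moreover have "(\<Sum>v<n. sqrt 3 / 2 * q * (1 - of_bool (v \<in> B1) - of_bool (v \<in> B2)))
      = sqrt 3 / 2 * q * (real n - card B1 - card B2)"
  proof -
    have "{..<n} \<inter> B1 = B1" "{..<n} \<inter> B2 = B2" by (auto simp: B1_def B2_def)
    then have "(\<Sum>v<n. 1 - of_bool (v \<in> B1) - of_bool (v \<in> B2)) = real n - card B1 - card B2"
      by (simp only: sum_subtractf sum_of_bool_mem) simp
    then show ?thesis by (simp only: sum_distrib_left[symmetric])
  qed
  ultimately have "sqrt 3 / 2 * q * (real n - card B1 - card B2) \<le> (\<Sum>v<n. x v * y v) + (\<Sum>v<n. z v * w v)"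
    by (simp add: sum.distrib)
  then show ?thesis
    using main T1 T2 gg ss unfolding link_error_def by linarith
qed

section \<open>Probability that the giants of adjacent layers are linked\<close>

text \<open>The layers are independent of each other and the rungs are pairwise independent. The
  joint law of rungs and layers is left arbitrary, since they share vertices.\<close>

definition two_layer_law :: "nat \<Rightarrow> real \<Rightarrow> ((nat \<times> nat) set \<times> (nat \<times> nat) set \<times> nat set) pmf \<Rightarrow> bool" where
  "two_layer_law n p J \<longleftrightarrow>
     layer_law n p (map_pmf fst J) \<and> layer_law n p (map_pmf (fst \<circ> snd) J) \<and>
     map_pmf (\<lambda>w. (fst w, fst (snd w))) J = pair_pmf (map_pmf fst J) (map_pmf (fst \<circ> snd) J) \<and>
     (\<forall>w\<in>set_pmf J. snd (snd w) \<subseteq> {..<n}) \<and>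
     (\<forall>v<n. measure_pmf.prob J {w. v \<in> snd (snd w)} = p) \<and>
     (\<forall>u<n. \<forall>v<n. u \<noteq> v \<longrightarrow> measure_pmf.prob J {w. u \<in> snd (snd w) \<and> v \<in> snd (snd w)} = p\<^sup>2)"

lemma expct_pair_le:
  assumes fin: "finite (set_pmf P)" "finite (set_pmf Q)"
  shows "(\<And>b. b \<in> set_pmf Q \<Longrightarrow> expct P (\<lambda>a. F a b) \<le> c) \<Longrightarrow> expct (pair_pmf P Q) (\<lambda>w. F (fst w) (snd w)) \<le> c"
    and "(\<And>a. a \<in> set_pmf P \<Longrightarrow> expct Q (\<lambda>b. F a b) \<le> c) \<Longrightarrow> expct (pair_pmf P Q) (\<lambda>w. F (fst w) (snd w)) \<le> c"
proof -
  have fPQ: "finite (set_pmf (pair_pmf P Q))" using fin by simp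
  have eq1: "expct (pair_pmf P Q) (\<lambda>w. F (fst w) (snd w)) = expct Q (\<lambda>b. expct P (\<lambda>a. F a b))"
    unfolding expct_sum[OF fPQ] expct_sum[OF fin(1)] expct_sum[OF fin(2)] set_pair_pmf
    by (simp add: sum.cartesian_product' pmf_pair sum_distrib_left mult_ac) (rule sum.swap)
  have eq2: "expct (pair_pmf P Q) (\<lambda>w. F (fst w) (snd w)) = expct P (\<lambda>a. expct Q (\<lambda>b. F a b))"
    unfolding expct_sum[OF fPQ] expct_sum[OF fin(1)] expct_sum[OF fin(2)] set_pair_pmf
    by (simp add: sum.cartesian_product' pmf_pair sum_distrib_left mult_ac)
  show "expct (pair_pmf P Q) (\<lambda>w. F (fst w) (snd w)) \<le> c" if "\<And>b. b \<in> set_pmf Q \<Longrightarrow> expct P (\<lambda>a. F a b) \<le> c"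
    unfolding eq1 using expct_mono[OF fin(2), of "\<lambda>b. expct P (\<lambda>a. F a b)" "\<lambda>_. c"] that by simp
  show "expct (pair_pmf P Q) (\<lambda>w. F (fst w) (snd w)) \<le> c" if "\<And>a. a \<in> set_pmf P \<Longrightarrow> expct Q (\<lambda>b. F a b) \<le> c"
    unfolding eq2 using expct_mono[OF fin(1), of "\<lambda>a. expct Q (\<lambda>b. F a b)" "\<lambda>_. c"] that by simp
qed

lemma link_error_bound:
  fixes \<eta> \<tau> :: real
  assumes fin: "finite (set_pmf P)" and eta: "\<eta> > 0" and n: "n > 0"
    and x: "\<And>a. (\<forall>v. \<bar>a v\<bar> \<le> (1::real)) \<Longrightarrow>
       expct P (\<lambda>A. \<bar>\<Sum>v<n. a v * (giant n A v - x A v)\<bar>) \<le> \<tau> * n \<and>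
       expct P (\<lambda>A. \<bar>\<Sum>v<n. a v * (medium \<eta> n A v - z A v)\<bar>) \<le> \<tau> * n"
  shows "expct P (\<lambda>A. link_error n \<eta> A B (x A) (z A)) \<le> 2 * \<tau> * n + 2 * \<tau> * n / \<eta>"
proof -
  note J[simp] = integrable_finite_pmf[OF fin]
  have "expct P (\<lambda>A. link_error n \<eta> A B (x A) (z A)) =
     expct P (\<lambda>A. \<bar>\<Sum>v<n. giant n B v * (giant n A v - x A v)\<bar>)
     + expct P (\<lambda>A. \<bar>\<Sum>v<n. medium \<eta> n B v * (medium \<eta> n A v - z A v)\<bar>)
     + 1 / (\<eta> * n) * (\<Sum>u<n. expct P (\<lambda>A. \<bar>\<Sum>v<n. of_bool (v \<in> reach B u) * (giant n A v - x A v)\<bar>))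
     + 1 / (\<eta> * n) * (\<Sum>u<n. expct P (\<lambda>A. \<bar>\<Sum>v<n. of_bool (v \<in> reach B u) * (medium \<eta> n A v - z A v)\<bar>))"
    unfolding link_error_def by simp
  also have "\<dots> \<le> \<tau> * n + \<tau> * n + 1 / (\<eta> * n) * (\<Sum>u<n. \<tau> * n) + 1 / (\<eta> * n) * (\<Sum>u<n. \<tau> * n)"
  proof (intro add_mono mult_left_mono sum_mono)
    show "expct P (\<lambda>A. \<bar>\<Sum>v<n. giant n B v * (giant n A v - x A v)\<bar>) \<le> \<tau> * n"
      using x[of "giant n B"] by (simp add: giant_def)
    show "expct P (\<lambda>A. \<bar>\<Sum>v<n. medium \<eta> n B v * (medium \<eta> n A v - z A v)\<bar>) \<le> \<tau> * n"
      using x[of "medium \<eta> n B"] by (simp add: medium_def)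
    show "expct P (\<lambda>A. \<bar>\<Sum>v<n. of_bool (v \<in> reach B u) * (giant n A v - x A v)\<bar>) \<le> \<tau> * n"
      "expct P (\<lambda>A. \<bar>\<Sum>v<n. of_bool (v \<in> reach B u) * (medium \<eta> n A v - z A v)\<bar>) \<le> \<tau> * n" for u
      using x[of "\<lambda>v. of_bool (v \<in> reach B u)"] by simp_all
  qed (use eta in auto)
  also have "\<dots> = 2 * \<tau> * n + 2 * \<tau> * n / \<eta>" using n eta by (simp add: field_simps)
  finally show ?thesis .
qed

text \<open>Outside rare events, unlinked giants require an error that is linear in
  \<open>n\<close>, while the expected error is a small multiple of \<open>n\<close>. The bound 3/4
  is the one demanded by \<open>one_dependent_chain\<close>.\<close>

lemma two_layer_linked:
  fixes p :: real
  assumes p: "4 - 2 * sqrt 3 < p" "p \<le> 1"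
  shows "\<exists>N. \<forall>n\<ge>N. \<forall>J. two_layer_law n p J \<longrightarrow>
     measure_pmf.prob J {w. linked n (fst w) (fst (snd w)) (snd (snd w))} \<ge> 3 / 4"
proof -
  have s3: "sqrt 3 < (7/4::real)" "1 \<le> sqrt (3::real)"
    by (rule real_less_lsqrt) (auto simp: power2_eq_square)
  \<comment> \<open>The surplus of rungs that would have to be absent over those that are absent. It
    is an increasing function of \<open>p\<close> and vanishes exactly at the threshold.\<close>
  define \<gamma> where "\<gamma> = sqrt 3 / 2 * p - (1 - p)"
  have "(1 + sqrt 3 / 2) * (4 - 2 * sqrt 3) < (1 + sqrt 3 / 2) * p"
    using p s3 by (intro mult_strict_left_mono) auto
  moreover have "(1 + sqrt 3 / 2) * (4 - 2 * sqrt 3) = (1::real)" by (simp add: field_simps)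
  ultimately have gam: "\<gamma> > 0" by (simp add: \<gamma>_def algebra_simps)
  \<comment> \<open>The second entry keeps \<open>p - \<beta>\<close> at or above the threshold, as
    the cone bound requires. The first one ensures that at least \<open>\<gamma> / 2\<close> is left
    after a loss of \<open>5 * \<beta>\<close>: four from the two exceptional sets and one from
    replacing \<open>p\<close> by \<open>p - \<beta>\<close>.\<close>
  define \<beta> where "\<beta> = min (\<gamma> / 10) (p - (4 - 2 * sqrt 3))"
  have beta: "0 < \<beta>" "\<beta> \<le> \<gamma> / 10" "\<beta> \<le> p - (4 - 2 * sqrt 3)"
    unfolding \<beta>_def using gam p by - (simp, rule min.cobounded1, rule min.cobounded2)
  have q: "4 - 2 * sqrt 3 \<le> p - \<beta>" using beta by simp
  have pb: "1/2 + \<beta> \<le> p" using q s3 by simp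
  have beta1: "\<beta> \<le> 1" using pb p by simp
  define \<eta> where "\<eta> = \<beta>^3 / 16"
  have eta: "\<eta> > 0" "\<eta> \<le> \<beta>^3 / 16" using beta by (auto simp: \<eta>_def)
  have eta1: "\<eta> \<le> 1" using power_le_one[of \<beta> 3] beta beta1 by (simp add: \<eta>_def)
  \<comment> \<open>The label errors amount to at most \<open>10 * \<tau> * n / \<eta>\<close>,
    which has to be small against \<open>\<gamma> * n\<close>. The bound \<open>1/32\<close> makes
    the two exceptional events cost at most \<open>1/16\<close>, which together with
    \<open>3/16\<close> gives \<open>1/4\<close>.\<close>
  define \<tau> where "\<tau> = min (1/32) (\<gamma> * \<eta> / 512)"
  have tau: "\<tau> > 0" "\<tau> \<le> 1/32" "\<tau> \<le> \<gamma> * \<eta> / 512"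
    unfolding \<tau>_def using gam eta by - (simp, rule min.cobounded1, rule min.cobounded2)
  obtain N where N: "\<And>n P. n \<ge> N \<Longrightarrow> layer_law n p P \<Longrightarrow> \<exists>x z.
    (\<forall>A v. 0 \<le> x A v \<and> 0 \<le> z A v \<and> x A v + z A v \<le> (1::real)) \<and>
    (\<forall>a. (\<forall>v. \<bar>a v\<bar> \<le> (1::real)) \<longrightarrow>
       expct P (\<lambda>A. \<bar>\<Sum>v<n. a v * (giant n A v - x A v)\<bar>) \<le> \<tau> * n \<and>
       expct P (\<lambda>A. \<bar>\<Sum>v<n. a v * (medium \<eta> n A v - z A v)\<bar>) \<le> \<tau> * n) \<and>
    measure_pmf.prob P {A. real (card {v\<in>{..<n}. \<not> (p - \<beta> \<le> (x A v)\<^sup>2 + (z A v)\<^sup>2 \<and> z A v \<le> x A v)}) > \<beta> * n} \<le> \<tau>"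
    using layer_structure[OF pb p(2) beta(1) less_imp_le[OF eta(1)] eta(2) tau(1)] by blast
  have "eventually (\<lambda>n::nat. sqrt (real n) \<le> \<gamma> / 16 * real n) sequentially"
    using gam by real_asymp
  then obtain N2 where N2: "\<And>n. n \<ge> N2 \<Longrightarrow> sqrt (real n) \<le> \<gamma> / 16 * real n"
    by (auto simp: eventually_sequentially)
  show ?thesis
  proof (intro exI[of _ "max (max N N2) 1"] allI impI)
    fix n J assume n: "max (max N N2) 1 \<le> n" and L: "two_layer_law n p J"
    have n0: "n > 0" using n by simp
    let ?A1 = "\<lambda>w. fst w" and ?A2 = "\<lambda>w. fst (snd w)" and ?H = "\<lambda>w. snd (snd w)"
    define P1 where "P1 = map_pmf fst J"
    define P2 where "P2 = map_pmf (fst \<circ> snd) J"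
    have L1: "layer_law n p P1" and L2: "layer_law n p P2"
      and indep: "map_pmf (\<lambda>w. (?A1 w, ?A2 w)) J = pair_pmf P1 P2"
      and Hsub: "\<And>w. w \<in> set_pmf J \<Longrightarrow> ?H w \<subseteq> {..<n}"
      using L unfolding two_layer_law_def P1_def P2_def by auto
    have g1: "graph_on n (?A1 w)" and g2: "graph_on n (?A2 w)" if "w \<in> set_pmf J" for w
      using L1 L2 that by (auto simp: layer_law_def P1_def P2_def)
    have fin1: "finite (set_pmf P1)" and fin2: "finite (set_pmf P2)"
      using L1 L2 by (auto intro: layer_law_finite)
    have finJ: "finite (set_pmf J)"
    proof (rule finite_subset)
      show "set_pmf J \<subseteq> set_pmf P1 \<times> set_pmf P2 \<times> Pow {..<n}"
      proof
        fix w assume w: "w \<in> set_pmf J"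
        then have "?A1 w \<in> set_pmf P1" "?A2 w \<in> set_pmf P2" by (auto simp: P1_def P2_def)
        then show "w \<in> set_pmf P1 \<times> set_pmf P2 \<times> Pow {..<n}" using Hsub[OF w] by (auto simp: mem_Times_iff)
      qed
      show "finite (set_pmf P1 \<times> set_pmf P2 \<times> Pow {..<n})" using fin1 fin2 by auto
    qed
    note Jint[simp] = integrable_finite_pmf[OF finJ]
    obtain x z where b1: "\<And>A v. 0 \<le> x A v \<and> 0 \<le> z A v \<and> x A v + z A v \<le> (1::real)"
      and d1: "\<And>a. (\<forall>v. \<bar>a v\<bar> \<le> (1::real)) \<Longrightarrow>
       expct P1 (\<lambda>A. \<bar>\<Sum>v<n. a v * (giant n A v - x A v)\<bar>) \<le> \<tau> * n \<and>
       expct P1 (\<lambda>A. \<bar>\<Sum>v<n. a v * (medium \<eta> n A v - z A v)\<bar>) \<le> \<tau> * n"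
      and bad1: "measure_pmf.prob P1 {A. real (card {v\<in>{..<n}. \<not> (p - \<beta> \<le> (x A v)\<^sup>2 + (z A v)\<^sup>2 \<and> z A v \<le> x A v)}) > \<beta> * n} \<le> \<tau>"
      using N[OF _ L1] n by auto
    obtain y u where b2: "\<And>A v. 0 \<le> y A v \<and> 0 \<le> u A v \<and> y A v + u A v \<le> (1::real)"
      and d2: "\<And>a. (\<forall>v. \<bar>a v\<bar> \<le> (1::real)) \<Longrightarrow>
       expct P2 (\<lambda>A. \<bar>\<Sum>v<n. a v * (giant n A v - y A v)\<bar>) \<le> \<tau> * n \<and>
       expct P2 (\<lambda>A. \<bar>\<Sum>v<n. a v * (medium \<eta> n A v - u A v)\<bar>) \<le> \<tau> * n"
      and bad2: "measure_pmf.prob P2 {A. real (card {v\<in>{..<n}. \<not> (p - \<beta> \<le> (y A v)\<^sup>2 + (u A v)\<^sup>2 \<and> u A v \<le> y A v)}) > \<beta> * n} \<le> \<tau>"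
      using N[OF _ L2] n by auto
    define B1 where "B1 A = {v\<in>{..<n}. \<not> (p - \<beta> \<le> (x A v)\<^sup>2 + (z A v)\<^sup>2 \<and> z A v \<le> x A v)}" for A
    define B2 where "B2 A = {v\<in>{..<n}. \<not> (p - \<beta> \<le> (y A v)\<^sup>2 + (u A v)\<^sup>2 \<and> u A v \<le> y A v)}" for A
    define f1 where "f1 w = link_error n \<eta> (?A1 w) (?A2 w) (x (?A1 w)) (z (?A1 w))" for w :: "(nat \<times> nat) set \<times> (nat \<times> nat) set \<times> nat set"
    define f2 where "f2 w = link_error n \<eta> (?A2 w) (?A1 w) (y (?A2 w)) (u (?A2 w))" for w :: "(nat \<times> nat) set \<times> (nat \<times> nat) set \<times> nat set"
    define f3 where "f3 w = \<bar>\<Sum>v<n. x (?A1 w) v * (giant n (?A2 w) v - y (?A2 w) v)\<bar>" for w :: "(nat \<times> nat) set \<times> (nat \<times> nat) set \<times> nat set"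
    define f4 where "f4 w = \<bar>\<Sum>v<n. z (?A1 w) v * (medium \<eta> n (?A2 w) v - u (?A2 w) v)\<bar>" for w :: "(nat \<times> nat) set \<times> (nat \<times> nat) set \<times> nat set"
    define f5 where "f5 w = \<bar>\<Sum>v<n. 1 * (of_bool (v \<in> ?H w) - p)\<bar>" for w :: "(nat \<times> nat) set \<times> (nat \<times> nat) set \<times> nat set"
    have pairJ: "expct J (\<lambda>w. F (?A1 w) (?A2 w)) = expct (pair_pmf P1 P2) (\<lambda>w. F (fst w) (snd w))" for F
      unfolding indep[symmetric] by simp
    have F1: "expct J f1 \<le> 2 * \<tau> * n + 2 * \<tau> * n / \<eta>"
      unfolding f1_def pairJ[of "\<lambda>a b. link_error n \<eta> a b (x a) (z a)"]
      by (rule expct_pair_le(1)[OF fin1 fin2, where F = "\<lambda>a b. link_error n \<eta> a b (x a) (z a)"],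
          rule link_error_bound[OF fin1 eta(1) n0 d1], assumption)
    have F2: "expct J f2 \<le> 2 * \<tau> * n + 2 * \<tau> * n / \<eta>"
      unfolding f2_def pairJ[of "\<lambda>a b. link_error n \<eta> b a (y b) (u b)"]
      by (rule expct_pair_le(2)[OF fin1 fin2, where F = "\<lambda>a b. link_error n \<eta> b a (y b) (u b)"],
          rule link_error_bound[OF fin2 eta(1) n0 d2], assumption)
    have b1': "\<bar>x A v\<bar> \<le> 1" "\<bar>z A v\<bar> \<le> 1" for A v using b1[of A v] by auto
    have F3: "expct J f3 \<le> \<tau> * n"
      unfolding f3_def pairJ[of "\<lambda>a b. \<bar>\<Sum>v<n. x a v * (giant n b v - y b v)\<bar>"]
      by (rule expct_pair_le(2)[OF fin1 fin2, where F = "\<lambda>a b. \<bar>\<Sum>v<n. x a v * (giant n b v - y b v)\<bar>"],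
          rule conjunct1[OF d2]) (simp add: b1')
    have F4: "expct J f4 \<le> \<tau> * n"
      unfolding f4_def pairJ[of "\<lambda>a b. \<bar>\<Sum>v<n. z a v * (medium \<eta> n b v - u b v)\<bar>"]
      by (rule expct_pair_le(2)[OF fin1 fin2, where F = "\<lambda>a b. \<bar>\<Sum>v<n. z a v * (medium \<eta> n b v - u b v)\<bar>"],
          rule conjunct2[OF d2]) (simp add: b1')
    have F5: "expct J f5 \<le> sqrt n"
    proof -
      have "expct J f5 \<le> sqrt (card ((\<lambda>v. (v, v)) ` {..<n}))"
        unfolding f5_def
      proof (rule second_moment[OF finJ])
        fix v v' assume "v \<in> {..<n}" "v' \<in> {..<n}" "(v, v') \<notin> (\<lambda>v. (v, v)) ` {..<n}"
        then have "v < n" "v' < n" "v \<noteq> v'" by auto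
        then show "expct J (\<lambda>w. (of_bool (v \<in> ?H w) - p) * (of_bool (v' \<in> ?H w) - p)) = 0"
          using L by (intro covariance_zero[OF finJ]) (auto simp: two_layer_law_def)
      qed (use p s3 in auto)
      also have "card ((\<lambda>v. (v, v)) ` {..<n}) = n" by (simp add: card_image inj_on_def)
      finally show ?thesis by simp
    qed
    define E where "E w = f1 w + f2 w + f3 w + f4 w + f5 w" for w
    have "expct J E = expct J f1 + expct J f2 + expct J f3 + expct J f4 + expct J f5"
      unfolding E_def by simp
    also have "\<dots> \<le> 6 * \<tau> * n + 4 * \<tau> * n / \<eta> + sqrt n"
      using F1 F2 F3 F4 F5 by linarith
    also have "6 * \<tau> * n \<le> 6 * \<tau> * n / \<eta>"
      using tau eta eta1 by (simp add: le_divide_eq mult_left_le)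
    also have "6 * \<tau> * n / \<eta> + 4 * \<tau> * n / \<eta> + sqrt n \<le> \<gamma> * n * (10 / 512) + \<gamma> / 16 * n"
    proof -
      have "6 * \<tau> * n / \<eta> + 4 * \<tau> * n / \<eta> = \<tau> / \<eta> * (10 * n)" by (simp add: add_divide_distrib[symmetric])
      also have "\<dots> \<le> \<gamma> / 512 * (10 * n)"
        using tau eta by (intro mult_right_mono) (auto simp: pos_divide_le_eq)
      finally show ?thesis using N2[of n] n by simp
    qed
    also have "\<dots> \<le> \<gamma> / 2 * n * (3 / 16)" using gam by simp
    finally have EE: "expct J E \<le> \<gamma> / 2 * n * (3 / 16)" by simp
    define S where "S = {w. \<not> linked n (?A1 w) (?A2 w) (?H w)}"
    define S1 where "S1 = {w :: (nat \<times> nat) set \<times> (nat \<times> nat) set \<times> nat set. real (card (B1 (fst w))) > \<beta> * n}"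
    define S2 where "S2 = {w :: (nat \<times> nat) set \<times> (nat \<times> nat) set \<times> nat set. real (card (B2 (fst (snd w)))) > \<beta> * n}"
    have pS1: "measure_pmf.prob J S1 \<le> \<tau>"
      using bad1 unfolding P1_def measure_map_pmf S1_def B1_def by (simp add: vimage_def)
    have pS2: "measure_pmf.prob J S2 \<le> \<tau>"
      using bad2 unfolding P2_def measure_map_pmf S2_def B2_def by (simp add: vimage_def)
    \<comment> \<open>An unlinked configuration with few bad columns would have about
      \<open>sqrt 3 / 2 * p * n\<close> absent rungs, but only about \<open>(1 - p) * n\<close> are
      absent; the error \<open>E\<close> must account for the difference.\<close>
    have "measure_pmf.prob J (S - S1 - S2) \<le> expct J E / (\<gamma> / 2 * n)"
    proof (rule expct_markov[OF finJ])
      have le0: "0 \<le> link_error n \<eta> A B a c" for A B a c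
        unfolding link_error_def using eta(1) by (intro add_nonneg_nonneg mult_nonneg_nonneg sum_nonneg) auto
      show "0 \<le> E w" for w unfolding E_def f1_def f2_def f3_def f4_def f5_def by (intro add_nonneg_nonneg le0) auto
      show "0 < \<gamma> / 2 * n" using gam n0 by simp
      fix w assume w: "w \<in> set_pmf J" "w \<in> S - S1 - S2"
      let ?b1 = "real (card (B1 (?A1 w)))" and ?b2 = "real (card (B2 (?A2 w)))"
      have bb: "?b1 \<le> \<beta> * n" "?b2 \<le> \<beta> * n" using w by (auto simp: S1_def S2_def)
      have nl: "\<not> linked n (?A1 w) (?A2 w) (?H w)" using w by (simp add: S_def)
      have main: "sqrt 3 / 2 * (p - \<beta>) * (real n - ?b1 - ?b2) - ?b1 - ?b2
          \<le> real n - card (?H w) + f1 w + f2 w + f3 w + f4 w"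
        using unlinked_bound[OF g1[OF w(1)] g2[OF w(1)] Hsub[OF w(1)] eta(1) n0 nl b1 b2 q]
        unfolding f1_def f2_def f3_def f4_def B1_def B2_def by simp
      have "(\<Sum>v<n. 1 * (of_bool (v \<in> ?H w) - p)) = real (card (?H w)) - n * p"
      proof -
        have "{..<n} \<inter> ?H w = ?H w" using Hsub[OF w(1)] by auto
        then show ?thesis by (simp only: sum_subtractf sum_of_bool_mem mult_1) simp
      qed
      then have H: "real (card (?H w)) \<ge> n * p - f5 w" unfolding f5_def by linarith
      define c where "c = sqrt 3 / 2 * (p - \<beta>)"
      have c: "0 \<le> c" "c \<le> 1" "c \<ge> sqrt 3 / 2 * p - \<beta>"
      proof -
        show "0 \<le> c" using pb s3 by (simp add: c_def)
        have "sqrt 3 / 2 * (p - \<beta>) \<le> 1 * 1" using pb p s3 beta by (intro mult_mono) auto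
        then show "c \<le> 1" by (simp add: c_def)
        have "sqrt 3 / 2 * \<beta> \<le> 1 * \<beta>" using s3 beta by (intro mult_right_mono) auto
        then show "c \<ge> sqrt 3 / 2 * p - \<beta>" by (simp add: c_def right_diff_distrib)
      qed
      have "c * (real n - 2 * \<beta> * n) - 2 * \<beta> * n \<le> c * (real n - ?b1 - ?b2) - ?b1 - ?b2"
        using bb c(1) mult_left_mono[OF _ c(1), of "real n - 2 * \<beta> * n" "real n - ?b1 - ?b2"] by linarith
      moreover have "c * (real n - 2 * \<beta> * n) - 2 * \<beta> * n \<ge> (sqrt 3 / 2 * p - 5 * \<beta>) * n"
      proof -
        have "c * \<beta> \<le> 1 * \<beta>" using c beta by (intro mult_right_mono) auto
        then have "sqrt 3 / 2 * p - 5 * \<beta> \<le> c - 2 * (c * \<beta>) - 2 * \<beta>" using c(3) by linarith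
        then have "(sqrt 3 / 2 * p - 5 * \<beta>) * n \<le> (c - 2 * (c * \<beta>) - 2 * \<beta>) * n"
          by (intro mult_right_mono) auto
        then show ?thesis by (simp add: algebra_simps)
      qed
      ultimately have "(sqrt 3 / 2 * p - 5 * \<beta>) * n \<le> real n - n * p + E w"
        using main H unfolding E_def c_def by linarith
      moreover have "(\<gamma> / 2) * n \<le> (\<gamma> - 5 * \<beta>) * n" using beta by (intro mult_right_mono) auto
      moreover have "(sqrt 3 / 2 * p - 5 * \<beta>) * n = (\<gamma> - 5 * \<beta>) * n + real n - n * p"
        by (simp add: \<gamma>_def algebra_simps)
      ultimately show "\<gamma> / 2 * n \<le> E w" by linarith
    qed
    also have "\<dots> \<le> 3 / 16" using EE gam n0 by (simp add: divide_le_eq mult_ac)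
    finally have pS: "measure_pmf.prob J (S - S1 - S2) \<le> 3 / 16" .
    have "measure_pmf.prob J S \<le> measure_pmf.prob J ((S - S1 - S2) \<union> (S1 \<union> S2))"
      by (intro measure_pmf.finite_measure_mono) auto
    also have "\<dots> \<le> measure_pmf.prob J (S - S1 - S2) + (measure_pmf.prob J S1 + measure_pmf.prob J S2)"
      by (intro order_trans[OF measure_Un_le] add_mono measure_Un_le) auto
    also have "\<dots> \<le> 1 / 4" using pS pS1 pS2 tau by linarith
    finally have "measure_pmf.prob J S \<le> 1 / 4" .
    moreover have "measure_pmf.prob J (- S) = 1 - measure_pmf.prob J S"
      using measure_pmf.prob_compl[of S J] by (simp add: Compl_eq_Diff_UNIV)
    moreover have "- S = {w. linked n (?A1 w) (?A2 w) (?H w)}" by (auto simp: S_def)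
    ultimately show "3 / 4 \<le> measure_pmf.prob J {w. linked n (?A1 w) (?A2 w) (?H w)}" by simp
  qed
qed

section \<open>The law of two adjacent layers\<close>

abbreviation ZK :: "nat \<Rightarrow> (int \<times> nat) graph" where
  "ZK n \<equiv> cart_prod Z_graph (K_graph n)"

definition layer_edges :: "nat \<Rightarrow> int \<Rightarrow> (int \<times> nat) set set" where
  "layer_edges n k = {{(k, u), (k, v)} | u v. u < n \<and> v < n \<and> u \<noteq> v}"

definition rung_edges :: "nat \<Rightarrow> int \<Rightarrow> (int \<times> nat) set set" where
  "rung_edges n k = {{(k, v), (k + 1, v)} | v. v < n}"

lemma edges_cart_prod: "edges (cart_prod G H) = {{(u1, u2), (v1, v2)} | u1 u2 v1 v2.
    (u1 = v1 \<and> u1 \<in> verts G \<and> {u2, v2} \<in> edges H) \<or> ({u1, v1} \<in> edges G \<and> u2 = v2 \<and> u2 \<in> verts H)}"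
  by (simp add: cart_prod_def edges_def)

lemma verts_K_graph: "verts (K_graph n) = {v. v < n}"
  by (auto simp: verts_def K_graph_def)

lemma verts_Z_graph: "verts Z_graph = UNIV"
  by (simp add: verts_def Z_graph_def)

lemma edges_ZK: "edges (ZK n) = (\<Union>k. layer_edges n k \<union> rung_edges n k)"
proof (intro equalityI subsetI)
  fix e assume "e \<in> edges (ZK n)"
  then obtain u1 u2 v1 v2 where e: "e = {(u1, u2), (v1, v2)}"
    and c: "(u1 = v1 \<and> {u2, v2} \<in> edges (K_graph n)) \<or> ({u1, v1} \<in> edges Z_graph \<and> u2 = v2 \<and> u2 < n)"
    unfolding edges_cart_prod verts_K_graph by blast
  from c show "e \<in> (\<Union>k. layer_edges n k \<union> rung_edges n k)"
  proof
    assume "u1 = v1 \<and> {u2, v2} \<in> edges (K_graph n)"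
    then have "e \<in> layer_edges n u1"
      unfolding e by (fastforce simp: K_graph_def edges_def layer_edges_def doubleton_eq_iff)
    then show ?thesis by blast
  next
    assume "{u1, v1} \<in> edges Z_graph \<and> u2 = v2 \<and> u2 < n"
    then have "e \<in> rung_edges n u1 \<or> e \<in> rung_edges n v1"
      unfolding e by (auto simp: Z_graph_def edges_def rung_edges_def doubleton_eq_iff)
    then show ?thesis by blast
  qed
next
  fix e assume "e \<in> (\<Union>k. layer_edges n k \<union> rung_edges n k)"
  then obtain k where "e \<in> layer_edges n k \<or> e \<in> rung_edges n k" by auto
  then show "e \<in> edges (ZK n)"
  proof
    assume "e \<in> layer_edges n k"
    then obtain u v where e: "e = {(k, u), (k, v)}" "u < n" "v < n" "u \<noteq> v" by (auto simp: layer_edges_def)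
    then have "{u, v} \<in> edges (K_graph n)" by (auto simp: K_graph_def edges_def)
    then show ?thesis unfolding e(1) edges_cart_prod verts_Z_graph by blast
  next
    assume "e \<in> rung_edges n k"
    then obtain v where e: "e = {(k, v), (k + 1, v)}" "v < n" by (auto simp: rung_edges_def)
    then have "{k, k + 1} \<in> edges Z_graph" "v \<in> verts (K_graph n)"
      by (auto simp: Z_graph_def K_graph_def edges_def verts_def)
    then show ?thesis unfolding e(1) edges_cart_prod by blast
  qed
qed

lemma layer_edges_subset: "layer_edges n k \<subseteq> edges (ZK n)" and rung_edges_subset: "rung_edges n k \<subseteq> edges (ZK n)"
  unfolding edges_ZK by auto

lemma layer_edge: "u < n \<Longrightarrow> v < n \<Longrightarrow> u \<noteq> v \<Longrightarrow> {(k, u), (k, v)} \<in> layer_edges n k"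
  by (auto simp: layer_edges_def)

lemma rung_edge: "v < n \<Longrightarrow> {(k, v), (k + 1, v)} \<in> rung_edges n k"
  by (auto simp: rung_edges_def)

lemma finite_layer_edges: "finite (layer_edges n k)"
proof (rule finite_subset)
  show "layer_edges n k \<subseteq> (\<lambda>(u, v). {(k, u), (k, v)}) ` ({..<n} \<times> {..<n})"
    by (auto simp: layer_edges_def)
qed auto

lemma finite_rung_edges: "finite (rung_edges n k)"
proof (rule finite_subset)
  show "rung_edges n k \<subseteq> (\<lambda>v. {(k, v), (k + 1, v)}) ` {..<n}"
    by (auto simp: rung_edges_def)
qed auto

lemma Union_layer_edges: "\<Union>(layer_edges n k) \<subseteq> {k} \<times> UNIV"
  by (auto simp: layer_edges_def)

lemma Union_rung_edges: "\<Union>(rung_edges n k) \<subseteq> {k, k + 1} \<times> UNIV"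
  by (auto simp: rung_edges_def)

section \<open>Events determined by finitely many edges\<close>

lemma edge_sigma_algebra: "sigma_algebra (Pow (edges H)) (edge_sigma H A)"
  unfolding edge_sigma_def by (rule sigma_algebra_sigma_sets) (auto simp: edge_event_def)

lemma edge_sigma_mono: "A \<subseteq> B \<Longrightarrow> edge_sigma H A \<subseteq> edge_sigma H B"
  unfolding edge_sigma_def by (rule sigma_sets_mono') auto

lemma edge_event_sigma: "e \<in> A \<Longrightarrow> edge_event H e \<in> edge_sigma H A"
  unfolding edge_sigma_def by (rule sigma_sets.Basic) auto

text \<open>Such an event is a finite union of events that prescribe the trace
  \<open>S \<inter> F\<close>. This settles the measurability of all connectivity events inside a
  slab.\<close>

lemma finite_event_sigma:
  assumes "finite F" "F \<subseteq> A"
  shows "{S \<in> Pow (edges H). Q (S \<inter> F)} \<in> edge_sigma H A"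
proof -
  interpret sigma_algebra "Pow (edges H)" "edge_sigma H A" by (rule edge_sigma_algebra)
  have ev: "{S \<in> Pow (edges H). e \<in> S} \<in> edge_sigma H A" if "e \<in> F" for e
    using edge_event_sigma[of e A H] that assms by (auto simp: edge_event_def)
  have "{S \<in> Pow (edges H). S \<inter> F = T} \<in> edge_sigma H A" if "T \<subseteq> F" for T
  proof -
    have eq: "{S \<in> Pow (edges H). S \<inter> F = T} = {S \<in> Pow (edges H). \<forall>e\<in>F. (e \<in> S \<longleftrightarrow> e \<in> T)}"
      using that by auto
    show ?thesis unfolding eq
    proof (intro sets_Collect_finite_All assms)
      fix e assume "e \<in> F"
      then show "{S \<in> Pow (edges H). (e \<in> S) = (e \<in> T)} \<in> edge_sigma H A"
        using ev[of e] sets_Collect_neg[OF ev[of e]] by (cases "e \<in> T") auto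
    qed
  qed
  then have "(\<Union>T\<in>{T\<in>Pow F. Q T}. {S \<in> Pow (edges H). S \<inter> F = T}) \<in> edge_sigma H A"
    using assms by (intro finite_UN) auto
  also have "(\<Union>T\<in>{T\<in>Pow F. Q T}. {S \<in> Pow (edges H). S \<inter> F = T}) = {S \<in> Pow (edges H). Q (S \<inter> F)}"
    by auto
  finally show ?thesis .
qed

definition layer_graph :: "nat \<Rightarrow> int \<Rightarrow> (int \<times> nat) set set \<Rightarrow> (nat \<times> nat) set" where
  "layer_graph n k S = {(u, v). u < n \<and> v < n \<and> u \<noteq> v \<and> {(k, u), (k, v)} \<in> S}"

definition rungs :: "nat \<Rightarrow> int \<Rightarrow> (int \<times> nat) set set \<Rightarrow> nat set" where
  "rungs n k S = {v. v < n \<and> {(k, v), (k + 1, v)} \<in> S}"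

lemma layer_graph_cong: "layer_graph n k (S \<inter> layer_edges n k) = layer_graph n k S"
  by (auto simp: layer_graph_def intro: layer_edge)

lemma layer_graph_on: "graph_on n (layer_graph n k S)"
  by (auto simp: graph_on_def layer_graph_def sym_def insert_commute)

definition slab_edges :: "nat \<Rightarrow> int \<Rightarrow> (int \<times> nat) set set" where
  "slab_edges n k = layer_edges n k \<union> layer_edges n (k + 1) \<union> rung_edges n k"

definition slab :: "nat \<Rightarrow> int \<Rightarrow> (int \<times> nat) set set \<Rightarrow> (nat \<times> nat) set \<times> (nat \<times> nat) set \<times> nat set" where
  "slab n k S = (layer_graph n k S, layer_graph n (k + 1) S, rungs n k S)"

lemma slab_cong: "slab n k (S \<inter> slab_edges n k) = slab n k S"
proof -
  have "layer_graph n k (S \<inter> slab_edges n k) = layer_graph n k S"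
    "layer_graph n (k + 1) (S \<inter> slab_edges n k) = layer_graph n (k + 1) S"
    "rungs n k (S \<inter> slab_edges n k) = rungs n k S"
    by (auto simp: layer_graph_def rungs_def slab_edges_def intro: layer_edge rung_edge)
  then show ?thesis by (simp add: slab_def)
qed

lemma finite_slab_edges: "finite (slab_edges n k)"
  by (simp add: slab_edges_def finite_layer_edges finite_rung_edges)

lemma slab_edges_subset: "slab_edges n k \<subseteq> edges (ZK n)"
  using layer_edges_subset rung_edges_subset by (simp add: slab_edges_def)

lemma Union_slab_edges: "\<Union>(slab_edges n k) \<subseteq> {k, k + 1} \<times> UNIV"
  using Union_layer_edges[of n k] Union_layer_edges[of n "k + 1"] Union_rung_edges[of n k]
  unfolding slab_edges_def by blast

lemma finite_range_slab: "finite (range (slab n k))"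
proof (rule finite_subset)
  show "range (slab n k) \<subseteq> Pow ({..<n} \<times> {..<n}) \<times> Pow ({..<n} \<times> {..<n}) \<times> Pow {..<n}"
    by (auto simp: slab_def layer_graph_def rungs_def)
qed auto

section \<open>Slabs under a 1-independent measure\<close>

locale ZK_model =
  fixes n :: nat and p :: real and \<mu> :: "(int \<times> nat) set set measure"
  assumes mu: "\<mu> \<in> M1p (ZK n) p"
begin

lemma prob_space_mu: "prob_space \<mu>"
  using mu by (simp add: M1p_def random_graph_model_def)

sublocale prob_space \<mu> by (rule prob_space_mu)

lemma space_mu: "space \<mu> = Pow (edges (ZK n))" and sets_mu: "sets \<mu> = edge_sigma (ZK n) (edges (ZK n))"
  using mu by (auto simp: M1p_def random_graph_model_def)

lemma edge_prob: "e \<in> edges (ZK n) \<Longrightarrow> prob {S \<in> space \<mu>. e \<in> S} = p"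
  using mu by (auto simp: M1p_def edge_event_def space_mu)

lemma sigma_sets_mu: "A \<subseteq> edges (ZK n) \<Longrightarrow> X \<in> edge_sigma (ZK n) A \<Longrightarrow> X \<in> sets \<mu>"
  unfolding sets_mu using edge_sigma_mono by blast

lemma independent:
  assumes "A \<subseteq> edges (ZK n)" "B \<subseteq> edges (ZK n)" "\<Union>A \<inter> \<Union>B = {}"
    and "X \<in> edge_sigma (ZK n) A" "Y \<in> edge_sigma (ZK n) B"
  shows "prob (X \<inter> Y) = prob X * prob Y"
proof -
  have "indep_set (edge_sigma (ZK n) A) (edge_sigma (ZK n) B)"
    using mu assms(1-3) by (auto simp: M1p_def one_independent_def)
  then show ?thesis using assms(4,5) by (rule indep_setD)
qed

lemma two_edges_prob:
  assumes "e \<in> edges (ZK n)" "f \<in> edges (ZK n)" "e \<inter> f = {}"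
  shows "prob {S \<in> space \<mu>. e \<in> S \<and> f \<in> S} = p\<^sup>2"
proof -
  have "prob (edge_event (ZK n) e \<inter> edge_event (ZK n) f) = prob (edge_event (ZK n) e) * prob (edge_event (ZK n) f)"
    by (rule independent[of "{e}" "{f}"]) (use assms in \<open>auto intro: edge_event_sigma\<close>)
  moreover have "edge_event (ZK n) e \<inter> edge_event (ZK n) f = {S \<in> space \<mu>. e \<in> S \<and> f \<in> S}"
    "edge_event (ZK n) e = {S \<in> space \<mu>. e \<in> S}" "edge_event (ZK n) f = {S \<in> space \<mu>. f \<in> S}"
    by (auto simp: edge_event_def space_mu)
  ultimately show ?thesis using edge_prob assms by (simp add: power2_eq_square)
qed

lemma slab_event:
  "{S \<in> space \<mu>. Q (slab n k S)} \<in> edge_sigma (ZK n) (slab_edges n k)"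
  using finite_event_sigma[OF finite_slab_edges[of n k] order_refl, of "ZK n" "\<lambda>S. Q (slab n k S)"]
  by (simp add: slab_cong space_mu)

lemma slab_measurable: "slab n k \<in> measurable \<mu> (count_space UNIV)"
proof (rule measurableI)
  show "slab n k -` Q \<inter> space \<mu> \<in> sets \<mu>" for Q
    using sigma_sets_mu[OF slab_edges_subset slab_event[of "\<lambda>w. w \<in> Q" k]]
    by (simp add: vimage_def Int_def conj_commute)
qed simp

definition slab_pmf :: "int \<Rightarrow> ((nat \<times> nat) set \<times> (nat \<times> nat) set \<times> nat set) pmf" where
  "slab_pmf k = Abs_pmf (distr \<mu> (count_space UNIV) (slab n k))"

text \<open>A slab takes finitely many values, so those of probability 0 form a null set and the
  image measure is discrete.\<close>

lemma measure_slab_pmf_distr: "measure_pmf (slab_pmf k) = distr \<mu> (count_space UNIV) (slab n k)"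
  unfolding slab_pmf_def
proof (rule Abs_pmf_inverse, intro CollectI conjI)
  note [measurable] = slab_measurable
  show "prob_space (distr \<mu> (count_space UNIV) (slab n k))"
    by (rule prob_space_distr) measurable
  have md: "measure (distr \<mu> (count_space UNIV) (slab n k)) {x} = prob (slab n k -` {x} \<inter> space \<mu>)" for x
    by (rule measure_distr) auto
  have "AE S in \<mu>. \<forall>x\<in>range (slab n k). slab n k S = x \<longrightarrow> prob (slab n k -` {x} \<inter> space \<mu>) \<noteq> 0"
  proof (rule AE_finite_allI[OF finite_range_slab])
    fix x
    have ev: "slab n k -` {x} \<inter> space \<mu> \<in> events" by measurable
    show "AE S in \<mu>. slab n k S = x \<longrightarrow> prob (slab n k -` {x} \<inter> space \<mu>) \<noteq> 0"
    proof (cases "prob (slab n k -` {x} \<inter> space \<mu>) = 0")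
      case True
      then have "AE S in \<mu>. S \<notin> slab n k -` {x} \<inter> space \<mu>" using prob_eq_0[OF ev] by simp
      then show ?thesis by (rule AE_mp) (auto intro!: AE_I2)
    qed auto
  qed
  then show "AE x in distr \<mu> (count_space UNIV) (slab n k). measure (distr \<mu> (count_space UNIV) (slab n k)) {x} \<noteq> 0"
    unfolding md by (subst AE_distr_iff) (auto simp: slab_measurable)
qed simp

lemma measure_slab_pmf: "measure_pmf.prob (slab_pmf k) Q = prob {S \<in> space \<mu>. slab n k S \<in> Q}"
  unfolding measure_slab_pmf_distr
  by (subst measure_distr) (auto simp: slab_measurable intro!: arg_cong[where f = prob])

lemma set_slab_pmf: "set_pmf (slab_pmf k) \<subseteq> range (slab n k)"
proof
  fix w assume "w \<in> set_pmf (slab_pmf k)"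
  then have "prob {S \<in> space \<mu>. slab n k S \<in> {w}} \<noteq> 0"
    unfolding measure_slab_pmf[symmetric] by (simp add: set_pmf_iff measure_pmf_single)
  then have "{S \<in> space \<mu>. slab n k S \<in> {w}} \<noteq> {}" by (metis measure_empty)
  then show "w \<in> range (slab n k)" by auto
qed

lemma layer_law_pmf:
  assumes "set_pmf P \<subseteq> range (layer_graph n k)"
    and prob: "\<And>Q. measure_pmf.prob P Q = prob {S \<in> space \<mu>. layer_graph n k S \<in> Q}"
  shows "layer_law n p P"
  unfolding layer_law_def
proof (intro conjI ballI allI impI)
  show "graph_on n A" if "A \<in> set_pmf P" for A using that assms(1) layer_graph_on by auto
  show "measure_pmf.prob P {A. (u, v) \<in> A} = p" if "u < n" "v < n" "u \<noteq> v" for u v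
    using edge_prob[of "{(k, u), (k, v)}"] layer_edges_subset layer_edge[OF that] that
    unfolding prob by (auto simp: layer_graph_def)
  show "measure_pmf.prob P {A. (u, v) \<in> A \<and> (u', v') \<in> A} = p\<^sup>2"
    if "u < n" "v < n" "u' < n" "v' < n" "u \<noteq> v" "u' \<noteq> v'" "{u, v} \<inter> {u', v'} = {}" for u v u' v'
    using two_edges_prob[of "{(k, u), (k, v)}" "{(k, u'), (k, v')}"] layer_edges_subset
      layer_edge[of u n v k] layer_edge[of u' n v' k] that
    unfolding prob by (auto simp: layer_graph_def)
qed

lemma two_layer_law_slab: "two_layer_law n p (slab_pmf k)"
proof -
  let ?J = "slab_pmf k"
  have m1: "measure_pmf.prob (map_pmf fst ?J) Q = prob {S \<in> space \<mu>. layer_graph n k S \<in> Q}" for Q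
    unfolding measure_map_pmf measure_slab_pmf by (simp add: slab_def)
  have m2: "measure_pmf.prob (map_pmf (fst \<circ> snd) ?J) Q = prob {S \<in> space \<mu>. layer_graph n (k + 1) S \<in> Q}" for Q
    unfolding measure_map_pmf measure_slab_pmf by (simp add: slab_def)
  have L1: "layer_law n p (map_pmf fst ?J)"
    by (rule layer_law_pmf[OF _ m1]) (use set_slab_pmf[of k] in \<open>force simp: slab_def\<close>)
  have L2: "layer_law n p (map_pmf (fst \<circ> snd) ?J)"
    by (rule layer_law_pmf[OF _ m2]) (use set_slab_pmf[of k] in \<open>force simp: slab_def\<close>)
  have "map_pmf (\<lambda>w. (fst w, fst (snd w))) ?J = pair_pmf (map_pmf fst ?J) (map_pmf (fst \<circ> snd) ?J)"
  proof (rule pmf_eqI)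
    fix ab :: "(nat \<times> nat) set \<times> (nat \<times> nat) set"
    obtain a b where ab: "ab = (a, b)" by (cases ab)
    have ev: "{S \<in> space \<mu>. layer_graph n j S \<in> Q} \<in> edge_sigma (ZK n) (layer_edges n j)" for j Q
      using finite_event_sigma[OF finite_layer_edges[of n j] order_refl, of "ZK n" "\<lambda>S. layer_graph n j S \<in> Q"]
      by (simp add: layer_graph_cong space_mu)
    have "pmf (map_pmf (\<lambda>w. (fst w, fst (snd w))) ?J) ab
       = prob ({S \<in> space \<mu>. layer_graph n k S \<in> {a}} \<inter> {S \<in> space \<mu>. layer_graph n (k + 1) S \<in> {b}})"
      unfolding measure_pmf_single[symmetric] measure_map_pmf measure_slab_pmf ab
      by (auto simp: slab_def intro!: arg_cong[where f = prob])
    \<comment> \<open>Distinct layers span disjoint vertex sets, so 1-independence applies.\<close>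
    also have "\<dots> = prob {S \<in> space \<mu>. layer_graph n k S \<in> {a}} * prob {S \<in> space \<mu>. layer_graph n (k + 1) S \<in> {b}}"
      by (rule independent[OF layer_edges_subset layer_edges_subset _ ev ev])
        (use Union_layer_edges[of n k] Union_layer_edges[of n "k + 1"] in fastforce)
    also have "\<dots> = pmf (pair_pmf (map_pmf fst ?J) (map_pmf (fst \<circ> snd) ?J)) ab"
      unfolding ab pmf_pair m1[symmetric] m2[symmetric] measure_pmf_single ..
    finally show "pmf (map_pmf (\<lambda>w. (fst w, fst (snd w))) ?J) ab
       = pmf (pair_pmf (map_pmf fst ?J) (map_pmf (fst \<circ> snd) ?J)) ab" .
  qed
  moreover have "snd (snd w) \<subseteq> {..<n}" if "w \<in> set_pmf ?J" for w
    using set_slab_pmf[of k] that by (auto simp: slab_def rungs_def)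
  moreover have "measure_pmf.prob ?J {w. v \<in> snd (snd w)} = p" if "v < n" for v
    using edge_prob[of "{(k, v), (k + 1, v)}"] rung_edges_subset rung_edge[OF that] that
    unfolding measure_slab_pmf by (auto simp: slab_def rungs_def)
  moreover have "measure_pmf.prob ?J {w. u \<in> snd (snd w) \<and> v \<in> snd (snd w)} = p\<^sup>2"
    if "u < n" "v < n" "u \<noteq> v" for u v
    using two_edges_prob[of "{(k, u), (k + 1, u)}" "{(k, v), (k + 1, v)}"] rung_edges_subset
      rung_edge[of u n k] rung_edge[of v n k] that
    unfolding measure_slab_pmf by (auto simp: slab_def rungs_def)
  ultimately show ?thesis using L1 L2 by (simp add: two_layer_law_def)
qed

definition link_event :: "int \<Rightarrow> (int \<times> nat) set set set" where
  "link_event k = {S \<in> space \<mu>. linked n (layer_graph n k S) (layer_graph n (k + 1) S) (rungs n k S)}"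

lemma link_event_sigma: "link_event k \<in> edge_sigma (ZK n) (slab_edges n k)"
  using slab_event[of "\<lambda>w. linked n (fst w) (fst (snd w)) (snd (snd w))" k]
  by (simp add: link_event_def slab_def)

lemma link_event_prob:
  "prob (link_event k) = measure_pmf.prob (slab_pmf k) {w. linked n (fst w) (fst (snd w)) (snd (snd w))}"
  unfolding measure_slab_pmf by (simp add: link_event_def slab_def)

end

section \<open>Long paths above the threshold\<close>

text \<open>Each further event at most halves the probability. As \<open>L (Suc m)\<close> is
  independent of \<open>C m\<close>, adding it to \<open>C (Suc m)\<close> loses at most
  \<open>prob (C m) / 4\<close>, and by the induction hypothesis this is at most
  \<open>prob (C (Suc m)) / 2\<close>. The value 3/4 makes the factor 1/2 reproduce itself.\<close>

lemma (in prob_space) one_dependent_chain: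
  fixes L :: "nat \<Rightarrow> 'a set"
  assumes ev: "\<And>j. L j \<in> events" and pr: "\<And>j. prob (L j) \<ge> 3 / 4"
    and ind: "\<And>m. prob ((space M \<inter> (\<Inter>j<m. L j)) \<inter> L (Suc m)) = prob (space M \<inter> (\<Inter>j<m. L j)) * prob (L (Suc m))"
  shows "prob (space M \<inter> (\<Inter>j<m. L j)) > 0"
proof -
  define C where "C m = space M \<inter> (\<Inter>j<m. L j)" for m
  have evC: "C m \<in> events" for m
    unfolding C_def by (induction m) (auto simp: lessThan_Suc ev Int_assoc[symmetric] Int_commute[of "L _"])
  have CS: "C (Suc m) = C m \<inter> L m" for m by (auto simp: C_def lessThan_Suc)
  have "prob (C m) > 0 \<and> prob (C m) \<le> 2 * prob (C (Suc m))" for m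
  proof (induction m)
    case 0
    have "C 0 = space M" "C (Suc 0) = L 0" using sets.sets_into_space[OF ev] by (auto simp: C_def)
    then show ?case using pr[of 0] prob_space by simp
  next
    case (Suc m)
    have "C (Suc m) \<subseteq> (C (Suc m) \<inter> L (Suc m)) \<union> (C m - C m \<inter> L (Suc m))"
      by (auto simp: CS)
    then have "prob (C (Suc m)) \<le> prob ((C (Suc m) \<inter> L (Suc m)) \<union> (C m - C m \<inter> L (Suc m)))"
      by (intro finite_measure_mono) (auto intro: evC ev)
    also have "\<dots> \<le> prob (C (Suc m) \<inter> L (Suc m)) + prob (C m - C m \<inter> L (Suc m))"
      by (intro measure_Un_le) (auto intro: evC ev)
    finally have 1: "prob (C (Suc m)) \<le> prob (C (Suc m) \<inter> L (Suc m)) + prob (C m - C m \<inter> L (Suc m))" .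
    have 2: "prob (C m - C m \<inter> L (Suc m)) = prob (C m) - prob (C m) * prob (L (Suc m))"
      using ind[of m] by (subst finite_measure_Diff) (auto simp: C_def[symmetric] intro: evC ev)
    have 3: "prob (C m) * (3 / 4) \<le> prob (C m) * prob (L (Suc m))"
      by (intro mult_left_mono pr) simp
    show ?case using Suc 1 2 3 unfolding CS[of "Suc m"] by linarith
  qed
  then show ?thesis by (simp add: C_def)
qed

definition adjacent :: "'v set set \<Rightarrow> ('v \<times> 'v) set" where
  "adjacent S = {(a, b). {a, b} \<in> S}"

lemma ladder_connected:
  assumes "((b, u), (b', v)) \<in> (ladder (layer_graph n k S) (layer_graph n (k + 1) S) (rungs n k S))\<^sup>*"
  shows "((k + of_bool b, u), (k + of_bool b', v)) \<in> (adjacent S)\<^sup>*"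
proof -
  have "((k + of_bool (fst x), snd x), (k + of_bool (fst y), snd y)) \<in> (adjacent S)\<^sup>*"
    if "(x, y) \<in> (ladder (layer_graph n k S) (layer_graph n (k + 1) S) (rungs n k S))\<^sup>*" for x y
    using that
  proof (induction rule: rtrancl_induct)
    case (step y z)
    then have "((k + of_bool (fst y), snd y), (k + of_bool (fst z), snd z)) \<in> adjacent S"
      by (auto simp: ladder_def layer_graph_def rungs_def adjacent_def insert_commute)
    with step show ?case by (meson rtrancl_into_rtrancl)
  qed simp
  from this[OF assms] show ?thesis by simp
qed

lemma reach_connected:
  assumes "v \<in> reach (layer_graph n k S) u"
  shows "((k, u), (k, v)) \<in> (adjacent S)\<^sup>*"
  using ladder_connected[OF ladder_reach(1)[OF assms]] by simp

text \<open>A link ends in the giant of the layer where the next one starts. The giant is unique by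
  \<open>giant_reach\<close>, so consecutive links can be joined inside it.\<close>

lemma linked_chain_connected:
  assumes "\<And>j. j \<le> m \<Longrightarrow> linked n (layer_graph n (int j) S) (layer_graph n (int j + 1) S) (rungs n (int j) S)"
  shows "\<exists>u v. giant n (layer_graph n (int m + 1) S) v = 1 \<and> ((0, u), (int m + 1, v)) \<in> (adjacent S)\<^sup>*"
  using assms
proof (induction m)
  case 0
  then show ?case using ladder_connected[of False _ True _ n 0 S] by (fastforce simp: linked_def)
next
  case (Suc m)
  then obtain u v where v: "giant n (layer_graph n (int m + 1) S) v = 1" "((0, u), (int m + 1, v)) \<in> (adjacent S)\<^sup>*"
    by (meson le_SucI)
  obtain v' w where w: "giant n (layer_graph n (int (Suc m)) S) v' = 1" "giant n (layer_graph n (int (Suc m) + 1) S) w = 1"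
    "((False, v'), (True, w)) \<in> (ladder (layer_graph n (int (Suc m)) S) (layer_graph n (int (Suc m) + 1) S) (rungs n (int (Suc m)) S))\<^sup>*"
    using Suc.prems[of "Suc m"] by (auto simp: linked_def)
  have e: "int (Suc m) = int m + 1" by simp
  have "((int m + 1, v), (int m + 1, v')) \<in> (adjacent S)\<^sup>*"
    using giant_reach[OF layer_graph_on v(1)] w(1) unfolding e by (intro reach_connected) blast
  moreover have "((int m + 1, v'), (int (Suc m) + 1, w)) \<in> (adjacent S)\<^sup>*"
    using ladder_connected[OF w(3)] by (simp add: ac_simps)
  ultimately show ?case using v(2) w(2) by (meson rtrancl_trans)
qed

lemma ZK_edge_step:
  assumes "{a, b} \<in> edges (ZK n)"
  shows "\<bar>fst a - fst b\<bar> \<le> 1"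
  using assms unfolding edges_ZK by (auto simp: layer_edges_def rung_edges_def doubleton_eq_iff)

text \<open>An edge changes the layer by at most 1, so a simple path from layer 0 to layer
  \<open>l\<close> has at least \<open>l\<close> edges; its initial segment is the required
  path.\<close>

lemma path_from_connected:
  assumes S: "S \<subseteq> edges (ZK n)" and c: "((0, u), (int l, v)) \<in> (adjacent S)\<^sup>*"
  shows "\<exists>vs. length vs = l + 1 \<and> distinct vs \<and> (\<forall>i<l. {vs ! i, vs ! (i + 1)} \<in> S)"
proof -
  define r where "r a b \<longleftrightarrow> (a, b) \<in> adjacent S" for a b
  have "r\<^sup>*\<^sup>* (0, u) (int l, v)" using c by (simp add: r_def[abs_def] rtranclp_rtrancl_eq)
  then obtain xs where "rtrancl_path r (0, u) xs (int l, v)" by (auto simp: rtranclp_eq_rtrancl_path)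
  then obtain ys where ys: "rtrancl_path r (0, u) ys (int l, v)" "distinct ((0, u) # ys)"
    by (rule rtrancl_path_distinct) blast
  let ?ws = "(0, u) # ys"
  have step: "{?ws ! i, ?ws ! (i + 1)} \<in> S" if "i < length ys" for i
    using rtrancl_path_nth[OF ys(1) that] by (simp add: r_def adjacent_def)
  have bound: "fst (?ws ! i) \<le> int i" if "i \<le> length ys" for i
    using that
  proof (induction i)
    case (Suc i)
    have "{?ws ! i, ?ws ! (i + 1)} \<in> edges (ZK n)" using step[of i] Suc.prems S by auto
    then show ?case using ZK_edge_step[of "?ws ! i" "?ws ! (i + 1)" n] Suc by simp
  qed simp
  have "?ws ! length ys = last ?ws" using last_conv_nth[of ?ws] by simp
  also have "last ?ws = (int l, v)"
  proof (cases "ys = []")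
    case True
    with ys(1) have "(0, u) = (int l, v)" by (auto elim: rtrancl_path.cases)
    then show ?thesis using True by simp
  qed (use rtrancl_path_last[OF ys(1)] in simp)
  finally have "l \<le> length ys" using bound[of "length ys"] by simp
  moreover define ws where "ws = ?ws"
  moreover have "length ws = Suc (length ys)" by (simp add: ws_def)
  ultimately have "length (take (l + 1) ws) = l + 1" "distinct (take (l + 1) ws)"
    "\<forall>i<l. {take (l + 1) ws ! i, take (l + 1) ws ! (i + 1)} \<in> S"
    using step ys(2) by (auto simp flip: ws_def)
  then show ?thesis by blast
qed

context ZK_model
begin

lemma path_event_measurable: "path_event (ZK n) l \<in> events"
proof -
  have ev: "{S \<in> space \<mu>. e \<in> S} \<in> events" for e
  proof (cases "e \<in> edges (ZK n)")
    case True
    then show ?thesis using sigma_sets_mu[OF order_refl edge_event_sigma[OF True]]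
      by (simp add: edge_event_def space_mu)
  next
    case False
    then have eq: "{S \<in> space \<mu>. e \<in> S} = {}" by (auto simp: space_mu)
    show ?thesis unfolding eq by simp
  qed
  have "{S \<in> space \<mu>. \<exists>vs. length vs = l + 1 \<and> distinct vs \<and> (\<forall>i\<in>{..<l}. {vs ! i, vs ! (i + 1)} \<in> S)} \<in> events"
    by (intro sets.sets_Collect_countable_Ex sets.sets_Collect_conj sets.sets_Collect_finite_All ev sets.sets_Collect_const) auto
  then show ?thesis by (simp add: path_event_def space_mu Ball_def)
qed

lemma path_event_positive:
  assumes "\<And>k. prob (link_event k) \<ge> 3 / 4"
  shows "prob (path_event (ZK n) l) > 0"
proof -
  define L where "L j = link_event (int j)" for j
  have evL: "L j \<in> events" for j
    unfolding L_def by (rule sigma_sets_mu[OF slab_edges_subset link_event_sigma])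
  \<comment> \<open>The slabs before \<open>m\<close> occupy layers up to \<open>m\<close>, and slab
    \<open>Suc m\<close> begins in layer \<open>m + 1\<close>. Leaving out slab \<open>m\<close>
    thus separates the vertex sets.\<close>
  have ind: "prob ((space \<mu> \<inter> (\<Inter>j<m. L j)) \<inter> L (Suc m)) = prob (space \<mu> \<inter> (\<Inter>j<m. L j)) * prob (L (Suc m))" for m
  proof (rule independent)
    let ?A = "\<Union>j<m. slab_edges n (int j)"
    interpret sA: sigma_algebra "Pow (edges (ZK n))" "edge_sigma (ZK n) ?A" by (rule edge_sigma_algebra)
    show "?A \<subseteq> edges (ZK n)" "slab_edges n (int (Suc m)) \<subseteq> edges (ZK n)" using slab_edges_subset by auto
    show "\<Union>?A \<inter> \<Union>(slab_edges n (int (Suc m))) = {}"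
    proof -
      have "\<Union>?A \<subseteq> {.. int m} \<times> UNIV"
      proof
        fix a assume "a \<in> \<Union>?A"
        then obtain j where "j < m" "a \<in> \<Union>(slab_edges n (int j))" by auto
        then show "a \<in> {.. int m} \<times> UNIV" using Union_slab_edges[of n "int j"] by auto
      qed
      then show ?thesis using Union_slab_edges[of n "int (Suc m)"] by fastforce
    qed
    show "L (Suc m) \<in> edge_sigma (ZK n) (slab_edges n (int (Suc m)))" unfolding L_def by (rule link_event_sigma)
    have Lj: "L j \<in> edge_sigma (ZK n) ?A" if "j < m" for j
      using link_event_sigma[of "int j"] edge_sigma_mono[of "slab_edges n (int j)" ?A "ZK n"] that
      unfolding L_def by blast
    show "space \<mu> \<inter> (\<Inter>j<m. L j) \<in> edge_sigma (ZK n) ?A"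
    proof (cases "m = 0")
      case True then show ?thesis using sA.top by (simp add: space_mu)
    next
      case False
      then have "(\<Inter>j<m. L j) \<in> edge_sigma (ZK n) ?A" using Lj by (intro sA.finite_INT) auto
      then show ?thesis using sA.top by (simp add: space_mu sA.Int)
    qed
  qed
  have "0 < prob (space \<mu> \<inter> (\<Inter>j<Suc l. L j))"
    by (rule one_dependent_chain[OF evL _ ind]) (unfold L_def, rule assms)
  also have "\<dots> \<le> prob (path_event (ZK n) l)"
  proof (rule finite_measure_mono[OF _ path_event_measurable])
    show "space \<mu> \<inter> (\<Inter>j<Suc l. L j) \<subseteq> path_event (ZK n) l"
    proof
      fix S assume S: "S \<in> space \<mu> \<inter> (\<Inter>j<Suc l. L j)"
      then have sub: "S \<subseteq> edges (ZK n)" by (simp add: space_mu)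
      have link: "linked n (layer_graph n (int j) S) (layer_graph n (int j + 1) S) (rungs n (int j) S)" if "j \<le> l" for j
        using S that by (auto simp: L_def link_event_def less_Suc_eq_le)
      have "\<exists>u v. ((0, u), (int l, v)) \<in> (adjacent S)\<^sup>*"
      proof (cases l)
        case 0 then show ?thesis by auto
      next
        case (Suc m)
        then show ?thesis using linked_chain_connected[of m n S] link by (fastforce simp: add.commute)
      qed
      then show "S \<in> path_event (ZK n) l"
        using path_from_connected[OF sub] sub by (fastforce simp: path_event_def)
    qed
  qed
  finally show ?thesis .
qed

end

definition long_path_parameters :: "nat \<Rightarrow> real set" where
  "long_path_parameters n = {p \<in> {0..1}. \<forall>\<mu> \<in> M1p (ZK n) p. \<forall>l::nat. measure \<mu> (path_event (ZK n) l) > 0}"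

lemma long_path_parameter_upper:
  assumes p: "4 - 2 * sqrt 3 < p" "p \<le> 1"
  shows "\<exists>N. \<forall>n\<ge>N. p \<in> long_path_parameters n"
proof -
  obtain N where N: "\<And>n J. n \<ge> N \<Longrightarrow> two_layer_law n p J \<Longrightarrow>
     measure_pmf.prob J {w. linked n (fst w) (fst (snd w)) (snd (snd w))} \<ge> 3 / 4"
    using two_layer_linked[OF p] by blast
  have "sqrt 3 \<le> (2::real)" by (rule real_le_lsqrt) auto
  then have p0: "0 \<le> p" using p by simp
  have "measure \<mu> (path_event (ZK n) l) > 0" if n: "n \<ge> N" and mu: "\<mu> \<in> M1p (ZK n) p" for n \<mu> l
  proof -
    interpret ZK_model n p \<mu> by unfold_locales (rule mu)
    show ?thesis by (rule path_event_positive) (unfold link_event_prob, rule N[OF n two_layer_law_slab])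
  qed
  then show ?thesis using p p0 by (auto simp: long_path_parameters_def)
qed

section \<open>A measure with bounded components\<close>

definition bern :: "real \<Rightarrow> bool \<Rightarrow> real" where
  "bern t b = (if b then t else 1 - t)"

text \<open>Block colouring: layers \<open>4 * m\<close> are entirely coloured \<open>m\<close>, and between them every vertex
  picks the colour of one of the two neighbouring blocks or, in odd layers, possibly none.
  Vertices without colour are joined only to layers congruent to 2 modulo 4, so they are
  leaves, and all other edges join vertices of equal colour.\<close>

definition colour :: "int \<Rightarrow> bool \<Rightarrow> int option" where
  "colour k t = (if k mod 4 = 0 then Some (k div 4)
     else if k mod 4 = 1 then (if t then Some (k div 4) else None)
     else if k mod 4 = 2 then Some (if t then k div 4 else k div 4 + 1)
     else (if t then Some (k div 4 + 1) else None))"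

definition compat :: "int \<Rightarrow> bool \<Rightarrow> int \<Rightarrow> bool \<Rightarrow> bool" where
  "compat k t l u \<longleftrightarrow> (\<exists>c. colour k t = Some c \<and> colour l u = Some c)
     \<or> (colour k t = None \<and> l mod 4 = 2) \<or> (colour l u = None \<and> k mod 4 = 2)"

text \<open>With \<open>s\<close> for odd layers and \<open>t\<close> for layers congruent to 2,
  these values make three kinds of edges equally likely: \<open>s\<^sup>2\<close> inside odd layers,
  \<open>t\<^sup>2 + (1 - t)\<^sup>2\<close> inside layers congruent to 2, and
  \<open>(1 - t) * s + (1 - s)\<close> for rungs from residue 2 to 3. All three equal
  \<open>4 - 2 * sqrt 3\<close>.\<close>

definition colour_prob :: "int \<Rightarrow> real" where
  "colour_prob k = (if k mod 4 = 0 then 1 else if k mod 4 = 2 then (3 - sqrt 3) / 2 else sqrt 3 - 1)"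

text \<open>Expressed by the set of residues of the two ends, hence well defined for an unordered
  edge. The value \<open>sqrt 3 - 1\<close> belongs to the rungs with residues 0 and 1, 1 and 2, or
  3 and 0.\<close>

definition compat_prob :: "(int \<times> nat) set \<Rightarrow> real" where
  "compat_prob e = (let R = (\<lambda>x. fst x mod 4) ` e in
     if R = {0} then 1 else if R \<in> {{1}, {2}, {3}, {2, 3}} then 4 - 2 * sqrt 3 else sqrt 3 - 1)"

lemma compat_sym: "compat k t l u \<longleftrightarrow> compat l u k t"
  by (auto simp: compat_def)

lemma mod4_cases: "(k::int) mod 4 = 0 \<or> k mod 4 = 1 \<or> k mod 4 = 2 \<or> k mod 4 = 3"
  by presburger

lemma compat_prob_layer:
  "(\<Sum>t\<in>UNIV. \<Sum>u\<in>UNIV. of_bool (compat k t k u) * (bern (colour_prob k) t * bern (colour_prob k) u))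
     = compat_prob {(k, v), (k, w)}"
  using mod4_cases[of k]
  by (elim disjE)
    (simp_all add: UNIV_bool compat_def colour_def bern_def colour_prob_def compat_prob_def Let_def field_simps)

lemma compat_prob_rung:
  "(\<Sum>t\<in>UNIV. \<Sum>u\<in>UNIV. of_bool (compat k t (k + 1) u) * (bern (colour_prob k) t * bern (colour_prob (k + 1)) u))
     = compat_prob {(k, v), (k + 1, v)}"
proof -
  have succ: "(k mod 4 = 0 \<and> (k + 1) mod 4 = 1 \<and> (k + 1) div 4 = k div 4)
    \<or> (k mod 4 = 1 \<and> (k + 1) mod 4 = 2 \<and> (k + 1) div 4 = k div 4)
    \<or> (k mod 4 = 2 \<and> (k + 1) mod 4 = 3 \<and> (k + 1) div 4 = k div 4)
    \<or> (k mod 4 = 3 \<and> (k + 1) mod 4 = 0 \<and> (k + 1) div 4 = k div 4 + 1)"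
    by presburger
  define l where "l = k + 1"
  show ?thesis using succ unfolding l_def[symmetric]
    by (elim disjE conjE)
      (simp_all add: UNIV_bool compat_def colour_def bern_def colour_prob_def compat_prob_def Let_def
        doubleton_eq_iff field_simps)
qed

lemma sqrt3_bounds: "1.7 < sqrt (3::real)" "sqrt (3::real) < 1.75"
  by (rule real_less_rsqrt real_less_lsqrt; simp add: power2_eq_square)+

lemma compat_prob_ge: "4 - 2 * sqrt 3 \<le> compat_prob e"
  using sqrt3_bounds by (auto simp: compat_prob_def Let_def)

lemma colour_prob_bounds: "0 \<le> colour_prob k" "colour_prob k \<le> 1"
  using sqrt3_bounds by (auto simp: colour_prob_def)

section \<open>Independent coins and the thinned block graph\<close>

locale block_model =
  fixes n :: nat and p :: real
  assumes p: "0 \<le> p" "p \<le> 4 - 2 * sqrt 3"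
begin

text \<open>The coordinate of a singleton decides the colour of that vertex, the coordinate of an edge
  is used to thin the edge down to probability \<open>p\<close>.\<close>

definition \<theta> :: "(int \<times> nat) set \<Rightarrow> real" where
  "\<theta> i = (if is_singleton i then colour_prob (fst (the_elem i)) else p / compat_prob i)"

lemma theta_bounds: "0 \<le> \<theta> i" "\<theta> i \<le> 1"
proof -
  have "compat_prob i > 0" "p \<le> compat_prob i"
    using compat_prob_ge[of i] sqrt3_bounds p by auto
  then show "0 \<le> \<theta> i" "\<theta> i \<le> 1"
    using p colour_prob_bounds by (auto simp: \<theta>_def)
qed

definition coins :: "((int \<times> nat) set \<Rightarrow> bool) measure" where
  "coins = PiM UNIV (\<lambda>i. measure_pmf (bernoulli_pmf (\<theta> i)))"

sublocale P: product_prob_space "\<lambda>i. measure_pmf (bernoulli_pmf (\<theta> i))" UNIV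
  by unfold_locales

lemma prob_space_coins: "prob_space coins"
  unfolding coins_def by (rule P.prob_space_axioms)

sublocale coins: prob_space coins by (rule prob_space_coins)

lemma space_coins: "space coins = UNIV"
  by (simp add: coins_def space_PiM)

lemma coin_measurable: "(\<lambda>\<omega>. \<omega> i) \<in> measurable coins (count_space UNIV)"
proof -
  have "(\<lambda>\<omega>. \<omega> i) \<in> measurable coins (measure_pmf (bernoulli_pmf (\<theta> i)))"
    unfolding coins_def by (rule measurable_component_singleton) simp
  then show ?thesis by (simp cong: measurable_cong_sets)
qed

lemma coins_finite:
  assumes "finite J"
  shows "coins.prob {\<omega>. \<forall>i\<in>J. \<omega> i = x i} = (\<Prod>i\<in>J. bern (\<theta> i) (x i))"
proof -
  have "emeasure coins {\<omega>\<in>space coins. \<forall>i\<in>J. \<omega> i \<in> {x i}} = (\<Prod>i\<in>J. emeasure (measure_pmf (bernoulli_pmf (\<theta> i))) {x i})"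
    unfolding coins_def by (rule P.emeasure_PiM_Collect) (use assms in auto)
  also have "\<dots> = (\<Prod>i\<in>J. ennreal (bern (\<theta> i) (x i)))"
    by (intro prod.cong refl) (simp add: emeasure_pmf_single bern_def theta_bounds)
  also have "\<dots> = ennreal (\<Prod>i\<in>J. bern (\<theta> i) (x i))"
    by (rule prod_ennreal) (simp add: bern_def theta_bounds)
  finally have "emeasure coins {\<omega>. \<forall>i\<in>J. \<omega> i = x i} = ennreal (\<Prod>i\<in>J. bern (\<theta> i) (x i))"
    by (simp add: space_coins)
  then show ?thesis
    by (simp add: measure_def) (intro enn2real_ennreal prod_nonneg, simp add: bern_def theta_bounds)
qed

lemma coin_event: "{\<omega>. \<omega> i = b} \<in> coins.events"
  using measurable_sets[OF coin_measurable, of "{b}" i] by (simp add: vimage_def space_coins)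

text \<open>An edge is decided by three coordinates: those of its ends enter through
  \<open>Q\<close>, and its own coordinate \<open>k\<close> contributes the thinning factor.\<close>

lemma coins_three:
  assumes d: "i \<noteq> j" "i \<noteq> k" "j \<noteq> k"
  shows "coins.prob {\<omega>. Q (\<omega> i) (\<omega> j) \<and> \<omega> k}
    = (\<Sum>t\<in>UNIV. \<Sum>u\<in>UNIV. of_bool (Q t u) * (bern (\<theta> i) t * bern (\<theta> j) u)) * \<theta> k"
proof -
  define E where "E z = {\<omega>. \<omega> i = fst z \<and> \<omega> j = snd z \<and> \<omega> k}" for z :: "bool \<times> bool"
  have E: "coins.prob (E z) = bern (\<theta> i) (fst z) * bern (\<theta> j) (snd z) * \<theta> k" for z
  proof -
    have "E z = {\<omega>. \<forall>x\<in>{i, j, k}. \<omega> x = (if x = i then fst z else if x = j then snd z else True)}"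
      using d by (auto simp: E_def)
    then have "coins.prob (E z) = (\<Prod>x\<in>{i, j, k}. bern (\<theta> x) (if x = i then fst z else if x = j then snd z else True))"
      by (simp only: coins_finite finite.intros)
    then show ?thesis using d by (simp add: bern_def[of _ True])
  qed
  have evE: "E z \<in> coins.events" for z
  proof -
    have "E z = {\<omega>. \<omega> i = fst z} \<inter> {\<omega>. \<omega> j = snd z} \<inter> {\<omega>. \<omega> k = True}" by (auto simp: E_def)
    then show ?thesis by (simp only: sets.Int coin_event)
  qed
  have "coins.prob {\<omega>. Q (\<omega> i) (\<omega> j) \<and> \<omega> k} = coins.prob (\<Union>z\<in>{z. Q (fst z) (snd z)}. E z)"
    by (rule arg_cong[where f = coins.prob]) (auto simp: E_def)
  also have "\<dots> = (\<Sum>z\<in>{z. Q (fst z) (snd z)}. coins.prob (E z))"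
  proof (rule coins.finite_measure_finite_Union)
    show "disjoint_family_on E {z. Q (fst z) (snd z)}" by (auto simp: disjoint_family_on_def E_def)
  qed (use evE in auto)
  also have "\<dots> = (\<Sum>z\<in>UNIV. of_bool (Q (fst z) (snd z)) * coins.prob (E z))"
    by (rule sum.mono_neutral_cong_left) auto
  also have "\<dots> = (\<Sum>t\<in>UNIV. \<Sum>u\<in>UNIV. of_bool (Q t u) * (bern (\<theta> i) t * bern (\<theta> j) u)) * \<theta> k"
    unfolding E UNIV_Times_UNIV[symmetric] sum.cartesian_product'
    by (simp add: sum_distrib_right mult.assoc)
  finally show ?thesis .
qed

definition present :: "(int \<times> nat) set \<Rightarrow> ((int \<times> nat) set \<Rightarrow> bool) \<Rightarrow> bool" where
  "present e \<omega> \<longleftrightarrow> \<omega> e \<and> (\<exists>a b. e = {a, b} \<and> compat (fst a) (\<omega> {a}) (fst b) (\<omega> {b}))"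

definition block_graph :: "((int \<times> nat) set \<Rightarrow> bool) \<Rightarrow> (int \<times> nat) set set" where
  "block_graph \<omega> = {e \<in> edges (ZK n). present e \<omega>}"

lemma present_pair: "present {a, b} \<omega> \<longleftrightarrow> compat (fst a) (\<omega> {a}) (fst b) (\<omega> {b}) \<and> \<omega> {a, b}"
  unfolding present_def doubleton_eq_iff using compat_sym by blast

lemma edge_pair:
  assumes "e \<in> edges (ZK n)"
  obtains a b where "e = {a, b}" "a \<noteq> b"
    "(\<Sum>t\<in>UNIV. \<Sum>u\<in>UNIV. of_bool (compat (fst a) t (fst b) u) *
      (bern (colour_prob (fst a)) t * bern (colour_prob (fst b)) u)) = compat_prob e"
proof -
  from assms consider k u v where "e = {(k, u), (k, v)}" "u \<noteq> v" | k v where "e = {(k, v), (k + 1, v)}"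
    unfolding edges_ZK by (auto simp: layer_edges_def rung_edges_def)
  then show thesis
  proof cases
    case (1 k u v)
    show thesis by (rule that[of "(k, u)" "(k, v)"]) (use 1 compat_prob_layer[of k u v] in auto)
  next
    case (2 k v)
    show thesis by (rule that[of "(k, v)" "(k + 1, v)"]) (use 2 compat_prob_rung[of k v] in auto)
  qed
qed

lemma present_prob:
  assumes "e \<in> edges (ZK n)"
  shows "coins.prob {\<omega>. present e \<omega>} = p"
proof -
  obtain a b where e: "e = {a, b}" "a \<noteq> b"
    and s: "(\<Sum>t\<in>UNIV. \<Sum>u\<in>UNIV. of_bool (compat (fst a) t (fst b) u) *
      (bern (colour_prob (fst a)) t * bern (colour_prob (fst b)) u)) = compat_prob e"
    by (rule edge_pair[OF assms])
  have ns: "\<not> is_singleton {a, b}" using e(2) by (auto simp: is_singleton_def doubleton_eq_iff)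
  have "coins.prob {\<omega>. present e \<omega>} = compat_prob e * \<theta> e"
    unfolding e present_pair
    by (subst coins_three) (use e s in \<open>auto simp: \<theta>_def doubleton_eq_iff\<close>)
  also have "\<dots> = p"
    using compat_prob_ge[of e] sqrt3_bounds ns by (simp add: \<theta>_def e)
  finally show ?thesis .
qed

text \<open>The coordinates on which the edges inside a vertex set \<open>V\<close> depend.\<close>

definition inner :: "(int \<times> nat) set \<Rightarrow> (int \<times> nat) set set" where
  "inner V = {i. i \<noteq> {} \<and> i \<subseteq> V}"

abbreviation cylinder :: "(int \<times> nat) set \<Rightarrow> ((int \<times> nat) set \<Rightarrow> bool) measure" where
  "cylinder V \<equiv> PiM (inner V) (\<lambda>i. measure_pmf (bernoulli_pmf (\<theta> i)))"

lemma present_cylinder: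
  assumes "e \<in> edges (ZK n)" "e \<subseteq> V"
  shows "\<exists>Y\<in>sets (cylinder V). {\<omega>. present e \<omega>} = {\<omega>. restrict \<omega> (inner V) \<in> Y}"
proof -
  obtain a b where e: "e = {a, b}" "a \<noteq> b" by (rule edge_pair[OF assms(1)], rule that)
  have i: "{a} \<in> inner V" "{b} \<in> inner V" "{a, b} \<in> inner V" using assms(2) e by (auto simp: inner_def)
  have m: "(\<lambda>\<omega>. \<omega> j) \<in> measurable (cylinder V) (count_space UNIV)" if "j \<in> inner V" for j
  proof -
    have "(\<lambda>\<omega>. \<omega> j) \<in> measurable (cylinder V) (measure_pmf (bernoulli_pmf (\<theta> j)))"
      using that by (rule measurable_component_singleton)
    then show ?thesis by (simp cong: measurable_cong_sets)
  qed
  have ev: "{\<omega> \<in> space (cylinder V). \<omega> j = t} \<in> sets (cylinder V)" if "j \<in> inner V" for j t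
    using measurable_sets[OF m[OF that], of "{t}"] by (simp add: vimage_def Int_def conj_commute)
  let ?Y = "{\<omega> \<in> space (cylinder V). present e \<omega>}"
  have "?Y = (\<Union>z\<in>{z. compat (fst a) (fst z) (fst b) (snd z)}.
      {\<omega> \<in> space (cylinder V). \<omega> {a} = fst z} \<inter> {\<omega> \<in> space (cylinder V). \<omega> {b} = snd z})
      \<inter> {\<omega> \<in> space (cylinder V). \<omega> {a, b} = True}"
    unfolding e present_pair by auto
  moreover have "\<dots> \<in> sets (cylinder V)"
    by (intro sets.Int sets.finite_UN ev i) auto
  ultimately have "?Y \<in> sets (cylinder V)" by simp
  moreover have "{\<omega>. present e \<omega>} = {\<omega>. restrict \<omega> (inner V) \<in> ?Y}"
    using i unfolding e present_pair by (auto simp: space_PiM)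
  ultimately show ?thesis by blast
qed

text \<open>The edges in \<open>A\<close> read only coordinates inside the vertex set
  \<open>\<Union>A\<close>. Hence 1-independence of the graph reduces to independence of disjoint
  families of coins.\<close>

lemma sigma_cylinder:
  assumes A: "A \<subseteq> edges (ZK n)" and X: "X \<in> edge_sigma (ZK n) A"
  shows "\<exists>Y\<in>sets (cylinder (\<Union>A)). block_graph -` X = {\<omega>. restrict \<omega> (inner (\<Union>A)) \<in> Y}"
  using X unfolding edge_sigma_def
proof (induction rule: sigma_sets.induct)
  case (Basic X)
  then obtain e where e: "e \<in> A" "X = edge_event (ZK n) e" by auto
  have eq: "block_graph -` X = {\<omega>. present e \<omega>}"
    using e A by (auto simp: edge_event_def block_graph_def)
  show ?case unfolding eq by (rule present_cylinder) (use e A in auto)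
next
  case Empty
  show ?case by (rule bexI[of _ "{}"]) auto
next
  case (Compl X)
  then obtain Y where Y: "Y \<in> sets (cylinder (\<Union>A))" "block_graph -` X = {\<omega>. restrict \<omega> (inner (\<Union>A)) \<in> Y}" by blast
  have sp: "restrict \<omega> (inner (\<Union>A)) \<in> space (cylinder (\<Union>A))" for \<omega>
    by (simp add: space_PiM)
  have top: "block_graph -` Pow (edges (ZK n)) = UNIV"
    unfolding block_graph_def by blast
  have eq: "block_graph -` (Pow (edges (ZK n)) - X) = {\<omega>. restrict \<omega> (inner (\<Union>A)) \<in> space (cylinder (\<Union>A)) - Y}"
    unfolding vimage_Diff top Y(2) using sp by blast
  show ?case by (rule bexI[where x = "space (cylinder (\<Union>A)) - Y"], rule eq, rule sets.compl_sets[OF Y(1)])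
next
  case (Union X)
  then obtain Y where Y: "\<And>i. Y i \<in> sets (cylinder (\<Union>A))" "\<And>i. block_graph -` X i = {\<omega>. restrict \<omega> (inner (\<Union>A)) \<in> Y i}"
    by metis
  have eq: "block_graph -` (\<Union>i. X i) = {\<omega>. restrict \<omega> (inner (\<Union>A)) \<in> (\<Union>i. Y i)}"
    unfolding vimage_UN Y(2) by blast
  show ?case by (rule bexI[where x = "\<Union>i. Y i"], rule eq, intro sets.countable_nat_UN image_subsetI Y(1))
qed

lemma coins_indep: "coins.indep_vars (\<lambda>i. measure_pmf (bernoulli_pmf (\<theta> i))) (\<lambda>i \<omega>. \<omega> i) UNIV"
proof (subst coins.indep_vars_iff_distr_eq_PiM)
  show "coins.random_variable (measure_pmf (bernoulli_pmf (\<theta> i))) (\<lambda>\<omega>. \<omega> i)" for i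
    unfolding coins_def by (rule measurable_component_singleton) simp
  show "distr coins (PiM UNIV (\<lambda>i. measure_pmf (bernoulli_pmf (\<theta> i)))) (\<lambda>\<omega>. \<lambda>i\<in>UNIV. \<omega> i)
     = PiM UNIV (\<lambda>i. distr coins (measure_pmf (bernoulli_pmf (\<theta> i))) (\<lambda>\<omega>. \<omega> i))"
    unfolding coins_def P.PiM_component[OF UNIV_I] by (simp add: restrict_UNIV distr_id)
qed simp

lemma cylinder_restrict: "(\<lambda>\<omega>. restrict \<omega> (inner V)) \<in> measurable coins (cylinder V)"
  unfolding coins_def by (rule measurable_restrict_subset) simp

definition block_measure :: "(int \<times> nat) set set measure" where
  "block_measure = distr coins (sigma (Pow (edges (ZK n))) (edge_event (ZK n) ` edges (ZK n))) block_graph"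

lemma edge_event_Pow: "edge_event (ZK n) ` A \<subseteq> Pow (Pow (edges (ZK n)))"
  by (auto simp: edge_event_def)

lemma block_sigma_event:
  assumes "A \<subseteq> edges (ZK n)" "X \<in> edge_sigma (ZK n) A"
  shows "block_graph -` X \<in> coins.events"
proof -
  obtain Y where "Y \<in> sets (cylinder (\<Union>A))" "block_graph -` X = {\<omega>. restrict \<omega> (inner (\<Union>A)) \<in> Y}"
    using sigma_cylinder[OF assms] by blast
  then show ?thesis using measurable_sets[OF cylinder_restrict, of Y "\<Union>A"] by (simp add: vimage_def space_coins)
qed

lemma block_graph_measurable:
  "block_graph \<in> measurable coins (sigma (Pow (edges (ZK n))) (edge_event (ZK n) ` edges (ZK n)))"
proof (rule measurable_measure_of[OF edge_event_Pow])
  show "block_graph \<in> space coins \<rightarrow> Pow (edges (ZK n))" by (auto simp: block_graph_def)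
  fix X assume "X \<in> edge_event (ZK n) ` edges (ZK n)"
  then have "X \<in> edge_sigma (ZK n) (edges (ZK n))" by (auto intro: edge_event_sigma)
  then show "block_graph -` X \<inter> space coins \<in> coins.events" using block_sigma_event[OF order_refl] by (simp add: space_coins)
qed

lemma space_block: "space block_measure = Pow (edges (ZK n))"
  by (simp add: block_measure_def space_measure_of[OF edge_event_Pow])

lemma sets_block: "sets block_measure = edge_sigma (ZK n) (edges (ZK n))"
  by (simp add: block_measure_def sets_measure_of[OF edge_event_Pow] edge_sigma_def)

lemma measure_block: "X \<in> sets block_measure \<Longrightarrow> measure block_measure X = coins.prob (block_graph -` X)"
  unfolding block_measure_def by (subst measure_distr[OF block_graph_measurable]) (auto simp: space_coins)

lemma block_measure_M1p: "block_measure \<in> M1p (ZK n) p"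
proof -
  have ps: "prob_space block_measure"
    unfolding block_measure_def by (rule coins.prob_space_distr[OF block_graph_measurable])
  interpret B: prob_space block_measure by (rule ps)
  have "B.indep_set (edge_sigma (ZK n) A) (edge_sigma (ZK n) B)"
    if AB: "A \<subseteq> edges (ZK n)" "B \<subseteq> edges (ZK n)" "\<Union>A \<inter> \<Union>B = {}" for A B
  proof (rule B.indep_setI)
    show "edge_sigma (ZK n) A \<subseteq> B.events" "edge_sigma (ZK n) B \<subseteq> B.events"
      unfolding sets_block by (intro edge_sigma_mono AB)+
    fix X Y assume X: "X \<in> edge_sigma (ZK n) A" and Y: "Y \<in> edge_sigma (ZK n) B"
    have ev: "X \<in> B.events" "Y \<in> B.events"
      unfolding sets_block using subsetD[OF edge_sigma_mono[OF AB(1)] X] subsetD[OF edge_sigma_mono[OF AB(2)] Y] by auto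
    obtain X' where X': "X' \<in> sets (cylinder (\<Union>A))" "block_graph -` X = {\<omega>. restrict \<omega> (inner (\<Union>A)) \<in> X'}"
      using sigma_cylinder[OF AB(1) X] by blast
    obtain Y' where Y': "Y' \<in> sets (cylinder (\<Union>B))" "block_graph -` Y = {\<omega>. restrict \<omega> (inner (\<Union>B)) \<in> Y'}"
      using sigma_cylinder[OF AB(2) Y] by blast
    \<comment> \<open>The empty set, a subset of both vertex sets, is excluded by the definition of
      \<open>inner\<close>.\<close>
    have "inner (\<Union>A) \<inter> inner (\<Union>B) = {}" using AB(3) by (auto simp: inner_def)
    from coins.indep_var_restrict[OF coins_indep this]
    have "coins.indep_var (cylinder (\<Union>A)) (\<lambda>\<omega>. restrict \<omega> (inner (\<Union>A))) (cylinder (\<Union>B)) (\<lambda>\<omega>. restrict \<omega> (inner (\<Union>B)))"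
      by simp
    from coins.indep_varD[OF this X'(1) Y'(1)]
    have "coins.prob (block_graph -` X \<inter> block_graph -` Y) = coins.prob (block_graph -` X) * coins.prob (block_graph -` Y)"
      unfolding X'(2) Y'(2) by (simp add: space_coins vimage_def Int_def)
    then show "B.prob (X \<inter> Y) = B.prob X * B.prob Y"
      using ev by (simp add: measure_block vimage_Int)
  qed
  then have "one_independent (ZK n) block_measure" by (simp add: one_independent_def)
  moreover have "measure block_measure (edge_event (ZK n) e) = p" if e: "e \<in> edges (ZK n)" for e
  proof -
    have "block_graph -` edge_event (ZK n) e = {\<omega>. present e \<omega>}"
      using e by (auto simp: edge_event_def block_graph_def)
    then show ?thesis using present_prob[OF e] e by (simp add: measure_block sets_block edge_event_sigma)
  qed
  ultimately show ?thesis using ps space_block sets_block by (simp add: M1p_def random_graph_model_def)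
qed

section \<open>Bounded components of the block graph\<close>

lemma colour_layers:
  assumes "colour k t = Some c"
  shows "k \<in> {4 * c - 2..4 * c + 2}"
  using assms mod4_cases[of k] by (auto simp: colour_def split: if_splits; presburger)

lemma block_edge_colour:
  assumes "{a, b} \<in> block_graph \<omega>"
  shows "colour (fst a) (\<omega> {a}) = colour (fst b) (\<omega> {b}) \<or> colour (fst a) (\<omega> {a}) = None \<or> colour (fst b) (\<omega> {b}) = None"
  using assms by (auto simp: block_graph_def present_pair compat_def)

text \<open>An uncoloured vertex lies in an odd layer and is joined only to layers congruent to 2
  modulo 4. Just one of the two adjacent layers is of this kind, and the rung to it is the only
  possible edge.\<close>

lemma block_leaf:
  assumes "{a, b} \<in> block_graph \<omega>" "{a, c} \<in> block_graph \<omega>" and none: "colour (fst a) (\<omega> {a}) = None"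
  shows "b = c"
proof -
  have r: "fst a mod 4 = 1 \<or> fst a mod 4 = 3"
    using none mod4_cases[of "fst a"] by (auto simp: colour_def split: if_splits)
  have nb: "b = (if fst a mod 4 = 1 then fst a + 1 else fst a - 1, snd a)" if "{a, b} \<in> block_graph \<omega>" for b
  proof -
    have b2: "fst b mod 4 = 2"
      using that none r by (auto simp: block_graph_def present_pair compat_def)
    have "{a, b} \<in> edges (ZK n)" using that by (simp add: block_graph_def)
    then have "(fst b = fst a \<or> fst b = fst a + 1 \<or> fst b = fst a - 1) \<and> (fst b \<noteq> fst a \<longrightarrow> snd b = snd a)"
      unfolding edges_ZK by (auto simp: layer_edges_def rung_edges_def doubleton_eq_iff)
    then show ?thesis using b2 r
      by (cases a; cases b) (auto; presburger)
  qed
  show ?thesis using nb[OF assms(1)] nb[OF assms(2)] by simp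
qed

text \<open>Inner vertices of a path are not leaves, so they are coloured, and all with the same
  colour. A colour occurs in only five layers, that is on at most \<open>5 * n\<close> vertices, but
  a path of length \<open>5 * n + 2\<close> has \<open>5 * n + 1\<close> inner vertices.\<close>

lemma block_no_long_path: "block_graph \<omega> \<notin> path_event (ZK n) (5 * n + 2)"
proof
  define l where "l = 5 * n + 2"
  define col where "col a = colour (fst a) (\<omega> {a})" for a
  assume "block_graph \<omega> \<in> path_event (ZK n) (5 * n + 2)"
  then obtain vs where vs: "length vs = l + 1" "distinct vs" "\<And>i. i < l \<Longrightarrow> {vs ! i, vs ! (i + 1)} \<in> block_graph \<omega>"
    by (auto simp: path_event_def l_def)
  have some: "col (vs ! i) \<noteq> None" if i: "1 \<le> i" "i < l" for i
  proof
    assume "col (vs ! i) = None"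
    moreover have "{vs ! i, vs ! (i - 1)} \<in> block_graph \<omega>" using vs(3)[of "i - 1"] i by (simp add: insert_commute)
    moreover have "{vs ! i, vs ! (i + 1)} \<in> block_graph \<omega>" using vs(3)[of i] i by simp
    ultimately have "vs ! (i - 1) = vs ! (i + 1)" using block_leaf unfolding col_def by blast
    then show False using vs(1,2) i by (simp add: nth_eq_iff_index_eq)
  qed
  have const: "1 \<le> i \<Longrightarrow> i < l \<Longrightarrow> col (vs ! i) = col (vs ! 1)" for i
  proof (induction i)
    case (Suc i)
    show ?case
    proof (cases "i = 0")
      case False
      then show ?thesis
        using Suc block_edge_colour[OF vs(3)[of i, simplified]] some[of i] some[of "Suc i"] by (auto simp: col_def)
    qed simp
  qed simp
  obtain c where c: "col (vs ! 1) = Some c" using some[of 1] by (auto simp: l_def)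
  have "(!) vs ` {1..<l} \<subseteq> {4 * c - 2..4 * c + 2} \<times> {..<n}"
  proof
    fix a assume "a \<in> (!) vs ` {1..<l}"
    then obtain i where i: "a = vs ! i" "1 \<le> i" "i < l" by auto
    have "fst a \<in> {4 * c - 2..4 * c + 2}"
      using const[OF i(2,3)] c colour_layers unfolding col_def i(1) by simp
    moreover have "{a, vs ! (i + 1)} \<in> edges (ZK n)" using vs(3)[OF i(3)] i(1) by (simp add: block_graph_def)
    then have "snd a < n" unfolding edges_ZK by (auto simp: layer_edges_def rung_edges_def doubleton_eq_iff)
    ultimately show "a \<in> {4 * c - 2..4 * c + 2} \<times> {..<n}" by (auto simp: mem_Times_iff)
  qed
  then have "card ((!) vs ` {1..<l}) \<le> card ({4 * c - 2..4 * c + 2} \<times> {..<n})" by (intro card_mono) auto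
  also have "\<dots> = 5 * n" by (simp add: card_cartesian_product)
  also have "card ((!) vs ` {1..<l}) = l - 1"
    using vs by (subst card_image) (auto intro!: inj_on_nth)
  finally show False by (simp add: l_def)
qed

lemma block_path_null: "measure block_measure (path_event (ZK n) (5 * n + 2)) = 0"
\<comment> \<open>On a set that is not measurable, \<open>measure\<close> has the value 0 by
  default.\<close>
proof (cases "path_event (ZK n) (5 * n + 2) \<in> sets block_measure")
  case True
  moreover have "block_graph -` path_event (ZK n) (5 * n + 2) = {}" using block_no_long_path by auto
  ultimately show ?thesis by (simp add: measure_block)
qed (rule measure_notin_sets)

end

section \<open>Lower bound for admissible parameters and the limit\<close>

lemma long_path_parameter_lower:
  assumes "p \<in> long_path_parameters n"
  shows "4 - 2 * sqrt 3 \<le> p"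
proof (rule ccontr)
  assume "\<not> 4 - 2 * sqrt 3 \<le> p"
  then interpret block_model n p by unfold_locales (use assms in \<open>auto simp: long_path_parameters_def\<close>)
  have "0 < measure block_measure (path_event (ZK n) (5 * n + 2))"
    using assms block_measure_M1p unfolding long_path_parameters_def by blast
  then show False unfolding block_path_null by simp
qed

theorem theorem9:
  shows "(\<lambda>n. p1LP (cart_prod Z_graph (K_graph n))) \<longlonglongrightarrow> 4 - 2 * sqrt 3"
proof (rule order_tendstoI)
  have Inf: "p1LP (ZK n) = Inf (long_path_parameters n)" for n
    by (simp add: p1LP_def long_path_parameters_def)
  have "4 - 2 * sqrt 3 < (1::real)" using sqrt3_bounds by simp
  then have ev: "\<forall>\<^sub>F n in sequentially. 4 - 2 * sqrt 3 \<le> p1LP (ZK n) \<and> p1LP (ZK n) \<le> p"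
    if p: "4 - 2 * sqrt 3 < p" "p \<le> 1" for p
  proof -
    obtain N where N: "\<And>n. n \<ge> N \<Longrightarrow> p \<in> long_path_parameters n"
      using long_path_parameter_upper[OF p] by blast
    have bdd: "bdd_below (long_path_parameters n)" for n
      by (rule bdd_belowI[of _ 0]) (auto simp: long_path_parameters_def)
    have "4 - 2 * sqrt 3 \<le> p1LP (ZK n) \<and> p1LP (ZK n) \<le> p" if "n \<ge> N" for n
      unfolding Inf
    proof
      show "Inf (long_path_parameters n) \<le> p" by (rule cInf_lower[OF N[OF that] bdd])
      show "4 - 2 * sqrt 3 \<le> Inf (long_path_parameters n)"
        by (rule cInf_greatest) (use N[OF that] long_path_parameter_lower in auto)
    qed
    then show ?thesis by (auto simp: eventually_sequentially)
  qed
  show "\<forall>\<^sub>F n in sequentially. a < p1LP (cart_prod Z_graph (K_graph n))" if "a < 4 - 2 * sqrt 3" for a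
    \<comment> \<open>The value \<open>p = 1\<close> is eventually admissible, so the set is not
      empty and its infimum inherits the lower bound of its members.\<close>
    using ev[of 1] by (rule eventually_mono) (use that sqrt3_bounds in auto)
  show "\<forall>\<^sub>F n in sequentially. p1LP (cart_prod Z_graph (K_graph n)) < a" if a: "4 - 2 * sqrt 3 < a" for a
  proof -
    obtain p where p: "4 - 2 * sqrt 3 < p" "p < min a 1"
      using a sqrt3_bounds dense[of "4 - 2 * sqrt 3" "min a 1"] by auto
    then have "p \<le> 1" by simp
    from ev[OF p(1) this] show ?thesis by (rule eventually_mono) (use p in auto)
  qed
qed

end
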